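(* Consider a statistical model that is semi-regular at the realization parameter $\theta_*=0$ (the rank $r$ of the Fisher information matrix at $0$ satisfies $r>0$), and suppose that conditions (A1), (A2), (A3) of the context hold, with the integer $m\ge1$ defined there. Let $O$ be the origin of $\mathbb{R}^d$ and let $g$ be the following composition of blow-ups: (a) perform one blow-up centered at the origin of $\mathbb{R}^d$; (b) in the charts in which the exceptional surface from (a) is $\{\theta_i=0\}$ with $i\in\{r+1,\ldots,d\}$, further perform a blow-up centered at the subvariety $\{\theta_1=\cdots=\theta_r=\theta_i=0\}$; (c) in the charts in which the exceptional surface from (b) is $\{\theta_i=0\}$ (same $i$), repeat (b), until the total number of blow-ups is $m$. Thus after the $m$-th blow-up, in the chart in which the exceptional surface is $\{\theta_i=0\}$ ($i=r+1,\ldots,d$), $g=g_i$ is the map $(\theta'_1,\ldots,\theta'_{i-1},\theta_i,\theta'_{i+1},\ldots,\theta'_d)\mapsto(\theta_1,\ldots,\theta_d)$ with $\theta_k=\theta_i^m\theta'_k$ for $1\le k\le r$ and $\theta_k=\theta_i\theta'_k$ for $r+1\le k\le d$, $k\ne i$. Let $U_0=g^{-1}(O)$ and let $S\subset U_0$ be defined in these local coordinates by $$S=\bigcup_{i=r+1}^d\left\{(\theta'_1,\ldots,\theta'_{i-1},\theta_i,\theta'_{i+1},\ldots,\theta'_d)\ \middle|\ (\theta'_1,\ldots,\theta'_r,\theta_i)=0,\ F_m(X|\theta'_{r+1},\ldots,\theta'_{i-1},1,\theta'_{i+1},\ldots,\theta'_d)=0\ \text{a.s.}\right\}.$$ Then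 at every point of $U_0\setminus S$ a normal crossing of $K(\theta)$ is obtained via $g$, and $$\inf_{Q\in U_0\setminus S}\left\{\min_{i=1,\ldots,d}\frac{h_i^{(Q)}+1}{k_i^{(Q)}}\right\}=\frac{d-r+rm}{2m},$$ with multiplicity $1$. In particular, if every $(\theta_{r+1},\ldots,\theta_d)\ne0$ satisfies alternative (ii) of (A3), then the real log canonical threshold $\lambda_O$ of $K$ at the origin $O$ is $$\lambda_O=\frac{d-r+rm}{2m}$$ with multiplicity $1$, and in this case the only point in a neighborhood of the origin in $\Theta$ satisfying $K(\theta)=0$ is the origin itself.
   Context: Setting. $p(x|\theta)$, $x\in\chi$, is a statistical model (family of probability densities) with parameter $\theta=(\theta_1,\ldots,\theta_d)\in\Theta\subset\mathbb{R}^d$, $d\ge1$. The true density $q$ is realizable: there is $\theta_*$ with $q(x)=p(x|\theta_* )$ a.s.; by translation $\theta_*=0$. $X$ is a random variable with density $q$ and $\mathbb{E}_X$ is expectation with respect to $X$. The log-likelihood ratio function is $f(x|\theta)=\log\frac{p(x|\theta_* )}{p(x|\theta)}$ and the Kullback-Leibler divergence is $K(\theta)=\mathbb{E}_X[f(X|\theta)]$. Standing assumptions: $f$ is $L^2$-integrable and analytic in $\theta$ around $\theta_*$, $K$ is analytic around $\theta_*$, and expectations and partial derivatives in $\theta$ can be interchanged. The Fisher information matrix at $\theta_*$ is the $d\times d$ matrix with entries $\mathrm{Cov}\left(\partial_{\theta_i}\log p(X|\theta)|_{\theta=\theta_*},\ \partial_{\theta_j}\log p(X|\theta)|_{\theta=\theta_*}\right)$,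 and $r$ denotes its rank. Notation. For a subset of the coordinates, written $\theta_{a},\ldots,\theta_{b}$, and $n\ge 1$, $$F_n(X|\theta_a,\ldots,\theta_b)=\sum_{\substack{i_a+\cdots+i_b=n\\ i_a,\ldots,i_b\in\mathbb{Z}_{\ge0}}}\frac{1}{i_a!\cdots i_b!}\left.\frac{\partial^n f(X|\theta)}{\partial\theta_a^{i_a}\cdots\partial\theta_b^{i_b}}\right|_{\theta=0}\theta_a^{i_a}\cdots\theta_b^{i_b}.$$ Random variables are called linearly independent if no nontrivial real linear combination of them is zero almost surely. (A1) The $r$ random variables $\left.\frac{\partial f(X|\theta)}{\partial\theta_1}\right|_{\theta=0},\ldots,\left.\frac{\partial f(X|\theta)}{\partial\theta_r}\right|_{\theta=0}$ are linearly independent. (A2) For the remaining $d-r$ parameters, $m\ge1$ is the largest integer such that $F_1(X|\theta_{r+1},\ldots,\theta_d)=\cdots=F_{m-1}(X|\theta_{r+1},\ldots,\theta_d)=0$ a.s. Convention: the value $m=1$ is treated as the case $r=d$ (no remaining parameters). (A3) For each $(\theta_{r+1},\ldots,\theta_d)\neq0$ one of the following holds: (i) $F_m(X|\theta_{r+1},\ldots,\theta_d)=0$ a.s.; (ii) $F_m(X|\theta_{r+1},\ldots,\theta_d)$ together with the $r$ random variables in (A1) are linearly independent. By convention, for $m=1$ alternative (ii) is regarded as always satisfied. Normal crossings and real log canonical threshold. For a proper analytic map $g:U\to W$ from a real analytic manifold onto a neighborhood $W$ of $O$, a normal crossing of $K$ is obtained at $Q\in U_0$ if there are local coordinates $u=(u_1,\ldots,u_d)$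 centered at $Q$ with $K(g(u))=a(u)u_1^{k_1}\cdots u_d^{k_d}$ and $|g'(u)|=|b(u)u_1^{h_1}\cdots u_d^{h_d}|$ (Jacobian determinant), where $k_i=k_i^{(Q)}$, $h_i=h_i^{(Q)}$ are non-negative integers and $a,b$ are analytic near $0$ with $a(0)\neq0$, $b(0)\neq0$. One sets $(h_i+1)/k_i=\infty$ if $k_i=0$. If $g$ is a resolution of singularities of $K$ near $O$ (proper, an analytic isomorphism away from $g^{-1}(K^{-1}(0))$, and giving a normal crossing at every point of $g^{-1}(K^{-1}(0))$), then the real log canonical threshold of $K$ at $O$ is $\lambda_O=\inf_Q\min_i\frac{h_i^{(Q)}+1}{k_i^{(Q)}}$ (independent of $g$). The multiplicity is the maximum, over points $Q$, of the number of indices $i$ for which $(h_i^{(Q)}+1)/k_i^{(Q)}$ equals the infimum. *)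

theory Defs
  imports "HOL-Probability.Probability"
begin

section \<open>Partial derivatives and real analytic functions of several variables\<close>

definition partial_deriv :: "'d::finite \<Rightarrow> (real^'d \<Rightarrow> real) \<Rightarrow> real^'d \<Rightarrow> real" where
  "partial_deriv i h \<theta> = deriv (\<lambda>t. h (\<theta> + t *\<^sub>R axis i 1)) 0"

text \<open>The derivative for a multi-index \<open>\<alpha>\<close>. The coordinates are processed in some fixed order,
  which is immaterial for the analytic functions considered below.\<close>

definition multi_deriv :: "('d::finite \<Rightarrow> nat) \<Rightarrow> (real^'d \<Rightarrow> real) \<Rightarrow> real^'d \<Rightarrow> real" where
  "multi_deriv \<alpha> h =
     fold (\<lambda>i. partial_deriv i ^^ \<alpha> i) (SOME is. distinct is \<and> set is = UNIV) h"

definition real_analytic_at :: "(real^'d::finite \<Rightarrow> real) \<Rightarrow> real^'d \<Rightarrow> bool" where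
  "real_analytic_at h x \<longleftrightarrow>
     (\<exists>(c :: ('d \<Rightarrow> nat) \<Rightarrow> real) e. e > 0 \<and>
        (\<forall>y. (\<forall>i. \<bar>y $ i - x $ i\<bar> < e) \<longrightarrow>
           ((\<lambda>\<alpha>. c \<alpha> * (\<Prod>i\<in>UNIV. (y $ i - x $ i) ^ \<alpha> i)) has_sum h y) UNIV))"

definition real_analytic_on :: "(real^'d::finite \<Rightarrow> real) \<Rightarrow> (real^'d) set \<Rightarrow> bool" where
  "real_analytic_on h S \<longleftrightarrow> (\<forall>x\<in>S. real_analytic_at h x)"

definition analytic_map_on :: "(real^'d::finite \<Rightarrow> real^'d) \<Rightarrow> (real^'d) set \<Rightarrow> bool" where
  "analytic_map_on F S \<longleftrightarrow> (\<forall>i. real_analytic_on (\<lambda>x. F x $ i) S)"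

definition analytic_diffeo_on :: "(real^'d::finite \<Rightarrow> real^'d) \<Rightarrow> (real^'d) set \<Rightarrow> bool" where
  "analytic_diffeo_on F V \<longleftrightarrow>
     open V \<and> open (F ` V) \<and> inj_on F V \<and>
     analytic_map_on F V \<and> analytic_map_on (inv_into V F) (F ` V)"


section \<open>Real analytic manifolds given by an atlas\<close>

text \<open>A chart is a pair of an open set of coordinate values and a parametrization, which maps
  coordinate values to points. The dimension is \<open>CARD('d)\<close>.\<close>

type_synonym ('d, 'p) atlas = "((real^'d) set \<times> (real^'d \<Rightarrow> 'p)) set"

definition atlas_points :: "('d::finite, 'p) atlas \<Rightarrow> 'p set" where
  "atlas_points \<A> = (\<Union>(V, \<phi>)\<in>\<A>. \<phi> ` V)"

definition atlas_topology :: "('d::finite, 'p) atlas \<Rightarrow> 'p topology" where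
  "atlas_topology \<A> =
     topology (\<lambda>S. S \<subseteq> atlas_points \<A> \<and> (\<forall>(V, \<phi>)\<in>\<A>. open {u \<in> V. \<phi> u \<in> S}))"

definition analytic_manifold :: "('d::finite, 'p) atlas \<Rightarrow> bool" where
  "analytic_manifold \<A> \<longleftrightarrow>
     (\<forall>(V, \<phi>)\<in>\<A>. open V \<and> inj_on \<phi> V) \<and>
     (\<forall>(V, \<phi>)\<in>\<A>. \<forall>(V', \<phi>')\<in>\<A>.
        open {u \<in> V. \<phi> u \<in> \<phi>' ` V'} \<and>
        analytic_map_on (inv_into V' \<phi>' \<circ> \<phi>) {u \<in> V. \<phi> u \<in> \<phi>' ` V'}) \<and>
     Hausdorff_space (atlas_topology \<A>) \<and> second_countable (atlas_topology \<A>)"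

lemma istopology_atlas:
  assumes "\<And>V \<phi>. (V, \<phi>) \<in> \<A> \<Longrightarrow> open V"
  shows "istopology (\<lambda>S. S \<subseteq> atlas_points \<A> \<and> (\<forall>(V, \<phi>)\<in>\<A>. open {u \<in> V. \<phi> u \<in> S}))"
  unfolding istopology_def
proof (intro conjI allI impI)
  fix S T
  assume S: "S \<subseteq> atlas_points \<A> \<and> (\<forall>(V, \<phi>)\<in>\<A>. open {u \<in> V. \<phi> u \<in> S})"
    and T: "T \<subseteq> atlas_points \<A> \<and> (\<forall>(V, \<phi>)\<in>\<A>. open {u \<in> V. \<phi> u \<in> T})"
  show "S \<inter> T \<subseteq> atlas_points \<A>" using S by blast
  have "{u \<in> V. \<phi> u \<in> S \<inter> T} = {u \<in> V. \<phi> u \<in> S} \<inter> {u \<in> V. \<phi> u \<in> T}"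
    for V and \<phi> :: "real^'a \<Rightarrow> 'b" by blast
  then show "\<forall>(V, \<phi>)\<in>\<A>. open {u \<in> V. \<phi> u \<in> S \<inter> T}" using S T by (auto intro!: open_Int)
next
  fix \<K>
  assume K: "\<forall>S\<in>\<K>. S \<subseteq> atlas_points \<A> \<and> (\<forall>(V, \<phi>)\<in>\<A>. open {u \<in> V. \<phi> u \<in> S})"
  show "\<Union>\<K> \<subseteq> atlas_points \<A>" using K by blast
  have "{u \<in> V. \<phi> u \<in> \<Union>\<K>} = (\<Union>S\<in>\<K>. {u \<in> V. \<phi> u \<in> S})"
    for V and \<phi> :: "real^'a \<Rightarrow> 'b" by blast
  then show "\<forall>(V, \<phi>)\<in>\<A>. open {u \<in> V. \<phi> u \<in> \<Union>\<K>}" using K by (auto intro!: open_UN)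
qed


section \<open>Normal crossings and the real log canonical threshold\<close>

text \<open>\<open>k\<close> and \<open>h\<close> are exponents of a normal crossing of \<open>K\<close> at the point \<open>Q\<close>. The local
  coordinates centered at \<open>Q\<close> are \<open>\<phi> \<circ> \<psi>\<close>, where \<open>\<phi>\<close> is a chart of the atlas and \<open>\<psi>\<close> an
  analytic change of coordinates.\<close>

definition normal_crossing ::
  "('d::finite, 'p) atlas \<Rightarrow> ('p \<Rightarrow> real^'d) \<Rightarrow> (real^'d \<Rightarrow> real) \<Rightarrow> 'p \<Rightarrow>
     ('d \<Rightarrow> nat) \<Rightarrow> ('d \<Rightarrow> nat) \<Rightarrow> bool" where
  "normal_crossing \<A> g K Q k h \<longleftrightarrow>
     (\<exists>(D, \<phi>)\<in>\<A>. \<exists>V \<psi> a b.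
        analytic_diffeo_on \<psi> V \<and> \<psi> ` V \<subseteq> D \<and> 0 \<in> V \<and> \<phi> (\<psi> 0) = Q \<and>
        real_analytic_on a V \<and> real_analytic_on b V \<and> a 0 \<noteq> 0 \<and> b 0 \<noteq> 0 \<and>
        (\<forall>u\<in>V. K (g (\<phi> (\<psi> u))) = a u * (\<Prod>i\<in>UNIV. u $ i ^ k i) \<and>
           \<bar>det (jacobian (g \<circ> \<phi> \<circ> \<psi>) (at u))\<bar> = \<bar>b u * (\<Prod>i\<in>UNIV. u $ i ^ h i)\<bar>))"

definition nc_ratio :: "('d \<Rightarrow> nat) \<Rightarrow> ('d \<Rightarrow> nat) \<Rightarrow> 'd \<Rightarrow> ereal" where
  "nc_ratio k h i = (if k i = 0 then \<infinity> else ereal (real (h i + 1) / real (k i)))"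

definition nc_exponents ::
  "('d::finite, 'p) atlas \<Rightarrow> ('p \<Rightarrow> real^'d) \<Rightarrow> (real^'d \<Rightarrow> real) \<Rightarrow> 'p set \<Rightarrow>
     (('d \<Rightarrow> nat) \<times> ('d \<Rightarrow> nat)) set" where
  "nc_exponents \<A> g K T = {(k, h). \<exists>Q\<in>T. normal_crossing \<A> g K Q k h}"

definition nc_threshold ::
  "('d::finite, 'p) atlas \<Rightarrow> ('p \<Rightarrow> real^'d) \<Rightarrow> (real^'d \<Rightarrow> real) \<Rightarrow> 'p set \<Rightarrow> ereal" where
  "nc_threshold \<A> g K T = (INF (k, h)\<in>nc_exponents \<A> g K T. Min (range (nc_ratio k h)))"

definition nc_multiplicity ::
  "('d::finite, 'p) atlas \<Rightarrow> ('p \<Rightarrow> real^'d) \<Rightarrow> (real^'d \<Rightarrow> real) \<Rightarrow> 'p set \<Rightarrow> nat" where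
  "nc_multiplicity \<A> g K T =
     Max ((\<lambda>(k, h). card {i. nc_ratio k h i = nc_threshold \<A> g K T}) ` nc_exponents \<A> g K T)"

definition resolution_of_singularities ::
  "('d::finite, 'p) atlas \<Rightarrow> ('p \<Rightarrow> real^'d) \<Rightarrow> (real^'d) set \<Rightarrow> (real^'d \<Rightarrow> real) \<Rightarrow> bool" where
  "resolution_of_singularities \<A> g W K \<longleftrightarrow>
     open W \<and> real_analytic_on K W \<and> analytic_manifold \<A> \<and>
     g ` atlas_points \<A> = W \<and> (\<forall>(V, \<phi>)\<in>\<A>. analytic_map_on (g \<circ> \<phi>) V) \<and>
     proper_map (atlas_topology \<A>) (top_of_set W) g \<and>
     \<comment> \<open>analytic isomorphism away from the zeros of \<open>K\<close>\<close>
     bij_betw g {Q \<in> atlas_points \<A>. K (g Q) \<noteq> 0} {\<theta> \<in> W. K \<theta> \<noteq> 0} \<and>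
     (\<forall>(V, \<phi>)\<in>\<A>. analytic_diffeo_on (g \<circ> \<phi>) {u \<in> V. K (g (\<phi> u)) \<noteq> 0}) \<and>
     (\<forall>Q\<in>atlas_points \<A>. K (g Q) = 0 \<longrightarrow> (\<exists>k h. normal_crossing \<A> g K Q k h))"

text \<open>\<open>lct\<close> is the real log canonical threshold of \<open>K\<close> at \<open>x\<close> and \<open>\<mu>\<close> its multiplicity, computed
  from a resolution of \<open>K\<close> near \<open>x\<close>; they do not depend on the resolution. Every second countable
  manifold of dimension \<open>CARD('d)\<close> has a copy whose points are of the type used here, since it is
  a quotient of countably many copies of open sets of coordinate values.\<close>

definition has_rlct :: "(real^'d::finite \<Rightarrow> real) \<Rightarrow> real^'d \<Rightarrow> ereal \<Rightarrow> nat \<Rightarrow> bool" where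
  "has_rlct K x lct \<mu> \<longleftrightarrow>
     (\<exists>(\<A> :: ('d, ('d list \<times> (real^'d)) set) atlas) g W.
        x \<in> W \<and> resolution_of_singularities \<A> g W K \<and>
        lct = nc_threshold \<A> g K {Q \<in> atlas_points \<A>. g Q = x} \<and>
        \<mu> = nc_multiplicity \<A> g K {Q \<in> atlas_points \<A>. g Q = x})"


section \<open>Statistical models\<close>

text \<open>\<open>X\<close> is a random variable on \<open>N\<close> with values in \<open>M\<close>. The true parameter is \<open>0\<close>.\<close>

definition loglik_ratio :: "('x \<Rightarrow> real^'d::finite \<Rightarrow> real) \<Rightarrow> 'x \<Rightarrow> real^'d \<Rightarrow> real" where
  "loglik_ratio p x \<theta> = ln (p x 0 / p x \<theta>)"

definition kl_div :: "'w measure \<Rightarrow> ('w \<Rightarrow> 'x) \<Rightarrow> ('x \<Rightarrow> real^'d::finite \<Rightarrow> real) \<Rightarrow> real^'d \<Rightarrow> real" where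
  "kl_div N X p \<theta> = (\<integral>\<omega>. loglik_ratio p (X \<omega>) \<theta> \<partial>N)"

definition covariance :: "'w measure \<Rightarrow> ('w \<Rightarrow> real) \<Rightarrow> ('w \<Rightarrow> real) \<Rightarrow> real" where
  "covariance N Y Z = (\<integral>\<omega>. (Y \<omega> - (\<integral>\<omega>'. Y \<omega>' \<partial>N)) * (Z \<omega> - (\<integral>\<omega>'. Z \<omega>' \<partial>N)) \<partial>N)"

definition fisher_information ::
  "'w measure \<Rightarrow> ('w \<Rightarrow> 'x) \<Rightarrow> ('x \<Rightarrow> real^'d::finite \<Rightarrow> real) \<Rightarrow> real^'d^'d" where
  "fisher_information N X p =
     (\<chi> i j. covariance N (\<lambda>\<omega>. partial_deriv i (\<lambda>\<theta>. ln (p (X \<omega>) \<theta>)) 0)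
                          (\<lambda>\<omega>. partial_deriv j (\<lambda>\<theta>. ln (p (X \<omega>) \<theta>)) 0))"

text \<open>The standing assumptions. Positivity of the densities makes the log-likelihood ratio well
  defined. Interchange of expectation and partial derivatives is assumed for the log-likelihood
  ratio and for the likelihood ratio \<open>p(X|\<theta>) / q(X)\<close>; the latter is differentiation under the
  integral sign in \<open>\<integral> p(x|\<theta>) dx = 1\<close>.\<close>

locale realizable_model = prob_space N
  for N :: "'w measure" and M :: "'x measure" and X :: "'w \<Rightarrow> 'x"
    and p :: "'x \<Rightarrow> real^'d::finite \<Rightarrow> real" and q :: "'x \<Rightarrow> real" and \<Theta> :: "(real^'d) set" +
  assumes density_measurable: "\<theta> \<in> \<Theta> \<Longrightarrow> (\<lambda>x. p x \<theta>) \<in> borel_measurable M"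
    and density_pos: "\<theta> \<in> \<Theta> \<Longrightarrow> x \<in> space M \<Longrightarrow> p x \<theta> > 0"
    and density_integral: "\<theta> \<in> \<Theta> \<Longrightarrow> (\<integral>\<^sup>+x. ennreal (p x \<theta>) \<partial>M) = 1"
    and true_density: "distributed N M X (\<lambda>x. ennreal (q x))"
    and realizable: "AE x in M. q x = p x 0"
    and regularity: "\<exists>W \<subseteq> \<Theta>. open W \<and> 0 \<in> W \<and>
      (\<forall>\<theta>\<in>W. integrable N (\<lambda>\<omega>. (loglik_ratio p (X \<omega>) \<theta>)\<^sup>2)) \<and>
      (AE \<omega> in N. real_analytic_on (loglik_ratio p (X \<omega>)) W) \<and>
      real_analytic_on (kl_div N X p) W \<and>
      (\<forall>\<theta>\<in>W. \<forall>\<alpha>. integrable N (\<lambda>\<omega>. multi_deriv \<alpha> (loglik_ratio p (X \<omega>)) \<theta>) \<and>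
         multi_deriv \<alpha> (kl_div N X p) \<theta> =
           expectation (\<lambda>\<omega>. multi_deriv \<alpha> (loglik_ratio p (X \<omega>)) \<theta>)) \<and>
      (\<forall>\<theta>\<in>W. \<forall>\<alpha>. integrable N (\<lambda>\<omega>. multi_deriv \<alpha> (\<lambda>\<theta>'. p (X \<omega>) \<theta>' / q (X \<omega>)) \<theta>) \<and>
         multi_deriv \<alpha> (\<lambda>\<theta>'. expectation (\<lambda>\<omega>. p (X \<omega>) \<theta>' / q (X \<omega>))) \<theta> =
           expectation (\<lambda>\<omega>. multi_deriv \<alpha> (\<lambda>\<theta>'. p (X \<omega>) \<theta>' / q (X \<omega>)) \<theta>))"


section \<open>Semi-regularity conditions\<close>

text \<open>Throughout, a set \<open>R\<close> of coordinates plays the role of \<open>{1, \<dots>, r}\<close>, and its complement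
  that of \<open>{r + 1, \<dots>, d}\<close>.\<close>

text \<open>The form \<open>F\<^sub>n(x|\<theta>\<^sub>A)\<close> of degree \<open>n\<close> in the coordinates \<open>A\<close>, for one value \<open>x\<close> of \<open>X\<close>, where
  \<open>f\<close> is the log-likelihood ratio at \<open>x\<close>. Coordinates of \<open>\<theta>\<close> outside \<open>A\<close> are ignored.\<close>

definition taylor_form ::
  "(real^'d::finite \<Rightarrow> real) \<Rightarrow> nat \<Rightarrow> 'd set \<Rightarrow> real^'d \<Rightarrow> real" where
  "taylor_form f n A \<theta> =
     (\<Sum>\<alpha> | (\<forall>i. i \<notin> A \<longrightarrow> \<alpha> i = 0) \<and> (\<Sum>i\<in>A. \<alpha> i) = n.
        1 / (\<Prod>i\<in>A. fact (\<alpha> i)) * multi_deriv \<alpha> f 0 * (\<Prod>i\<in>A. \<theta> $ i ^ \<alpha> i))"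

definition lin_indep_rvs :: "'w measure \<Rightarrow> 'i set \<Rightarrow> ('i \<Rightarrow> 'w \<Rightarrow> real) \<Rightarrow> bool" where
  "lin_indep_rvs N I Y \<longleftrightarrow>
     (\<forall>c :: 'i \<Rightarrow> real. (AE \<omega> in N. (\<Sum>i\<in>I. c i * Y i \<omega>) = 0) \<longrightarrow> (\<forall>i\<in>I. c i = 0))"

definition condition_A1 ::
  "'w measure \<Rightarrow> ('w \<Rightarrow> 'x) \<Rightarrow> ('x \<Rightarrow> real^'d::finite \<Rightarrow> real) \<Rightarrow> 'd set \<Rightarrow> bool" where
  "condition_A1 N X p R \<longleftrightarrow>
     lin_indep_rvs N R (\<lambda>i \<omega>. partial_deriv i (loglik_ratio p (X \<omega>)) 0)"

definition vanishing_below ::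
  "'w measure \<Rightarrow> ('w \<Rightarrow> 'x) \<Rightarrow> ('x \<Rightarrow> real^'d::finite \<Rightarrow> real) \<Rightarrow> 'd set \<Rightarrow> nat \<Rightarrow> bool" where
  "vanishing_below N X p R m \<longleftrightarrow>
     (\<forall>n. 1 \<le> n \<and> n < m \<longrightarrow>
        (\<forall>\<theta>. AE \<omega> in N. taylor_form (loglik_ratio p (X \<omega>)) n (- R) \<theta> = 0))"

text \<open>By convention, \<open>m = 1\<close> is the case without remaining parameters; all forms are then empty
  sums, and there is no largest integer to speak of.\<close>

definition condition_A2 ::
  "'w measure \<Rightarrow> ('w \<Rightarrow> 'x) \<Rightarrow> ('x \<Rightarrow> real^'d::finite \<Rightarrow> real) \<Rightarrow> 'd set \<Rightarrow> nat \<Rightarrow> bool" where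
  "condition_A2 N X p R m \<longleftrightarrow> m \<ge> 1 \<and> (m = 1 \<longleftrightarrow> R = UNIV) \<and>
     (R \<noteq> UNIV \<longrightarrow> vanishing_below N X p R m \<and> (\<forall>m'. vanishing_below N X p R m' \<longrightarrow> m' \<le> m))"

text \<open>\<open>F\<^sub>m\<close> (index \<open>None\<close>) and the first derivatives in the directions \<open>R\<close> are linearly independent.\<close>

definition form_independent ::
  "'w measure \<Rightarrow> ('w \<Rightarrow> 'x) \<Rightarrow> ('x \<Rightarrow> real^'d::finite \<Rightarrow> real) \<Rightarrow> 'd set \<Rightarrow> nat \<Rightarrow> real^'d \<Rightarrow> bool" where
  "form_independent N X p R m \<theta> \<longleftrightarrow>
     lin_indep_rvs N (insert None (Some ` R))
       (\<lambda>k \<omega>. case k of None \<Rightarrow> taylor_form (loglik_ratio p (X \<omega>)) m (- R) \<theta>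
                      | Some i \<Rightarrow> partial_deriv i (loglik_ratio p (X \<omega>)) 0)"

text \<open>For \<open>m = 1\<close>, that is \<open>R = UNIV\<close>, the condition is void.\<close>

definition condition_A3 ::
  "'w measure \<Rightarrow> ('w \<Rightarrow> 'x) \<Rightarrow> ('x \<Rightarrow> real^'d::finite \<Rightarrow> real) \<Rightarrow> 'd set \<Rightarrow> nat \<Rightarrow> bool" where
  "condition_A3 N X p R m \<longleftrightarrow>
     (\<forall>\<theta>. (\<exists>i. i \<notin> R \<and> \<theta> $ i \<noteq> 0) \<longrightarrow>
        (AE \<omega> in N. taylor_form (loglik_ratio p (X \<omega>)) m (- R) \<theta> = 0) \<or>
        form_independent N X p R m \<theta>)"


section \<open>The sequence of blow-ups\<close>

text \<open>The blow-up of \<open>\<real>\<^sup>d\<close> along the subspace on which the coordinates in \<open>J\<close> vanish, in the chart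
  in which the exceptional surface is \<open>{u\<^sub>j = 0}\<close>, where \<open>j \<in> J\<close>.\<close>

definition blowup_chart :: "'d::finite set \<Rightarrow> 'd \<Rightarrow> real^'d \<Rightarrow> real^'d" where
  "blowup_chart J j u = (\<chi> k. if k \<in> J \<and> k \<noteq> j then u $ j * u $ k else u $ k)"

text \<open>A chart of the iterated blow-up is named by the list of the indices \<open>j\<close> chosen in the
  successive blow-ups that affect it, the latest one first. The exceptional surface of the latest
  one is \<open>{u\<^sub>i = 0}\<close> with \<open>i\<close> the head of the list. The next blow-up is centered at the origin if
  there was none before, and at \<open>{u\<^sub>k = 0, k \<in> R} \<inter> {u\<^sub>i = 0}\<close> if \<open>i \<notin> R\<close>. If \<open>i \<in> R\<close>, the center
  does not meet the chart, which is then left unchanged; this is encoded by the empty set.\<close>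

fun center_coords :: "'d set \<Rightarrow> 'd list \<Rightarrow> 'd set" where
  "center_coords R [] = UNIV"
| "center_coords R (i # c) = (if i \<in> R then {} else insert i R)"

fun blowup_charts :: "'d set \<Rightarrow> nat \<Rightarrow> 'd list set" where
  "blowup_charts R 0 = {[]}"
| "blowup_charts R (Suc n) =
     (\<Union>c\<in>blowup_charts R n. if center_coords R c = {} then {c}
                            else {j # c | j. j \<in> center_coords R c})"

fun chart_map :: "'d::finite set \<Rightarrow> 'd list \<Rightarrow> real^'d \<Rightarrow> real^'d" where
  "chart_map R [] = id"
| "chart_map R (j # c) = chart_map R c \<circ> blowup_chart (center_coords R c) j"

text \<open>Gluing of the charts. All centers lie over the origin, so the iterated blow-up is an
  isomorphism over the complement of the origin, and there two chart points coincide iff they have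
  the same image. The preimage of this complement is dense and the blow-up is Hausdorff, so that
  in general two chart points coincide iff they are limits of such coinciding pairs.\<close>

definition glued :: "'d::finite set \<Rightarrow> 'd list \<times> (real^'d) \<Rightarrow> 'd list \<times> (real^'d) \<Rightarrow> bool" where
  "glued R = (\<lambda>(c, u) (c', u').
     (u, u') \<in> closure {(v, v'). chart_map R c v = chart_map R c' v' \<and> chart_map R c v \<noteq> 0})"

definition blowup_point ::
  "'d::finite set \<Rightarrow> nat \<Rightarrow> 'd list \<Rightarrow> real^'d \<Rightarrow> ('d list \<times> (real^'d)) set" where
  "blowup_point R n c u = {(c', u'). c' \<in> blowup_charts R n \<and> glued R (c, u) (c', u')}"

definition blowup_atlas ::
  "'d::finite set \<Rightarrow> nat \<Rightarrow> ('d, ('d list \<times> (real^'d)) set) atlas" where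
  "blowup_atlas R n = (\<lambda>c. (UNIV, blowup_point R n c)) ` blowup_charts R n"

definition blowup_map :: "'d::finite set \<Rightarrow> ('d list \<times> (real^'d)) set \<Rightarrow> real^'d" where
  "blowup_map R Q = (THE \<theta>. \<exists>(c, u)\<in>Q. \<theta> = chart_map R c u)"

definition fiber_over_origin :: "'d::finite set \<Rightarrow> nat \<Rightarrow> ('d list \<times> (real^'d)) set set" where
  "fiber_over_origin R n = {Q \<in> atlas_points (blowup_atlas R n). blowup_map R Q = 0}"

lemma chart_map_replicate:
  fixes R :: "'d::finite set"
  assumes "i \<notin> R" "n \<ge> 1"
  shows "chart_map R (replicate n i) u =
    (\<chi> k. if k = i then u $ i else if k \<in> R then u $ i ^ n * u $ k else u $ i * u $ k)"
  using assms(2)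
proof (induction n arbitrary: u rule: dec_induct)
  case base
  show ?case by (auto simp: blowup_chart_def vec_eq_iff)
next
  case (step n)
  obtain n' where n': "n = Suc n'" using step.hyps by (cases n) auto
  have "center_coords R (replicate n i) = insert i R"
    using assms(1) n' by simp
  then have "chart_map R (replicate (Suc n) i) u =
      chart_map R (replicate n i) (blowup_chart (insert i R) i u)" by simp
  then show ?case
    unfolding step.IH by (auto simp: blowup_chart_def vec_eq_iff assms(1))
qed

lemma replicate_in_blowup_charts:
  assumes "i \<notin> R"
  shows "replicate n i \<in> blowup_charts R n"
proof (induction n)
  case (Suc n)
  have "i \<in> center_coords R (replicate n i)"
    using assms by (cases n) auto
  then show ?case using Suc by (auto intro!: bexI[of _ "replicate n i"])
qed simp

text \<open>The list \<open>replicate m i\<close> with \<open>i \<notin> R\<close> names the chart in which the exceptional surface of the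
  \<open>m\<close>-th blow-up is \<open>{u\<^sub>i = 0}\<close>.\<close>

definition degenerate_points ::
  "'w measure \<Rightarrow> ('w \<Rightarrow> 'x) \<Rightarrow> ('x \<Rightarrow> real^'d::finite \<Rightarrow> real) \<Rightarrow> 'd set \<Rightarrow> nat \<Rightarrow>
     ('d list \<times> (real^'d)) set set" where
  "degenerate_points N X p R m =
     (\<Union>i\<in>- R. blowup_point R m (replicate m i) `
        {u. (\<forall>k\<in>R. u $ k = 0) \<and> u $ i = 0 \<and>
            (AE \<omega> in N. taylor_form (loglik_ratio p (X \<omega>)) m (- R)
                          (\<chi> k. if k = i then 1 else u $ k) = 0)})"

end

theory Submission
  imports Defs
begin

text \<open>Put weight \<open>n\<close> on the coordinates in \<open>R\<close> and weight \<open>1\<close> on the others. By (A2) the log-likelihood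
  ratio \<open>f\<close> has weighted order at least \<open>n\<close> for every \<open>n \<le> m\<close>, almost surely. Since
  \<open>E[exp (- f)] = 1\<close> identically, the coefficients of \<open>exp (- f) = 1 - f + f\<^sup>2 / 2 - \<dots>\<close> have expectation
  zero, so that \<open>K\<close> has weighted order at least \<open>2 n\<close>, and its part of weight \<open>2 n\<close> is \<open>E[L\<^sup>2] / 2\<close>, where
  \<open>L\<close> is the part of \<open>f\<close> of weight \<open>n\<close>. By (A1) and (A3), \<open>L\<close> vanishes almost surely only over the
  degenerate points. Every chart of the iterated blow-up is a monomial map whose one or two
  exceptional coordinates \<open>e\<close> act with such a weight \<open>n\<close>; hence \<open>K\<close> is \<open>u\<^sub>e\<close> to the power \<open>2 n\<close> times a
  unit, and the Jacobian is a monomial in the exceptional coordinates. The resulting ratio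
  \<open>r / 2 + (d - r) / (2 n)\<close> is smallest for \<open>n = m\<close>.

  That the exponents do not depend on the coordinates follows from the orders of vanishing of
  \<open>K\<close> and of the Jacobian at nearby points. For the threshold itself, the blow-up is realized as
  the closure of the graph of a map to a product of projective spaces.\<close>

section \<open>Power series in several variables\<close>

text \<open>The regularity assumption lets the expectation pass through derivatives at a point, not
  through the power series of f. No series is therefore integrated: up to weight 2n each Taylor
  coefficient of K is computed on its own, from an almost sure identity between finitely many Taylor
  coefficients of f and of p/q. The sum of products in it is integrable because the other side is
  linear in coefficients that are. Threshold and multiplicity range over all analytic coordinates in
  which a normal crossing appears, so good coordinates give only one of the two inequalities; the
  other needs exponents that can be recovered from K and the Jacobian alone. The charts are glued
  twice. For the exponents over the given blow-up it suffices that glued points have the same image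
  and that one point of top weight is not degenerate. A resolution must also be Hausdorff and proper
  with analytic transitions, which is hard to read off from a gluing defined by limits; recording
  lines next to the image turns equality of points into polynomial equations, and these survive
  limits.\<close>

definition mpow :: "real^'d::finite \<Rightarrow> ('d \<Rightarrow> nat) \<Rightarrow> real" where
  "mpow w \<alpha> = (\<Prod>i\<in>UNIV. w $ i ^ \<alpha> i)"

text \<open>The radius depends on the coordinate: near an exceptional hypersurface the polydisc is
  thin in one direction but reaches beyond the base point in the others.\<close>

definition pseries :: "(('d::finite \<Rightarrow> nat) \<Rightarrow> real) \<Rightarrow> ('d \<Rightarrow> real) \<Rightarrow> (real^'d \<Rightarrow> real) \<Rightarrow> bool" where
  "pseries c \<rho> h \<longleftrightarrow> (\<forall>w. (\<forall>i. \<bar>w $ i\<bar> < \<rho> i) \<longrightarrow> ((\<lambda>\<alpha>. c \<alpha> * mpow w \<alpha>) has_sum h w) UNIV)"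

lemma pseriesD: "pseries c \<rho> h \<Longrightarrow> (\<And>i. \<bar>w $ i\<bar> < \<rho> i) \<Longrightarrow> ((\<lambda>\<alpha>. c \<alpha> * mpow w \<alpha>) has_sum h w) UNIV"
  by (auto simp: pseries_def)

lemma real_analytic_at_iff_pseries:
  fixes h :: "real^'d::finite \<Rightarrow> real"
  shows "real_analytic_at h x \<longleftrightarrow> (\<exists>c e. e > 0 \<and> pseries c (\<lambda>_. e) (\<lambda>w. h (x + w)))"
proof -
  have "(\<forall>y::real^'d. (\<forall>i. \<bar>y $ i - x $ i\<bar> < e) \<longrightarrow>
           ((\<lambda>\<alpha>. c \<alpha> * (\<Prod>i\<in>UNIV. (y $ i - x $ i) ^ \<alpha> i)) has_sum h y) UNIV) \<longleftrightarrow>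
        pseries c (\<lambda>_. e) (\<lambda>w. h (x + w))" for c :: "('d \<Rightarrow> nat) \<Rightarrow> real" and e :: real
    unfolding pseries_def mpow_def
  proof safe
    fix w :: "real^'d" assume *: "\<forall>y::real^'d. (\<forall>i. \<bar>y $ i - x $ i\<bar> < e) \<longrightarrow>
           ((\<lambda>\<alpha>. c \<alpha> * (\<Prod>i\<in>UNIV. (y $ i - x $ i) ^ \<alpha> i)) has_sum h y) UNIV" "\<forall>i. \<bar>w $ i\<bar> < e"
    show "((\<lambda>\<alpha>. c \<alpha> * (\<Prod>i\<in>UNIV. w $ i ^ \<alpha> i)) has_sum h (x + w)) UNIV"
      using *(1)[rule_format, of "x + w"] *(2) by simp
  next
    fix y :: "real^'d" assume *: "\<forall>w::real^'d. (\<forall>i. \<bar>w $ i\<bar> < e) \<longrightarrow> ((\<lambda>\<alpha>. c \<alpha> * (\<Prod>i\<in>UNIV. w $ i ^ \<alpha> i)) has_sum h (x + w)) UNIV"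
      "\<forall>i. \<bar>y $ i - x $ i\<bar> < e"
    show "((\<lambda>\<alpha>. c \<alpha> * (\<Prod>i\<in>UNIV. (y $ i - x $ i) ^ \<alpha> i)) has_sum h y) UNIV"
      using *(1)[rule_format, of "y - x"] *(2) by simp
  qed
  then show ?thesis unfolding real_analytic_at_def by auto
qed

lemma pseries_mono: "pseries c \<rho> h \<Longrightarrow> (\<And>i. \<sigma> i \<le> \<rho> i) \<Longrightarrow> pseries c \<sigma> h"
  unfolding pseries_def by (meson order_less_le_trans)

lemma pseries_imp_real_analytic_at:
  fixes h :: "real^'d::finite \<Rightarrow> real"
  assumes "pseries c \<sigma> (\<lambda>w. h (x + w))" "\<And>i. \<sigma> i > 0"
  shows "real_analytic_at h x"
proof -
  have "pseries c (\<lambda>_. Min (range \<sigma>)) (\<lambda>w. h (x + w))"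
    using assms(1) by (rule pseries_mono) auto
  moreover have "Min (range \<sigma>) > 0" using assms(2) by (subst Min_gr_iff) auto
  ultimately show ?thesis unfolding real_analytic_at_iff_pseries by blast
qed

lemma mpow_zero_exp [simp]: "mpow w (\<lambda>_. 0) = 1"
  by (simp add: mpow_def)

lemma mpow_zero: "mpow (0 :: real^'d::finite) \<alpha> = (if \<alpha> = (\<lambda>_. 0) then 1 else 0)"
proof (cases "\<alpha> = (\<lambda>_. 0)")
  case False
  then obtain i where "\<alpha> i \<noteq> 0" by auto
  then show ?thesis using False unfolding mpow_def by (auto intro!: exI[of _ i])
qed (simp add: mpow_def)

lemma mpow_add: "mpow w (\<lambda>i. \<alpha> i + \<beta> i) = mpow w \<alpha> * mpow w \<beta>"
  by (simp add: mpow_def power_add prod.distrib)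

lemma abs_mpow: "\<bar>mpow w \<alpha>\<bar> = mpow (\<chi> i. \<bar>w $ i\<bar>) \<alpha>"
  by (simp add: mpow_def abs_prod power_abs)

lemma mpow_mono: "(\<And>i. 0 \<le> v $ i \<and> v $ i \<le> w $ i) \<Longrightarrow> mpow v \<alpha> \<le> mpow w \<alpha>"
  unfolding mpow_def by (intro prod_mono) (auto intro: power_mono)

lemma mpow_pos: "(\<And>i. 0 < w $ i) \<Longrightarrow> mpow w \<alpha> > 0"
  unfolding mpow_def by (intro prod_pos) auto

lemma mpow_nonneg: "(\<And>i. 0 \<le> w $ i) \<Longrightarrow> mpow w \<alpha> \<ge> 0"
  unfolding mpow_def by (intro prod_nonneg) auto

definition uidx :: "'d \<Rightarrow> 'd \<Rightarrow> nat" where "uidx i = (\<lambda>k. if k = i then 1 else 0)"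

lemma mpow_uidx: "mpow w (uidx i) = w $ i"
proof -
  have "mpow w (uidx i) = (\<Prod>k\<in>UNIV. if k = i then w $ k else 1)"
    unfolding mpow_def uidx_def by (intro prod.cong) auto
  then show ?thesis by (simp add: prod.delta)
qed

lemma uidx_eq [simp]: "uidx i = uidx j \<longleftrightarrow> i = j"
  by (metis uidx_def zero_neq_one)

lemma uidx_neq_0 [simp]: "uidx i \<noteq> (\<lambda>_. 0)"
  by (metis uidx_def zero_neq_one)

lemma summable_abs_real: "f summable_on A \<longleftrightarrow> (\<lambda>x. \<bar>f x :: real\<bar>) summable_on A"
  using summable_on_iff_abs_summable_on_real[of f A] by simp

text \<open>Iterated sums agree with the sum over pairs only under absolute convergence. It is
  checked through the row sums \<open>G\<close> of the absolute values, which are easy to find in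
  translations, products and compositions of series.\<close>

lemma has_sum_Sigma_abs:
  fixes f :: "'a \<times> 'b \<Rightarrow> real"
  assumes "\<And>x. x \<in> A \<Longrightarrow> ((\<lambda>y. f (x, y)) has_sum g x) (B x)"
    and "\<And>x. x \<in> A \<Longrightarrow> ((\<lambda>y. \<bar>f (x, y)\<bar>) has_sum G x) (B x)"
    and "G summable_on A" and "(g has_sum S) A"
  shows "(f has_sum S) (Sigma A B)"
proof (rule has_sum_SigmaI)
  have "(\<lambda>x. \<bar>f x\<bar>) summable_on Sigma A B"
    using assms(2,3) by (rule summable_on_SigmaI) auto
  then show "f summable_on Sigma A B" by (rule summable_abs_real[THEN iffD2])
qed (use assms in auto)

text \<open>The index set is arbitrary and the exponents \<open>b x\<close> may repeat. Translation,
  multiplication, composition and pull-back to a chart all produce such sums, which become power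
  series by collecting equal exponents.\<close>

lemma pseries_group:
  fixes c :: "'x \<Rightarrow> real" and b :: "'x \<Rightarrow> 'd::finite \<Rightarrow> nat"
  assumes S: "\<And>w. (\<And>i. \<bar>w $ i\<bar> < \<rho> i) \<Longrightarrow> ((\<lambda>x. c x * mpow w (b x)) has_sum h w) I"
    and \<rho>: "\<And>i. \<rho> i > 0"
  shows "c summable_on {x\<in>I. b x = \<beta>}"
    and "pseries (\<lambda>\<beta>. infsum c {x\<in>I. b x = \<beta>}) \<rho> h"
proof -
  show fib: "c summable_on {x\<in>I. b x = \<beta>}" for \<beta>
  proof -
    \<comment> \<open>At a point with positive coordinates no monomial vanishes, so it can be
      divided out of the summable terms.\<close>
    define s :: "real^'d" where "s = (\<chi> i. \<rho> i / 2)"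
    have s: "\<bar>s $ i\<bar> < \<rho> i" "0 < s $ i" for i using \<rho>[of i] by (auto simp: s_def)
    have "(\<lambda>x. c x * mpow s (b x)) summable_on I" using S[OF s(1)] has_sum_imp_summable by blast
    then have "(\<lambda>x. c x * mpow s (b x)) summable_on {x\<in>I. b x = \<beta>}"
      by (rule summable_on_subset) auto
    then have "(\<lambda>x. c x * mpow s \<beta>) summable_on {x\<in>I. b x = \<beta>}"
      by (rule iffD1[OF summable_on_cong, rotated]) auto
    then show ?thesis
      using mpow_pos[OF s(2)] by (metis less_numeral_extra(3) summable_on_cmult_left')
  qed
  show "pseries (\<lambda>\<beta>. infsum c {x\<in>I. b x = \<beta>}) \<rho> h"
    unfolding pseries_def
  proof safe
    fix w :: "real^'d" assume w: "\<forall>i. \<bar>w $ i\<bar> < \<rho> i"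
    have "((\<lambda>(\<beta>, x). c x * mpow w \<beta>) has_sum h w) (Sigma UNIV (\<lambda>\<beta>. {x\<in>I. b x = \<beta>}))"
      using S[OF w[rule_format]]
      by (subst has_sum_reindex_bij_witness[where j = snd and i = "\<lambda>x. (b x, x)" and T = I]) auto
    then show "((\<lambda>\<beta>. infsum c {x\<in>I. b x = \<beta>} * mpow w \<beta>) has_sum h w) UNIV"
    proof (rule has_sum_SigmaD)
      fix \<beta> show "((\<lambda>x. case (\<beta>, x) of (\<beta>, x) \<Rightarrow> c x * mpow w \<beta>) has_sum
          infsum c {x\<in>I. b x = \<beta>} * mpow w \<beta>) {x\<in>I. b x = \<beta>}"
        using fib by (auto intro!: has_sum_cmult_left)
    qed
  qed
qed

section \<open>Re-expansion at another point and differentiability\<close>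

lemma pseries_summable:
  "pseries c \<rho> h \<Longrightarrow> (\<And>i. \<bar>w $ i\<bar> < \<rho> i) \<Longrightarrow> (\<lambda>\<alpha>. \<bar>c \<alpha>\<bar> * \<bar>mpow w \<alpha>\<bar>) summable_on UNIV"
  unfolding abs_mult[symmetric] summable_abs_real[symmetric]
  by (rule has_sum_imp_summable, rule pseriesD)

lemma mpow_binomial:
  fixes v w :: "real^'d::finite"
  shows "mpow (v + w) \<beta> =
    (\<Sum>\<gamma> | \<forall>i. \<gamma> i \<le> \<beta> i. (\<Prod>i\<in>UNIV. real (\<beta> i choose \<gamma> i)) * mpow v (\<lambda>i. \<beta> i - \<gamma> i) * mpow w \<gamma>)"
proof -
  have "mpow (v + w) \<beta> = (\<Prod>i\<in>UNIV. \<Sum>k\<le>\<beta> i. real (\<beta> i choose k) * v $ i ^ (\<beta> i - k) * w $ i ^ k)"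
    unfolding mpow_def
  proof (intro prod.cong refl)
    fix i
    have "(w $ i + v $ i) ^ \<beta> i = (\<Sum>k\<le>\<beta> i. real (\<beta> i choose k) * w $ i ^ k * v $ i ^ (\<beta> i - k))"
      by (rule binomial_ring)
    then show "(v + w) $ i ^ \<beta> i = (\<Sum>k\<le>\<beta> i. real (\<beta> i choose k) * v $ i ^ (\<beta> i - k) * w $ i ^ k)"
      by (simp add: mult_ac add.commute)
  qed
  also have "\<dots> = (\<Sum>\<gamma>\<in>PiE UNIV (\<lambda>i. {..\<beta> i}). \<Prod>i\<in>UNIV. real (\<beta> i choose \<gamma> i) * v $ i ^ (\<beta> i - \<gamma> i) * w $ i ^ \<gamma> i)"
    by (rule prod_sum_PiE) auto
  also have "PiE UNIV (\<lambda>i. {..\<beta> i}) = {\<gamma>. \<forall>i. \<gamma> i \<le> \<beta> i}" by (auto simp: PiE_def)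
  finally show ?thesis by (simp add: prod.distrib mpow_def)
qed

lemma finite_idx_le: "finite {\<gamma> :: 'd::finite \<Rightarrow> nat. \<forall>i. \<gamma> i \<le> \<beta> i}"
proof -
  have "{\<gamma>. \<forall>i. \<gamma> i \<le> \<beta> i} = PiE UNIV (\<lambda>i. {..\<beta> i})" by (auto simp: PiE_def)
  then show ?thesis by (simp add: finite_PiE)
qed

text \<open>A Taylor coefficient at y. The sum runs over pairs with a fixed second entry, not over
  \<beta> alone, so that it is literally the fibre sum of \<open>pseries_group\<close>.\<close>

definition shift_coeff :: "(('d::finite \<Rightarrow> nat) \<Rightarrow> real) \<Rightarrow> real^'d \<Rightarrow> ('d \<Rightarrow> nat) \<Rightarrow> real" where
  "shift_coeff c y \<gamma> = infsum (\<lambda>(\<beta>, \<gamma>). c \<beta> * (\<Prod>i\<in>UNIV. real (\<beta> i choose \<gamma> i)) * mpow y (\<lambda>i. \<beta> i - \<gamma> i))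
     {x \<in> Sigma UNIV (\<lambda>\<beta>. {\<gamma>. \<forall>i. \<gamma> i \<le> \<beta> i}). snd x = \<gamma>}"

text \<open>Expand each power of y + w binomially. With absolute values this becomes the series at
  |y| + |w|, which is why the radius shrinks to \<rho> - |y|.\<close>

lemma
  fixes h :: "real^'d::finite \<Rightarrow> real"
  assumes c: "pseries c \<rho> h" and y: "\<And>i. \<bar>y $ i\<bar> < \<rho> i"
  shows pseries_shift: "pseries (shift_coeff c y) (\<lambda>i. \<rho> i - \<bar>y $ i\<bar>) (\<lambda>w. h (y + w))"
    and summable_shift_coeff:
      "(\<lambda>(\<beta>, \<gamma>). c \<beta> * (\<Prod>i\<in>UNIV. real (\<beta> i choose \<gamma> i)) * mpow y (\<lambda>i. \<beta> i - \<gamma> i)) summable_on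
         {x \<in> Sigma UNIV (\<lambda>\<beta>. {\<gamma>. \<forall>i. \<gamma> i \<le> \<beta> i}). snd x = \<gamma>}"
proof -
  let ?I = "Sigma UNIV (\<lambda>\<beta>. {\<gamma> :: 'd \<Rightarrow> nat. \<forall>i. \<gamma> i \<le> \<beta> i})"
  let ?c = "\<lambda>(\<beta>, \<gamma>). c \<beta> * (\<Prod>i\<in>UNIV. real (\<beta> i choose \<gamma> i)) * mpow y (\<lambda>i. \<beta> i - \<gamma> i)"
  have *: "((\<lambda>x. ?c x * mpow w (snd x)) has_sum h (y + w)) ?I"
    if w: "\<And>i. \<bar>w $ i\<bar> < \<rho> i - \<bar>y $ i\<bar>" for w
  proof (rule has_sum_Sigma_abs)
    let ?v = "(\<chi> i. \<bar>y $ i\<bar>) + (\<chi> i. \<bar>w $ i\<bar>)"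
    show "((\<lambda>\<gamma>. ?c (\<beta>, \<gamma>) * mpow w (snd (\<beta>, \<gamma>))) has_sum c \<beta> * mpow (y + w) \<beta>) {\<gamma>. \<forall>i. \<gamma> i \<le> \<beta> i}" for \<beta>
      by (rule has_sum_finiteI[OF finite_idx_le])
        (simp add: mpow_binomial sum_distrib_left mult_ac)
    show "((\<lambda>\<gamma>. \<bar>?c (\<beta>, \<gamma>) * mpow w (snd (\<beta>, \<gamma>))\<bar>) has_sum \<bar>c \<beta>\<bar> * \<bar>mpow ?v \<beta>\<bar>) {\<gamma>. \<forall>i. \<gamma> i \<le> \<beta> i}" for \<beta>
      by (rule has_sum_finiteI[OF finite_idx_le], subst abs_of_nonneg[OF mpow_nonneg])
        (simp_all add: mpow_binomial sum_distrib_left abs_mult abs_mpow abs_prod mult_ac)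
    show "(\<lambda>\<beta>. \<bar>c \<beta>\<bar> * \<bar>mpow ?v \<beta>\<bar>) summable_on UNIV"
      using c by (rule pseries_summable) (use w in \<open>auto simp: algebra_simps\<close>)
    show "((\<lambda>\<beta>. c \<beta> * mpow (y + w) \<beta>) has_sum h (y + w)) UNIV"
      using c by (rule pseriesD) (use w in \<open>smt (verit) vector_add_component\<close>)
  qed
  note g = pseries_group[OF *]
  show "pseries (shift_coeff c y) (\<lambda>i. \<rho> i - \<bar>y $ i\<bar>) (\<lambda>w. h (y + w))"
    unfolding shift_coeff_def using g(2)[of "\<lambda>i. \<rho> i - \<bar>y $ i\<bar>"] y by simp
  show "?c summable_on {x\<in>?I. snd x = \<gamma>}"
    using g(1)[of "\<lambda>i. \<rho> i - \<bar>y $ i\<bar>" \<gamma>] y by simp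
qed

lemma pseries_zero: "pseries c \<rho> h \<Longrightarrow> (\<And>i. \<rho> i > 0) \<Longrightarrow> h 0 = c (\<lambda>_. 0)"
proof -
  assume c: "pseries c \<rho> h" and \<rho>: "\<And>i. \<rho> i > 0"
  have "((\<lambda>\<alpha>. c \<alpha> * mpow 0 \<alpha>) has_sum h 0) UNIV" using c by (rule pseriesD) (simp add: \<rho>)
  moreover have "((\<lambda>\<alpha>. c \<alpha> * mpow 0 \<alpha>) has_sum c (\<lambda>_. 0)) UNIV"
    by (rule has_sum_finite_neutralI[of "{\<lambda>_. 0}"]) (auto simp: mpow_zero)
  ultimately show ?thesis by (rule has_sum_unique)
qed

definition deg :: "('d::finite \<Rightarrow> nat) \<Rightarrow> nat" where "deg \<alpha> = (\<Sum>i\<in>UNIV. \<alpha> i)"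

lemma deg_cases: "deg \<alpha> \<ge> 2 \<or> \<alpha> = (\<lambda>_. 0) \<or> (\<exists>i. \<alpha> = uidx i)"
proof (cases "\<alpha> = (\<lambda>_. 0)")
  case False
  then obtain i where i: "\<alpha> i \<noteq> 0" by auto
  have "deg \<alpha> = \<alpha> i + (\<Sum>k\<in>UNIV - {i}. \<alpha> k)" unfolding deg_def by (rule sum.remove) auto
  then have "deg \<alpha> \<ge> 2 \<or> (\<alpha> i = 1 \<and> (\<Sum>k\<in>UNIV - {i}. \<alpha> k) = 0)" using i by linarith
  then show ?thesis
  proof
    assume "\<alpha> i = 1 \<and> (\<Sum>k\<in>UNIV - {i}. \<alpha> k) = 0"
    then have "\<alpha> = uidx i" by (auto simp: uidx_def fun_eq_iff)
    then show ?thesis by blast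
  qed simp
qed simp

lemma mpow_const: "mpow (\<chi> i. s) \<alpha> = s ^ deg \<alpha>"
  unfolding mpow_def deg_def by (simp add: power_sum)

lemma mpow_le_deg: "(\<And>i. \<bar>w $ i\<bar> \<le> s) \<Longrightarrow> \<bar>mpow w \<alpha>\<bar> \<le> s ^ deg \<alpha>"
proof -
  assume "\<And>i. \<bar>w $ i\<bar> \<le> s"
  then have "mpow (\<chi> i. \<bar>w $ i\<bar>) \<alpha> \<le> mpow (\<chi> i. s) \<alpha>" by (intro mpow_mono) auto
  then show ?thesis by (simp add: abs_mpow mpow_const)
qed

text \<open>Monomials of degree at least two are compared with their values at a fixed s: for |w| <=
  s they are at most (|w| / s)^2 times these, so the remainder after the linear part is at most C
  |w|^2.\<close>

lemma pseries_has_derivative_0: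
  fixes h :: "real^'d::finite \<Rightarrow> real"
  assumes c: "pseries c \<rho> h" and \<rho>: "\<And>i. \<rho> i > 0"
  shows "(h has_derivative (\<lambda>w. \<Sum>i\<in>UNIV. c (uidx i) * w $ i)) (at 0)"
proof -
  define s where "s = Min (range \<rho>) / 2"
  have s: "s > 0" "s < \<rho> i" for i
  proof -
    have "Min (range \<rho>) > 0" using \<rho> by (subst Min_gr_iff) auto
    moreover have "Min (range \<rho>) \<le> \<rho> i" by simp
    ultimately show "s > 0" "s < \<rho> i" unfolding s_def by linarith+
  qed
  define A where "A = insert (\<lambda>_. 0) (range (uidx :: 'd \<Rightarrow> 'd \<Rightarrow> nat))"
  have degA: "deg \<alpha> \<ge> 2" if "\<alpha> \<notin> A" for \<alpha> using deg_cases[of \<alpha>] that unfolding A_def by auto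
  have sumC: "(\<lambda>\<alpha>. \<bar>c \<alpha>\<bar> * s ^ deg \<alpha>) summable_on - A"
  proof -
    have "(\<lambda>\<alpha>. \<bar>c \<alpha>\<bar> * \<bar>mpow (\<chi> i. s) \<alpha>\<bar>) summable_on UNIV"
      using c by (rule pseries_summable) (use s in auto)
    then show ?thesis using s(1) by (auto simp: mpow_const intro: summable_on_subset)
  qed
  define C where "C = infsum (\<lambda>\<alpha>. \<bar>c \<alpha>\<bar> * s ^ deg \<alpha>) (- A) / s^2"
  have bound: "\<bar>h w - h 0 - (\<Sum>i\<in>UNIV. c (uidx i) * w $ i)\<bar> \<le> C * norm w ^ 2" if w: "norm w \<le> s" for w
  proof -
    have wi: "\<bar>w $ i\<bar> \<le> norm w" for i by (rule component_le_norm_cart)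
    have H: "((\<lambda>\<alpha>. c \<alpha> * mpow w \<alpha>) has_sum h w) UNIV"
      using c by (rule pseriesD) (use wi w s in \<open>meson order_le_less_trans order_trans\<close>)
    have F: "((\<lambda>\<alpha>. c \<alpha> * mpow w \<alpha>) has_sum (c (\<lambda>_. 0) + (\<Sum>i\<in>UNIV. c (uidx i) * w $ i))) A"
    proof (rule has_sum_finiteI)
      have "inj_on (uidx :: 'd \<Rightarrow> 'd \<Rightarrow> nat) UNIV" by (auto intro: injI)
      then have "(\<Sum>\<alpha>\<in>range (uidx :: 'd \<Rightarrow> 'd \<Rightarrow> nat). c \<alpha> * mpow w \<alpha>) = (\<Sum>i\<in>UNIV. c (uidx i) * w $ i)"
        by (simp add: sum.reindex mpow_uidx)
      then show "c (\<lambda>_. 0) + (\<Sum>i\<in>UNIV. c (uidx i) * w $ i) = (\<Sum>\<alpha>\<in>A. c \<alpha> * mpow w \<alpha>)"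
        unfolding A_def by (subst sum.insert) (auto dest: sym)
    qed (simp add: A_def)
    have "((\<lambda>\<alpha>. c \<alpha> * mpow w \<alpha>) has_sum (h w - (c (\<lambda>_. 0) + (\<Sum>i\<in>UNIV. c (uidx i) * w $ i)))) (UNIV - A)"
      using H F by (rule has_sum_Diff) simp
    then have D: "((\<lambda>\<alpha>. c \<alpha> * mpow w \<alpha>) has_sum (h w - h 0 - (\<Sum>i\<in>UNIV. c (uidx i) * w $ i))) (- A)"
      using pseries_zero[OF c \<rho>] by (simp add: Compl_eq_Diff_UNIV algebra_simps)
    let ?g = "\<lambda>\<alpha>. (norm w / s)^2 * (\<bar>c \<alpha>\<bar> * s ^ deg \<alpha>)"
    have le: "\<bar>c \<alpha> * mpow w \<alpha>\<bar> \<le> ?g \<alpha>" if "\<alpha> \<in> - A" for \<alpha>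
    proof -
      have 2: "deg \<alpha> \<ge> 2" using degA that by auto
      have "norm w ^ deg \<alpha> = norm w ^ 2 * norm w ^ (deg \<alpha> - 2)"
        using 2 by (metis le_add_diff_inverse power_add)
      also have "\<dots> \<le> norm w ^ 2 * s ^ (deg \<alpha> - 2)"
        using w by (intro mult_left_mono power_mono) auto
      also have "\<dots> = (norm w / s)^2 * s ^ deg \<alpha>"
        using 2 s(1) by (simp add: power_divide power_diff field_simps)
      finally have "\<bar>mpow w \<alpha>\<bar> \<le> (norm w / s)^2 * s ^ deg \<alpha>"
        using mpow_le_deg[of w "norm w" \<alpha>] wi by force
      then have "\<bar>c \<alpha>\<bar> * \<bar>mpow w \<alpha>\<bar> \<le> \<bar>c \<alpha>\<bar> * ((norm w / s)^2 * s ^ deg \<alpha>)"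
        by (rule mult_left_mono) simp
      then show ?thesis by (simp add: abs_mult mult_ac)
    qed
    have gs: "(?g has_sum (norm w / s)^2 * infsum (\<lambda>\<alpha>. \<bar>c \<alpha>\<bar> * s ^ deg \<alpha>) (- A)) (- A)"
      using sumC by (intro has_sum_cmult_right has_sum_infsum)
    have "h w - h 0 - (\<Sum>i\<in>UNIV. c (uidx i) * w $ i) \<le> C * norm w ^ 2"
      using has_sum_mono[OF D gs] le unfolding C_def by (force simp: power_divide mult_ac)
    moreover have "((\<lambda>\<alpha>. - (c \<alpha> * mpow w \<alpha>)) has_sum - (h w - h 0 - (\<Sum>i\<in>UNIV. c (uidx i) * w $ i))) (- A)"
      using D by (simp only: has_sum_uminus minus_minus)
    from has_sum_mono[OF this gs] have "- (h w - h 0 - (\<Sum>i\<in>UNIV. c (uidx i) * w $ i)) \<le> C * norm w ^ 2"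
      using le unfolding C_def by (force simp: power_divide mult_ac)
    ultimately show ?thesis by linarith
  qed
  have lin: "bounded_linear (\<lambda>w :: real^'d. \<Sum>i\<in>UNIV. c (uidx i) * w $ i)"
    by (intro bounded_linear_sum bounded_linear_mult_right[THEN bounded_linear_compose] bounded_linear_vec_nth)
  show ?thesis
  proof (rule has_derivativeI_sandwich[of s])
    show "((\<lambda>w. C * norm w) \<longlongrightarrow> 0) (at (0 :: real^'d))"
      by (auto intro!: tendsto_eq_intros)
  next
    fix w :: "real^'d"
    assume w: "w \<in> UNIV" "w \<noteq> 0" "dist w 0 < s"
    then have "\<bar>h w - h 0 - (\<Sum>i\<in>UNIV. c (uidx i) * w $ i)\<bar> \<le> C * norm w ^ 2"
      by (intro bound) auto
    then show "norm (h w - h 0 - (\<Sum>i\<in>UNIV. c (uidx i) * (w - 0) $ i)) / norm (w - 0) \<le> C * norm w"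
      using w by (simp add: field_simps power2_eq_square)
  qed (use lin s in auto)
qed


section \<open>Partial derivatives and Taylor coefficients\<close>

definition dcoeff :: "'d::finite \<Rightarrow> (('d \<Rightarrow> nat) \<Rightarrow> real) \<Rightarrow> ('d \<Rightarrow> nat) \<Rightarrow> real" where
  "dcoeff i c \<alpha> = real (\<alpha> i + 1) * c (\<lambda>k. \<alpha> k + uidx i k)"

lemma partial_deriv_eq:
  fixes h :: "real^'d::finite \<Rightarrow> real"
  assumes "((\<lambda>w. h (y + w)) has_derivative D) (at 0)"
  shows "partial_deriv i h y = D (axis i 1)"
proof -
  have "((\<lambda>t. t *\<^sub>R axis i (1::real)) has_derivative (\<lambda>t. t *\<^sub>R axis i 1)) (at 0)"
    by (intro derivative_eq_intros) auto
  moreover have "((\<lambda>w. h (y + w)) has_derivative D) (at (0 *\<^sub>R axis i (1::real)))"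
    using assms by simp
  ultimately have "((\<lambda>t. h (y + t *\<^sub>R axis i 1)) has_derivative (\<lambda>t. D (t *\<^sub>R axis i 1))) (at 0)"
    by (rule has_derivative_compose)
  then have "((\<lambda>t. h (y + t *\<^sub>R axis i 1)) has_derivative (\<lambda>t. t *\<^sub>R D (axis i 1))) (at 0)"
    using has_derivative_linear[OF assms] by (simp add: linear_scale)
  then have "((\<lambda>t. h (y + t *\<^sub>R axis i 1)) has_field_derivative D (axis i 1)) (at 0)"
    by (simp add: has_field_derivative_def mult_commute_abs)
  then show ?thesis unfolding partial_deriv_def by (rule DERIV_imp_deriv)
qed

lemma sum_axis_1: "(\<Sum>k\<in>UNIV. c k * axis i 1 $ k) = (c i :: real)"
proof -
  have "(\<Sum>k\<in>UNIV. c k * axis i 1 $ k) = (\<Sum>k\<in>UNIV. if k = i then c k else 0)"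
    by (intro sum.cong) (auto simp: axis_def)
  then show ?thesis by (simp add: sum.delta)
qed

lemma partial_deriv_shift_coeff:
  assumes "pseries c \<rho> h" "\<And>i. \<bar>y $ i\<bar> < \<rho> i"
  shows "partial_deriv i h y = shift_coeff c y (uidx i)"
proof -
  have "((\<lambda>w. h (y + w)) has_derivative (\<lambda>w. \<Sum>i\<in>UNIV. shift_coeff c y (uidx i) * w $ i)) (at 0)"
    using pseries_shift[OF assms] by (rule pseries_has_derivative_0) (simp add: assms)
  from partial_deriv_eq[OF this] show ?thesis by (simp add: sum_axis_1)
qed

text \<open>The series is not differentiated term by term: the derivative at y is the linear
  coefficient of the expansion at y, whose terms \<open>(\<beta>, uidx i)\<close> are matched with
  \<alpha> = \<beta> - \<open>uidx i\<close>. The binomial factor then becomes \<alpha> i +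
  1.\<close>

lemma pseries_partial:
  fixes h :: "real^'d::finite \<Rightarrow> real"
  assumes c: "pseries c \<rho> h"
  shows "pseries (dcoeff i c) \<rho> (partial_deriv i h)"
  unfolding pseries_def
proof safe
  fix y :: "real^'d" assume y: "\<forall>i. \<bar>y $ i\<bar> < \<rho> i"
  let ?F = "{x \<in> Sigma UNIV (\<lambda>\<beta>. {\<gamma>. \<forall>i. \<gamma> i \<le> \<beta> i}). snd x = uidx i}"
  let ?f = "\<lambda>(\<beta>, \<gamma>). c \<beta> * (\<Prod>i\<in>UNIV. real (\<beta> i choose \<gamma> i)) * mpow y (\<lambda>i. \<beta> i - \<gamma> i)"
  have "(?f has_sum shift_coeff c y (uidx i)) ?F"
    unfolding shift_coeff_def using c y by (intro has_sum_infsum summable_shift_coeff) auto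
  also have "?this \<longleftrightarrow> ((\<lambda>\<alpha>. dcoeff i c \<alpha> * mpow y \<alpha>) has_sum shift_coeff c y (uidx i)) UNIV"
  proof (rule has_sum_reindex_bij_witness[where
        i = "\<lambda>\<alpha>. (\<lambda>k. \<alpha> k + uidx i k, uidx i)" and j = "\<lambda>(\<beta>, \<gamma>). (\<lambda>k. \<beta> k - \<gamma> k)"])
    fix x assume x: "x \<in> ?F"
    then obtain \<beta> where \<beta>: "x = (\<beta>, uidx i)" "\<And>k. uidx i k \<le> \<beta> k" by (cases x) auto
    have [simp]: "(\<lambda>k. \<beta> k - uidx i k + uidx i k) = \<beta>" using \<beta>(2) by auto
    show "(\<lambda>k. (case x of (\<beta>, \<gamma>) \<Rightarrow> \<lambda>k. \<beta> k - \<gamma> k) k + uidx i k, uidx i) = x"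
      using \<beta> by simp
    have bi: "\<beta> i \<ge> 1" using \<beta>(2)[of i] by (simp add: uidx_def)
    have "(\<Prod>k\<in>UNIV. real (\<beta> k choose uidx i k)) = (\<Prod>k\<in>UNIV. if k = i then real (\<beta> k) else 1)"
      by (intro prod.cong) (auto simp: uidx_def)
    then have "(\<Prod>k\<in>UNIV. real (\<beta> k choose uidx i k)) = real (\<beta> i)" by (simp add: prod.delta)
    then show "dcoeff i c (case x of (\<beta>, \<gamma>) \<Rightarrow> \<lambda>k. \<beta> k - \<gamma> k) *
        mpow y (case x of (\<beta>, \<gamma>) \<Rightarrow> \<lambda>k. \<beta> k - \<gamma> k) = ?f x"
      using bi \<beta> by (simp add: dcoeff_def mult_ac) (simp add: uidx_def of_nat_diff)
  qed auto
  finally show "((\<lambda>\<alpha>. dcoeff i c \<alpha> * mpow y \<alpha>) has_sum partial_deriv i h y) UNIV"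
    using partial_deriv_shift_coeff[OF c] y by simp
qed

lemma dcoeff_pow:
  "(dcoeff i ^^ n) c \<beta> = fact (\<beta> i + n) / fact (\<beta> i) * c (\<lambda>k. \<beta> k + n * uidx i k)"
proof (induction n arbitrary: \<beta>)
  case (Suc n)
  have [simp]: "(\<lambda>k. \<beta> k + uidx i k + n * uidx i k) = (\<lambda>k. \<beta> k + Suc n * uidx i k)" by auto
  have "(dcoeff i ^^ Suc n) c \<beta> = dcoeff i ((dcoeff i ^^ n) c) \<beta>" by simp
  also have "\<dots> = real (\<beta> i + 1) * (fact (\<beta> i + 1 + n) / fact (\<beta> i + 1)) * c (\<lambda>k. \<beta> k + Suc n * uidx i k)"
    unfolding dcoeff_def Suc.IH by (simp add: uidx_def add.assoc)
  also have "real (\<beta> i + 1) * (fact (\<beta> i + 1 + n) / fact (\<beta> i + 1)) = (fact (\<beta> i + Suc n) / fact (\<beta> i) :: real)"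
  proof -
    have "a \<noteq> 0 \<Longrightarrow> a * (X / (a * b)) = X / b" for a b X :: real by simp
    moreover have "(fact (\<beta> i + 1) :: real) = real (\<beta> i + 1) * fact (\<beta> i)" by simp
    ultimately show ?thesis by (metis add.assoc add.commute of_nat_eq_0_iff plus_1_eq_Suc add_is_0 one_neq_zero)
  qed
  finally show ?case .
qed simp

lemma fold_dcoeff:
  fixes c :: "('d::finite \<Rightarrow> nat) \<Rightarrow> real"
  assumes "distinct is"
  shows "fold (\<lambda>i. dcoeff i ^^ \<alpha> i) is c \<beta> =
    (\<Prod>i\<in>set is. fact (\<beta> i + \<alpha> i) / fact (\<beta> i)) * c (\<lambda>k. \<beta> k + (if k \<in> set is then \<alpha> k else 0))"
  using assms
proof (induction "is" arbitrary: c)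
  case (Cons i "is")
  have eq: "(\<lambda>k. \<beta> k + (if k \<in> set is then \<alpha> k else 0) + \<alpha> i * uidx i k) =
      (\<lambda>k. \<beta> k + (if k \<in> set (i # is) then \<alpha> k else 0))"
    using Cons.prems by (auto simp: uidx_def)
  have "fold (\<lambda>i. dcoeff i ^^ \<alpha> i) (i # is) c \<beta> = fold (\<lambda>i. dcoeff i ^^ \<alpha> i) is ((dcoeff i ^^ \<alpha> i) c) \<beta>"
    by simp
  also have "\<dots> = (\<Prod>i\<in>set is. fact (\<beta> i + \<alpha> i) / fact (\<beta> i)) *
      (dcoeff i ^^ \<alpha> i) c (\<lambda>k. \<beta> k + (if k \<in> set is then \<alpha> k else 0))"
    using Cons by simp
  finally show ?case unfolding dcoeff_pow eq using Cons.prems by simp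
qed simp

definition mfact :: "('d::finite \<Rightarrow> nat) \<Rightarrow> real" where "mfact \<alpha> = (\<Prod>i\<in>UNIV. fact (\<alpha> i))"

lemma mfact_pos: "mfact \<alpha> > 0" unfolding mfact_def by (intro prod_pos) auto

lemma multi_deriv_pseries:
  fixes h :: "real^'d::finite \<Rightarrow> real"
  assumes "pseries c \<rho> h" and "\<And>i. \<rho> i > 0"
  shows "multi_deriv \<alpha> h 0 = mfact \<alpha> * c \<alpha>"
proof -
  have pow: "pseries c \<rho> h \<Longrightarrow> pseries ((dcoeff i ^^ n) c) \<rho> ((partial_deriv i ^^ n) h)" for i n c h
    by (induction n) (auto intro: pseries_partial)
  have fold: "pseries c \<rho> h \<Longrightarrow>
    pseries (fold (\<lambda>i. dcoeff i ^^ \<alpha> i) xs c) \<rho> (fold (\<lambda>i. partial_deriv i ^^ \<alpha> i) xs h)" for xs c h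
    by (induction xs arbitrary: c h) (auto intro: pow)
  \<comment> \<open>The enumeration hidden in \<open>multi_deriv\<close> enters only as a distinct
    and exhaustive list, and \<open>fold_dcoeff\<close> depends on nothing else.\<close>
  define xs where "xs = (SOME xs. distinct xs \<and> set xs = (UNIV :: 'd set))"
  have "\<exists>xs. distinct xs \<and> set xs = (UNIV :: 'd set)" using finite_distinct_list[of "UNIV :: 'd set"] by auto
  then have xs: "distinct xs" "set xs = UNIV" unfolding xs_def by (metis (mono_tags, lifting) someI_ex)+
  have "multi_deriv \<alpha> h 0 = fold (\<lambda>i. dcoeff i ^^ \<alpha> i) xs c (\<lambda>_. 0)"
    unfolding multi_deriv_def xs_def[symmetric]
    using fold[OF assms(1)] assms(2) by (rule pseries_zero)
  also have "\<dots> = mfact \<alpha> * c \<alpha>" using xs by (simp add: fold_dcoeff mfact_def)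
  finally show ?thesis .
qed

lemma partial_deriv_pseries:
  assumes "pseries c \<rho> h" and "\<And>i. \<rho> i > 0"
  shows "partial_deriv i h 0 = c (uidx i)"
  using pseries_zero[OF pseries_partial[OF assms(1)] assms(2), of i] by (simp add: dcoeff_def)

lemma real_analytic_at_partial_deriv:
  assumes "real_analytic_at h x"
  shows "real_analytic_at (partial_deriv i h) x"
proof -
  obtain c e where c: "e > 0" "pseries c (\<lambda>_. e) (\<lambda>w. h (x + w))"
    using assms unfolding real_analytic_at_iff_pseries by blast
  have "partial_deriv i (\<lambda>w. h (x + w)) = (\<lambda>w. partial_deriv i h (x + w))"
    by (simp add: partial_deriv_def fun_eq_iff add.assoc)
  then show ?thesis using pseries_partial[OF c(2), of i] c(1)
    unfolding real_analytic_at_iff_pseries by auto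
qed

lemma real_analytic_at_has_derivative:
  fixes h :: "real^'d::finite \<Rightarrow> real"
  assumes "real_analytic_at h x"
  shows "(h has_derivative (\<lambda>w. \<Sum>i\<in>UNIV. partial_deriv i h x * w $ i)) (at x)"
proof -
  obtain c e where c: "e > 0" "pseries c (\<lambda>_. e) (\<lambda>w. h (x + w))"
    using assms unfolding real_analytic_at_iff_pseries by blast
  have D: "((\<lambda>w. h (x + w)) has_derivative (\<lambda>w. \<Sum>i\<in>UNIV. c (uidx i) * w $ i)) (at 0)"
    using c(2) by (rule pseries_has_derivative_0) (rule c)
  from partial_deriv_eq[OF D] have "partial_deriv i h x = c (uidx i)" for i by (simp add: sum_axis_1)
  with D show ?thesis by (simp add: has_derivative_at add.commute)
qed

lemma real_analytic_at_isCont: "real_analytic_at h x \<Longrightarrow> isCont h x"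
  using real_analytic_at_has_derivative has_derivative_continuous by blast

lemma eventually_real_analytic_at:
  fixes h :: "real^'d::finite \<Rightarrow> real"
  assumes "real_analytic_at h x"
  shows "eventually (real_analytic_at h) (nhds x)"
proof -
  obtain c e where c: "e > 0" "pseries c (\<lambda>_. e) (\<lambda>w. h (x + w))"
    using assms unfolding real_analytic_at_iff_pseries by blast
  have "real_analytic_at h y" if "dist y x < e" for y
  proof -
    have lt: "\<bar>(y - x) $ i\<bar> < e" for i
      using that component_le_norm_cart[of "y - x" i] by (simp add: dist_norm)
    have "pseries (shift_coeff c (y - x)) (\<lambda>i. e - \<bar>(y - x) $ i\<bar>) (\<lambda>w. h (x + (y - x + w)))"
      using c(2) lt by (rule pseries_shift)
    then show ?thesis by (intro pseries_imp_real_analytic_at[of _ _ h y]) (use lt in \<open>auto simp: add.assoc\<close>)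
  qed
  then show ?thesis using c(1) unfolding eventually_nhds_metric by blast
qed


section \<open>Closure properties of analytic functions\<close>

lemma pseries_const: "pseries (\<lambda>\<alpha>. if \<alpha> = (\<lambda>_. 0) then a else 0) \<rho> (\<lambda>_. a)"
  unfolding pseries_def by (auto split: if_splits intro!: has_sum_finite_neutralI[of "{\<lambda>_. 0}"])

lemma real_analytic_at_const: "real_analytic_at (\<lambda>_. a) x"
  unfolding real_analytic_at_iff_pseries using pseries_const by (blast intro: zero_less_one)

lemma pseries_add: "pseries c \<rho> f \<Longrightarrow> pseries d \<rho> g \<Longrightarrow> pseries (\<lambda>\<alpha>. c \<alpha> + d \<alpha>) \<rho> (\<lambda>w. f w + g w)"
  unfolding pseries_def by (simp add: distrib_right has_sum_add)

lemma pseries_cmult: "pseries c \<rho> f \<Longrightarrow> pseries (\<lambda>\<alpha>. a * c \<alpha>) \<rho> (\<lambda>w. a * f w)"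
  unfolding pseries_def by (simp add: mult.assoc has_sum_cmult_right)

lemma pseries_coord:
  "pseries (\<lambda>\<alpha>. if \<alpha> = uidx i then 1 else 0) \<rho> (\<lambda>w. w $ i)"
  unfolding pseries_def by (auto simp: mpow_uidx split: if_splits intro!: has_sum_finite_neutralI[of "{uidx i}"])

lemma real_analytic_at_add:
  assumes "real_analytic_at f x" "real_analytic_at g x"
  shows "real_analytic_at (\<lambda>y. f y + g y) x"
proof -
  obtain c e where c: "e > 0" "pseries c (\<lambda>_. e) (\<lambda>w. f (x + w))"
    using assms unfolding real_analytic_at_iff_pseries by blast
  obtain d e' where d: "e' > 0" "pseries d (\<lambda>_. e') (\<lambda>w. g (x + w))"
    using assms unfolding real_analytic_at_iff_pseries by blast
  have "pseries (\<lambda>\<alpha>. c \<alpha> + d \<alpha>) (\<lambda>_. min e e') (\<lambda>w. f (x + w) + g (x + w))"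
    by (intro pseries_add pseries_mono[OF c(2)] pseries_mono[OF d(2)]) auto
  then show ?thesis using c d unfolding real_analytic_at_iff_pseries
    by (intro exI[of _ "\<lambda>\<alpha>. c \<alpha> + d \<alpha>"] exI[of _ "min e e'"]) auto
qed

lemma real_analytic_at_coord: "real_analytic_at (\<lambda>y. y $ i) x"
proof -
  have "pseries (\<lambda>\<alpha>. (if \<alpha> = (\<lambda>_. 0) then x $ i else 0) + (if \<alpha> = uidx i then 1 else 0)) (\<lambda>_. 1) (\<lambda>w. x $ i + w $ i)"
    by (intro pseries_add pseries_const pseries_coord)
  then show ?thesis by (intro pseries_imp_real_analytic_at[where \<sigma> = "\<lambda>_. 1"]) auto
qed

lemma pseries_mult:
  fixes f g :: "real^'d::finite \<Rightarrow> real"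
  assumes c: "pseries c \<rho> f" and d: "pseries d \<rho> g" and \<rho>: "\<And>i. \<rho> i > 0"
  shows "\<exists>e. pseries e \<rho> (\<lambda>w. f w * g w)"
proof -
  let ?c = "\<lambda>(\<alpha>, \<beta>). c \<alpha> * d \<beta>" and ?b = "\<lambda>(\<alpha>, \<beta>) i. \<alpha> i + \<beta> i :: nat"
  have "((\<lambda>x. ?c x * mpow w (?b x)) has_sum f w * g w) (Sigma UNIV (\<lambda>_. UNIV))"
    if w: "\<And>i. \<bar>w $ i\<bar> < \<rho> i" for w
  proof (rule has_sum_Sigma_abs)
    have g: "((\<lambda>\<beta>. \<bar>d \<beta>\<bar> * \<bar>mpow w \<beta>\<bar>) has_sum infsum (\<lambda>\<beta>. \<bar>d \<beta>\<bar> * \<bar>mpow w \<beta>\<bar>) UNIV) UNIV"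
      using pseries_summable[OF d w] by (rule has_sum_infsum)
    show "((\<lambda>\<beta>. ?c (\<alpha>, \<beta>) * mpow w (?b (\<alpha>, \<beta>))) has_sum c \<alpha> * mpow w \<alpha> * g w) UNIV" for \<alpha>
      using has_sum_cmult_right[OF pseriesD[OF d w], of "c \<alpha> * mpow w \<alpha>"]
      by (simp add: mpow_add mult_ac)
    show "((\<lambda>\<beta>. \<bar>?c (\<alpha>, \<beta>) * mpow w (?b (\<alpha>, \<beta>))\<bar>) has_sum
        \<bar>c \<alpha>\<bar> * \<bar>mpow w \<alpha>\<bar> * infsum (\<lambda>\<beta>. \<bar>d \<beta>\<bar> * \<bar>mpow w \<beta>\<bar>) UNIV) UNIV" for \<alpha>
      using has_sum_cmult_right[OF g, of "\<bar>c \<alpha>\<bar> * \<bar>mpow w \<alpha>\<bar>"]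
      by (simp add: mpow_add abs_mult mult_ac)
    show "(\<lambda>\<alpha>. \<bar>c \<alpha>\<bar> * \<bar>mpow w \<alpha>\<bar> * infsum (\<lambda>\<beta>. \<bar>d \<beta>\<bar> * \<bar>mpow w \<beta>\<bar>) UNIV) summable_on UNIV"
      using pseries_summable[OF c w] by (rule summable_on_cmult_left)
    show "((\<lambda>\<alpha>. c \<alpha> * mpow w \<alpha> * g w) has_sum f w * g w) UNIV"
      using pseriesD[OF c w] by (rule has_sum_cmult_left)
  qed
  note g = pseries_group(2)[OF this]
  show ?thesis using g[of \<rho>] \<rho> by blast
qed

lemma real_analytic_at_mult:
  assumes "real_analytic_at f x" "real_analytic_at g x"
  shows "real_analytic_at (\<lambda>y. f y * g y) x"
proof -
  obtain c e where c: "e > 0" "pseries c (\<lambda>_. e) (\<lambda>w. f (x + w))"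
    using assms unfolding real_analytic_at_iff_pseries by blast
  obtain d e' where d: "e' > 0" "pseries d (\<lambda>_. e') (\<lambda>w. g (x + w))"
    using assms unfolding real_analytic_at_iff_pseries by blast
  have "\<exists>k. pseries k (\<lambda>_. min e e') (\<lambda>w. f (x + w) * g (x + w))"
    by (rule pseries_mult[OF pseries_mono[OF c(2)] pseries_mono[OF d(2)]]) (use c d in auto)
  then show ?thesis using c d unfolding real_analytic_at_iff_pseries
    by (metis min_less_iff_conj)
qed

lemma real_analytic_at_power: "real_analytic_at f x \<Longrightarrow> real_analytic_at (\<lambda>y. f y ^ n) x"
  by (induction n) (auto intro: real_analytic_at_const real_analytic_at_mult)

lemma real_analytic_at_prod:
  "(\<And>i. i \<in> I \<Longrightarrow> real_analytic_at (f i) x) \<Longrightarrow> real_analytic_at (\<lambda>y. \<Prod>i\<in>I. f i y) x"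
  by (induction I rule: infinite_finite_induct) (auto intro: real_analytic_at_const real_analytic_at_mult)

lemma real_analytic_at_cong:
  assumes "real_analytic_at f x" and "eventually (\<lambda>y. f y = g y) (nhds x)"
  shows "real_analytic_at g x"
proof -
  obtain c e where c: "e > 0" "pseries c (\<lambda>_. e) (\<lambda>w. f (x + w))"
    using assms unfolding real_analytic_at_iff_pseries by blast
  obtain r where r: "r > 0" "\<And>y. dist y x < r \<Longrightarrow> f y = g y"
    using assms(2) unfolding eventually_nhds_metric by blast
  \<comment> \<open>The two functions agree on a Euclidean ball. The sum of the absolute coordinates
    bounds the norm, so a cube of half-width r / d fits inside.\<close>
  define e' where "e' = min e (r / real CARD('a))"
  have "e' > 0" using c r by (simp add: e'_def)
  moreover have "pseries c (\<lambda>_. e') (\<lambda>w. g (x + w))"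
    unfolding pseries_def
  proof safe
    fix w :: "real^'a" assume w: "\<forall>i. \<bar>w $ i\<bar> < e'"
    have "norm w \<le> (\<Sum>i\<in>UNIV. \<bar>w $ i\<bar>)" by (rule norm_le_l1_cart)
    also have "\<dots> < (\<Sum>i\<in>(UNIV :: 'a set). r / real CARD('a))"
      using w by (intro sum_strict_mono) (auto simp: e'_def)
    also have "\<dots> = r" by simp
    finally have "f (x + w) = g (x + w)" by (intro r) (simp add: dist_norm)
    then show "((\<lambda>\<alpha>. c \<alpha> * mpow w \<alpha>) has_sum g (x + w)) UNIV"
      using pseriesD[OF c(2), of w] w by (simp add: e'_def)
  qed
  ultimately show ?thesis unfolding real_analytic_at_iff_pseries by blast
qed

section \<open>Composition with a power series in one variable\<close>

definition msum :: "('d \<Rightarrow> nat) list \<Rightarrow> 'd \<Rightarrow> nat" where "msum xs i = (\<Sum>\<alpha>\<leftarrow>xs. \<alpha> i)"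

lemma mpow_msum:
  fixes w :: "real^'d::finite"
  shows "mpow w (msum xs) = (\<Prod>\<alpha>\<leftarrow>xs. mpow w \<alpha>)"
proof (induction xs)
  case Nil
  have "msum [] = (\<lambda>_ :: 'd. 0)" by (simp add: msum_def fun_eq_iff)
  then show ?case by simp
next
  case (Cons \<alpha> xs)
  have "msum (\<alpha> # xs) = (\<lambda>i. \<alpha> i + msum xs i)" by (simp add: msum_def fun_eq_iff)
  then show ?case using Cons by (simp add: mpow_add)
qed

lemma has_sum_prod_list:
  fixes t :: "'a \<Rightarrow> real"
  assumes "(t has_sum T) UNIV"
  shows "((\<lambda>xs. \<Prod>x\<leftarrow>xs. t x) has_sum T ^ k) {xs. length xs = k}"
proof (induction k)
  case (Suc k)
  obtain T' where T': "((\<lambda>x. \<bar>t x\<bar>) has_sum T') UNIV"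
    using has_sum_imp_summable[OF assms] summable_abs_real[of t UNIV] by (auto simp: summable_on_def)
  obtain A where A: "((\<lambda>xs. \<bar>\<Prod>x\<leftarrow>xs. t x\<bar>) has_sum A) {xs. length xs = k}"
    using has_sum_imp_summable[OF Suc.IH] summable_abs_real[of "\<lambda>xs. \<Prod>x\<leftarrow>xs. t x"] by (auto simp: summable_on_def)
  have "((\<lambda>(x, xs). t x * (\<Prod>x\<leftarrow>xs. t x)) has_sum T * T ^ k) (Sigma UNIV (\<lambda>_. {xs. length xs = k}))"
  proof (rule has_sum_Sigma_abs)
    show "((\<lambda>xs. case (x, xs) of (x, xs) \<Rightarrow> t x * (\<Prod>x\<leftarrow>xs. t x)) has_sum t x * T ^ k) {xs. length xs = k}" for x
      using Suc.IH by (auto intro: has_sum_cmult_right)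
    show "((\<lambda>xs. \<bar>case (x, xs) of (x, xs) \<Rightarrow> t x * (\<Prod>x\<leftarrow>xs. t x)\<bar>) has_sum \<bar>t x\<bar> * A) {xs. length xs = k}" for x
      using A by (auto simp: abs_mult intro: has_sum_cmult_right)
    show "(\<lambda>x. \<bar>t x\<bar> * A) summable_on UNIV"
      using T' by (intro summable_on_cmult_left) (auto simp: summable_on_def)
    show "((\<lambda>x. t x * T ^ k) has_sum T * T ^ k) UNIV" using assms by (rule has_sum_cmult_left)
  qed
  also have "?this \<longleftrightarrow> ((\<lambda>xs. \<Prod>x\<leftarrow>xs. t x) has_sum T ^ Suc k) {xs. length xs = Suc k}"
    by (rule has_sum_reindex_bij_witness[where i = "\<lambda>xs. (hd xs, tl xs)" and j = "\<lambda>(x, xs). x # xs"])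
      (auto simp: length_Suc_conv)
  finally show ?case .
qed (auto intro: has_sum_finiteI)

text \<open>The k-th power of the inner series has one term per list of k exponents, so the
  composite has one term per list of any length. Collecting lists with the same total exponent gives
  this coefficient.\<close>

definition comp_coeff :: "(nat \<Rightarrow> real) \<Rightarrow> (('d \<Rightarrow> nat) \<Rightarrow> real) \<Rightarrow> ('d \<Rightarrow> nat) \<Rightarrow> real" where
  "comp_coeff a c \<alpha> = infsum (\<lambda>xs. a (length xs) * (\<Prod>\<beta>\<leftarrow>xs. c \<beta>)) {xs \<in> UNIV. msum xs = \<alpha>}"

lemma pseries_compose:
  fixes h :: "real^'d::finite \<Rightarrow> real"
  assumes c: "pseries c \<rho> h" and \<rho>: "\<And>i. \<rho> i > 0" and c0: "c (\<lambda>_. 0) = 0"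
    and F: "\<And>t. \<bar>t\<bar> < r \<Longrightarrow> ((\<lambda>k. a k * t ^ k) has_sum F t) UNIV" and r: "r > 0"
  shows "\<exists>\<sigma> > 0. pseries (comp_coeff a c) (\<lambda>_. \<sigma>) (\<lambda>w. F (h w))"
proof -
  define s where "s = Min (range \<rho>) / 2"
  have s: "s > 0" "s < \<rho> i" for i
  proof -
    have "Min (range \<rho>) > 0" using \<rho> by (subst Min_gr_iff) auto
    moreover have "Min (range \<rho>) \<le> \<rho> i" by simp
    ultimately show "s > 0" "s < \<rho> i" unfolding s_def by linarith+
  qed
  have sumC: "(\<lambda>\<alpha>. \<bar>c \<alpha>\<bar> * s ^ deg \<alpha>) summable_on UNIV"
  proof -
    have "(\<lambda>\<alpha>. \<bar>c \<alpha>\<bar> * \<bar>mpow (\<chi> i. s) \<alpha>\<bar>) summable_on UNIV"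
      using c by (rule pseries_summable) (use s in auto)
    then show ?thesis using s(1) by (auto simp: mpow_const)
  qed
  define S where "S = infsum (\<lambda>\<alpha>. \<bar>c \<alpha>\<bar> * s ^ deg \<alpha>) UNIV"
  have S: "((\<lambda>\<alpha>. \<bar>c \<alpha>\<bar> * s ^ deg \<alpha>) has_sum S) UNIV" using sumC unfolding S_def by simp
  have S0: "S \<ge> 0" using S by (rule has_sum_nonneg) (use s in auto)
  \<comment> \<open>The inner series has no constant term, so shrinking the cube by \<delta> <= 1
    scales its absolute sum \<open>S\<close> by at most \<delta>; the factor r / (S + 1) brings it
    below the radius r of the outer series.\<close>
  define \<delta> where "\<delta> = min 1 (r / (S + 1))"
  have \<delta>: "\<delta> > 0" "\<delta> \<le> 1" "\<delta> * S < r"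
  proof -
    show "\<delta> > 0" "\<delta> \<le> 1" using r S0 by (auto simp: \<delta>_def)
    have "\<delta> * S \<le> r / (S + 1) * S" using S0 by (intro mult_right_mono) (auto simp: \<delta>_def)
    also have "\<dots> < r" using r S0 by (simp add: field_simps)
    finally show "\<delta> * S < r" .
  qed
  have "((\<lambda>xs. (a (length xs) * (\<Prod>\<beta>\<leftarrow>xs. c \<beta>)) * mpow w (msum xs)) has_sum F (h w)) UNIV"
    if w: "\<And>i. \<bar>w $ i\<bar> < \<delta> * s" for w
  proof -
    have \<delta>s: "\<delta> * s \<le> s" using \<delta> s(1) by (simp add: mult_le_cancel_right1)
    have w\<rho>: "\<bar>w $ i\<bar> < \<rho> i" for i using w[of i] \<delta>s s(2)[of i] by linarith
    define t where "t = (\<lambda>\<alpha>. c \<alpha> * mpow w \<alpha>)"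
    have t: "(t has_sum h w) UNIV" unfolding t_def using pseriesD[OF c w\<rho>] .
    obtain T where T: "((\<lambda>\<alpha>. \<bar>t \<alpha>\<bar>) has_sum T) UNIV"
      using has_sum_imp_summable[OF t] summable_abs_real[of t UNIV] by (auto simp: summable_on_def)
    have tle: "\<bar>t \<alpha>\<bar> \<le> \<delta> * (\<bar>c \<alpha>\<bar> * s ^ deg \<alpha>)" for \<alpha>
    proof (cases "\<alpha> = (\<lambda>_. 0)")
      case True then show ?thesis using c0 by (simp add: t_def)
    next
      case False
      then obtain i where "\<alpha> i > 0" by auto
      then have dg: "deg \<alpha> \<ge> 1"
        using member_le_sum[of i UNIV \<alpha>] unfolding deg_def by simp
      have "\<bar>mpow w \<alpha>\<bar> \<le> (\<delta> * s) ^ deg \<alpha>" using w by (intro mpow_le_deg) (simp add: less_imp_le)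
      also have "\<dots> = \<delta> ^ deg \<alpha> * s ^ deg \<alpha>" by (rule power_mult_distrib)
      also have "\<dots> \<le> \<delta> ^ 1 * s ^ deg \<alpha>"
        using \<delta> s(1) dg by (intro mult_right_mono power_decreasing) auto
      finally show ?thesis unfolding t_def abs_mult
        by (metis abs_ge_zero mult.left_commute mult_left_mono power_one_right)
    qed
    have "T \<le> \<delta> * S" using T has_sum_cmult_right[OF S, of \<delta>] by (rule has_sum_mono) (rule tle)
    then have Tr: "T < r" using \<delta>(3) by linarith
    have T0: "T \<ge> 0" using T by (rule has_sum_nonneg) simp
    have hT: "\<bar>h w\<bar> \<le> T"
    proof -
      have "h w \<le> T" using t T by (rule has_sum_mono) simp
      moreover have "((\<lambda>x. - t x) has_sum - h w) UNIV" using t by (simp only: has_sum_uminus minus_minus)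
      then have "- h w \<le> T" using T by (rule has_sum_mono) simp
      ultimately show ?thesis by linarith
    qed
    have "((\<lambda>(k, xs). a k * (\<Prod>\<alpha>\<leftarrow>xs. t \<alpha>)) has_sum F (h w)) (Sigma UNIV (\<lambda>k. {xs. length xs = k}))"
    proof (rule has_sum_Sigma_abs)
      show "((\<lambda>xs. case (k, xs) of (k, xs) \<Rightarrow> a k * (\<Prod>\<alpha>\<leftarrow>xs. t \<alpha>)) has_sum a k * h w ^ k) {xs. length xs = k}" for k
        using has_sum_prod_list[OF t] by (auto intro: has_sum_cmult_right)
      have abs_prod_list: "\<bar>\<Prod>\<alpha>\<leftarrow>xs. t \<alpha>\<bar> = (\<Prod>\<alpha>\<leftarrow>xs. \<bar>t \<alpha>\<bar>)" for xs
        by (induction xs) (auto simp: abs_mult)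
      show "((\<lambda>xs. \<bar>case (k, xs) of (k, xs) \<Rightarrow> a k * (\<Prod>\<alpha>\<leftarrow>xs. t \<alpha>)\<bar>) has_sum \<bar>a k\<bar> * T ^ k) {xs. length xs = k}" for k
        using has_sum_prod_list[OF T] by (auto simp: abs_mult abs_prod_list intro: has_sum_cmult_right)
      have "(\<lambda>k. a k * T ^ k) summable_on UNIV"
        using F[of T] T0 Tr by (auto simp: summable_on_def)
      then show "(\<lambda>k. \<bar>a k\<bar> * T ^ k) summable_on UNIV"
        using summable_abs_real[of "\<lambda>k. a k * T ^ k"] T0 by (simp add: abs_mult)
      show "((\<lambda>k. a k * h w ^ k) has_sum F (h w)) UNIV" using hT Tr by (intro F) linarith
    qed
    also have "?this \<longleftrightarrow> ((\<lambda>xs. a (length xs) * (\<Prod>\<alpha>\<leftarrow>xs. t \<alpha>)) has_sum F (h w)) UNIV"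
      by (rule has_sum_reindex_bij_witness[where i = "\<lambda>xs. (length xs, xs)" and j = snd]) auto
    also have "(\<lambda>xs. a (length xs) * (\<Prod>\<alpha>\<leftarrow>xs. t \<alpha>)) = (\<lambda>xs. (a (length xs) * (\<Prod>\<beta>\<leftarrow>xs. c \<beta>)) * mpow w (msum xs))"
    proof
      fix xs
      have "(\<Prod>\<alpha>\<leftarrow>xs. t \<alpha>) = (\<Prod>\<beta>\<leftarrow>xs. c \<beta>) * (\<Prod>\<alpha>\<leftarrow>xs. mpow w \<alpha>)"
        unfolding t_def by (induction xs) auto
      then show "a (length xs) * (\<Prod>\<alpha>\<leftarrow>xs. t \<alpha>) = (a (length xs) * (\<Prod>\<beta>\<leftarrow>xs. c \<beta>)) * mpow w (msum xs)"
        by (simp add: mpow_msum)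
    qed
    finally show ?thesis .
  qed
  note * = pseries_group(2)[OF this]
  have "pseries (comp_coeff a c) (\<lambda>_. \<delta> * s) (\<lambda>w. F (h w))"
    unfolding comp_coeff_def using \<delta> s by (intro *) auto
  then show ?thesis using \<delta> s by (intro exI[of _ "\<delta> * s"]) auto
qed

lemma real_analytic_at_inverse:
  assumes "real_analytic_at h x" "h x \<noteq> 0"
  shows "real_analytic_at (\<lambda>y. inverse (h y)) x"
proof -
  obtain c e where c: "e > 0" "pseries c (\<lambda>_. e) (\<lambda>w. h (x + w))"
    using assms unfolding real_analytic_at_iff_pseries by blast
  \<comment> \<open>\<open>d\<close> is the series of 1 - h / h(x), without constant term; 1 / h is
    the geometric series in it, divided by h(x).\<close>
  define d where "d = (\<lambda>\<alpha>. (if \<alpha> = (\<lambda>_. 0) then 1 else 0) + (- inverse (h x)) * c \<alpha>)"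
  have d: "pseries d (\<lambda>_. e) (\<lambda>w. 1 + (- inverse (h x)) * h (x + w))"
    unfolding d_def by (intro pseries_add pseries_const pseries_cmult c)
  have "d (\<lambda>_. 0) = 0" using pseries_zero[OF c(2) c(1)] assms(2) by (simp add: d_def)
  moreover have "((\<lambda>k. 1 * t ^ k) has_sum inverse (1 - t)) UNIV" if "\<bar>t\<bar> < 1" for t :: real
    by (rule norm_summable_imp_has_sum)
      (use that geometric_sums[of t] in \<open>auto simp: power_abs inverse_eq_divide intro: summable_geometric\<close>)
  ultimately have "\<exists>\<sigma>>0. pseries (comp_coeff (\<lambda>_. 1) d) (\<lambda>_. \<sigma>) (\<lambda>w. inverse (1 - (1 + (- inverse (h x)) * h (x + w))))"
    by (intro pseries_compose[OF d c(1), where F = "\<lambda>t. inverse (1 - t)" and r = 1]) auto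
  then obtain \<sigma> where "\<sigma> > 0" "pseries (comp_coeff (\<lambda>_. 1) d) (\<lambda>_. \<sigma>) (\<lambda>w. inverse (1 - (1 + (- inverse (h x)) * h (x + w))))"
    by blast
  then have "pseries (\<lambda>\<alpha>. inverse (h x) * comp_coeff (\<lambda>_. 1) d \<alpha>) (\<lambda>_. \<sigma>)
      (\<lambda>w. inverse (h x) * inverse (1 - (1 + (- inverse (h x)) * h (x + w))))"
    by (intro pseries_cmult)
  moreover have "(\<lambda>w. inverse (h x) * inverse (1 - (1 + (- inverse (h x)) * h (x + w)))) = (\<lambda>w. inverse (h (x + w)))"
    using assms(2) by (simp add: fun_eq_iff field_simps)
  ultimately have "pseries (\<lambda>\<alpha>. inverse (h x) * comp_coeff (\<lambda>_. 1) d \<alpha>) (\<lambda>_. \<sigma>) (\<lambda>w. inverse (h (x + w)))"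
    by simp
  then show ?thesis using \<open>\<sigma> > 0\<close> unfolding real_analytic_at_iff_pseries by blast
qed

lemma pseries_exp:
  fixes h :: "real^'d::finite \<Rightarrow> real"
  assumes c: "pseries c \<rho> h" and \<rho>: "\<And>i. \<rho> i > 0" and c0: "c (\<lambda>_. 0) = 0"
  shows "\<exists>\<sigma> > 0. pseries (comp_coeff (\<lambda>k. 1 / fact k) c) (\<lambda>_. \<sigma>) (\<lambda>w. exp (h w))"
proof (rule pseries_compose[OF c \<rho> c0, where r = 1])
  fix t :: real
  have "(\<lambda>k. t ^ k /\<^sub>R fact k) sums exp t" by (rule exp_converges)
  moreover have "summable (\<lambda>k. norm (t ^ k /\<^sub>R fact k))" by (rule summable_norm_exp)
  ultimately have "((\<lambda>k. t ^ k /\<^sub>R fact k) has_sum exp t) UNIV" by (intro norm_summable_imp_has_sum)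
  then show "((\<lambda>k. 1 / fact k * t ^ k) has_sum exp t) UNIV" by (simp add: field_simps)
qed simp

text \<open>Only lists of length one and two contribute to low-order coefficients of the exponential.\<close>

lemma comp_coeff_exp_low:
  fixes c :: "('d::finite \<Rightarrow> nat) \<Rightarrow> real" and wt :: "('d \<Rightarrow> nat) \<Rightarrow> nat"
  assumes add: "\<And>\<alpha> \<beta>. wt (\<lambda>i. \<alpha> i + \<beta> i) = wt \<alpha> + wt \<beta>"
    and low: "\<And>\<alpha>. wt \<alpha> < n \<Longrightarrow> c \<alpha> = 0" and n: "n \<ge> 1" and \<alpha>: "wt \<alpha> \<le> 2 * n" "\<alpha> \<noteq> (\<lambda>_. 0)"
  shows "comp_coeff (\<lambda>k. 1 / fact k) c \<alpha> = c \<alpha> + (\<Sum>\<beta> | \<forall>i. \<beta> i \<le> \<alpha> i. c \<beta> * c (\<lambda>i. \<alpha> i - \<beta> i)) / 2"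
proof -
  let ?B = "{\<beta> :: 'd \<Rightarrow> nat. \<forall>i. \<beta> i \<le> \<alpha> i}"
  let ?f = "\<lambda>xs. 1 / fact (length xs) * (\<Prod>\<beta>\<leftarrow>xs. c \<beta>)"
  \<comment> \<open>Ordered pairs of exponents with sum \<alpha>. Their factor 1 / 2! in the
    exponential is the division by 2 in the claim.\<close>
  let ?G = "(\<lambda>\<beta>. [\<beta>, \<lambda>i. \<alpha> i - \<beta> i]) ` ?B"
  have fin: "finite ?B" by (rule finite_idx_le)
  \<comment> \<open>Each factor has weight at least n, so three factors overshoot 2n. The empty list
    is ruled out later because \<alpha> is not zero.\<close>
  have wt_ge: "wt (msum xs) \<ge> n * length xs" if "(\<Prod>\<beta>\<leftarrow>xs. c \<beta>) \<noteq> 0" for xs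
    using that
  proof (induction xs)
    case (Cons \<beta> xs)
    have "msum (\<beta> # xs) = (\<lambda>i. \<beta> i + msum xs i)" by (simp add: msum_def fun_eq_iff)
    moreover have "wt \<beta> \<ge> n" using low[of \<beta>] Cons.prems by force
    ultimately show ?case using Cons by (auto simp: add)
  qed simp
  have "(?f has_sum (\<Sum>xs\<in>insert [\<alpha>] ?G. ?f xs)) {xs \<in> UNIV. msum xs = \<alpha>}"
  proof (rule has_sum_finite_neutralI)
    show "finite (insert [\<alpha>] ?G)" using fin by simp
    show "insert [\<alpha>] ?G \<subseteq> {xs \<in> UNIV. msum xs = \<alpha>}" by (auto simp: msum_def fun_eq_iff)
    fix xs assume xs: "xs \<in> {xs \<in> UNIV. msum xs = \<alpha>} - insert [\<alpha>] ?G"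
    then have ms: "msum xs = \<alpha>" by simp
    show "?f xs = 0"
    proof (rule ccontr)
      assume "?f xs \<noteq> 0"
      then have "n * length xs \<le> 2 * n" using wt_ge[of xs] ms \<alpha> by fastforce
      then have "length xs \<le> 2" using n by (metis mult.commute mult_le_cancel1 not_one_le_zero neq0_conv)
      then consider "xs = []" | \<beta> where "xs = [\<beta>]" | \<beta> \<gamma> where "xs = [\<beta>, \<gamma>]"
        by (cases xs; cases "tl xs"; cases "tl (tl xs)") auto
      then show False
      proof cases
        case 1 then show False using ms \<alpha> by (auto simp: msum_def fun_eq_iff)
      next
        case 2 then show False using ms xs by (auto simp: msum_def fun_eq_iff)
      next
        case 3
        then have g: "\<And>i. \<alpha> i = \<beta> i + \<gamma> i" using ms by (auto simp: msum_def fun_eq_iff)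
        then have "\<gamma> = (\<lambda>i. \<alpha> i - \<beta> i)" "\<beta> \<in> ?B" by auto
        then show False using 3 xs by blast
      qed
    qed
  qed simp
  then have "comp_coeff (\<lambda>k. 1 / fact k) c \<alpha> = (\<Sum>xs\<in>insert [\<alpha>] ?G. ?f xs)"
    unfolding comp_coeff_def by (rule infsumI)
  also have "\<dots> = c \<alpha> + (\<Sum>xs\<in>?G. ?f xs)" using fin by (subst sum.insert) auto
  also have "(\<Sum>xs\<in>?G. ?f xs) = (\<Sum>\<beta>\<in>?B. c \<beta> * c (\<lambda>i. \<alpha> i - \<beta> i)) / 2"
    by (subst sum.reindex) (auto intro: inj_onI simp: sum_divide_distrib)
  finally show ?thesis .
qed

section \<open>Order of vanishing\<close>

definition bigO_at :: "('a::real_normed_vector \<Rightarrow> real) \<Rightarrow> 'a \<Rightarrow> nat \<Rightarrow> bool" where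
  "bigO_at F P n \<longleftrightarrow> (\<exists>C. \<forall>\<^sub>F w in nhds P. \<bar>F w\<bar> \<le> C * norm (w - P) ^ n)"

text \<open>The order of vanishing is defined by growth, since it then depends on |F| only; a normal
  crossing describes the Jacobian only up to sign.\<close>

definition ord_at :: "('a::real_normed_vector \<Rightarrow> real) \<Rightarrow> 'a \<Rightarrow> nat \<Rightarrow> bool" where
  "ord_at F P n \<longleftrightarrow> bigO_at F P n \<and> \<not> bigO_at F P (Suc n)"

lemma isCont_tendsto_nhds: "isCont f x \<Longrightarrow> (f \<longlongrightarrow> f x) (nhds x)"
  by (simp add: isCont_def tendsto_at_iff_tendsto_nhds)

lemma bigO_at_mono:
  assumes "bigO_at F P n'" "n \<le> n'"
  shows "bigO_at F P n"
proof -
  obtain C where C: "\<forall>\<^sub>F w in nhds P. \<bar>F w\<bar> \<le> C * norm (w - P) ^ n'"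
    using assms unfolding bigO_at_def by blast
  have "\<forall>\<^sub>F w in nhds P. norm (w - P) < 1"
    by (auto simp: eventually_nhds_metric dist_norm intro!: exI[of _ 1])
  with C have "\<forall>\<^sub>F w in nhds P. \<bar>F w\<bar> \<le> \<bar>C\<bar> * norm (w - P) ^ n"
  proof eventually_elim
    case (elim w)
    have "C * norm (w - P) ^ n' \<le> \<bar>C\<bar> * norm (w - P) ^ n'" by (intro mult_right_mono) auto
    also have "\<dots> \<le> \<bar>C\<bar> * norm (w - P) ^ n"
      using elim assms(2) by (intro mult_left_mono power_decreasing) auto
    finally show ?case using elim by linarith
  qed
  then show ?thesis unfolding bigO_at_def by blast
qed

lemma ord_at_unique: "ord_at F P n \<Longrightarrow> ord_at F P n' \<Longrightarrow> n = n'"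
  unfolding ord_at_def by (metis bigO_at_mono linorder_neqE_nat Suc_leI)

text \<open>Coordinates that do not vanish at P are absorbed into the unit \<open>B\<close>. Along
  the diagonal through P every vanishing coordinate equals t, so the upper bound is attained up to a
  constant factor.\<close>

lemma ord_at_monomial:
  fixes P :: "real^'d::finite"
  assumes A: "isCont A P" "A P \<noteq> 0"
    and F: "\<forall>\<^sub>F w in nhds P. \<bar>F w\<bar> = \<bar>A w * (\<Prod>l\<in>UNIV. w $ l ^ k l)\<bar>"
  shows "ord_at F P (\<Sum>l | P $ l = 0. k l)"
proof -
  define T where "T = {l. P $ l = 0}"
  define B where "B = (\<lambda>w. A w * (\<Prod>l\<in>-T. w $ l ^ k l))"
  have contB: "isCont B P" unfolding B_def using A(1) by (intro continuous_intros)
  have B0: "B P \<noteq> 0" using A(2) by (auto simp: B_def T_def)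
  have split: "(\<Prod>l\<in>UNIV. w $ l ^ k l) = (\<Prod>l\<in>-T. w $ l ^ k l) * (\<Prod>l\<in>T. w $ l ^ k l)" for w :: "real^'d"
    by (metis Compl_partition2 Compl_disjoint2 finite prod.union_disjoint)
  have F': "\<forall>\<^sub>F w in nhds P. \<bar>F w\<bar> = \<bar>B w\<bar> * (\<Prod>l\<in>T. \<bar>w $ l\<bar> ^ k l)"
    using F by eventually_elim (simp add: split B_def abs_mult abs_prod power_abs)
  let ?n = "\<Sum>l\<in>T. k l"
  have "\<forall>\<^sub>F w in nhds P. \<bar>B w\<bar> < \<bar>B P\<bar> + 1"
  proof -
    have "isCont (\<lambda>w. \<bar>B w\<bar>) P" using contB by (intro continuous_intros)
    then have "((\<lambda>w. \<bar>B w\<bar>) \<longlongrightarrow> \<bar>B P\<bar>) (nhds P)" by (rule isCont_tendsto_nhds)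
    then show ?thesis by (rule order_tendstoD) simp
  qed
  with F' have "\<forall>\<^sub>F w in nhds P. \<bar>F w\<bar> \<le> (\<bar>B P\<bar> + 1) * norm (w - P) ^ ?n"
  proof eventually_elim
    case (elim w)
    have "(\<Prod>l\<in>T. \<bar>w $ l\<bar> ^ k l) \<le> (\<Prod>l\<in>T. norm (w - P) ^ k l)"
    proof (intro prod_mono conjI power_mono)
      fix l assume "l \<in> T"
      then have "w $ l = (w - P) $ l" by (simp add: T_def)
      then show "\<bar>w $ l\<bar> \<le> norm (w - P)" by (metis component_le_norm_cart)
    qed auto
    then show ?case using elim by (auto simp: power_sum intro!: mult_mono prod_nonneg)
  qed
  then have up: "bigO_at F P ?n" unfolding bigO_at_def by blast
  have low: "\<not> bigO_at F P (Suc ?n)"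
  proof
    assume "bigO_at F P (Suc ?n)"
    then obtain C where "\<forall>\<^sub>F w in nhds P. \<bar>F w\<bar> \<le> C * norm (w - P) ^ Suc ?n"
      unfolding bigO_at_def by blast
    with F' have ev: "\<forall>\<^sub>F w in nhds P. \<bar>B w\<bar> * (\<Prod>l\<in>T. \<bar>w $ l\<bar> ^ k l) \<le> C * norm (w - P) ^ Suc ?n"
      by eventually_elim simp
    define \<gamma> :: "real \<Rightarrow> real^'d" where "\<gamma> = (\<lambda>t. P + t *\<^sub>R 1)"
    have lim: "(\<gamma> \<longlongrightarrow> P) (at_right 0)"
      unfolding \<gamma>_def by (auto intro!: tendsto_eq_intros)
    have "\<forall>\<^sub>F t in at_right 0. \<bar>B (\<gamma> t)\<bar> * (\<Prod>l\<in>T. \<bar>\<gamma> t $ l\<bar> ^ k l) \<le> C * norm (\<gamma> t - P) ^ Suc ?n"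
      using filterlim_iff[THEN iffD1, OF lim, rule_format, OF ev] .
    moreover have "\<forall>\<^sub>F t :: real in at_right 0. t > 0" by (simp add: eventually_at_right_less)
    ultimately have le: "\<forall>\<^sub>F t in at_right 0. \<bar>B (\<gamma> t)\<bar> \<le> C * norm (1 :: real^'d) ^ Suc ?n * t"
    proof eventually_elim
      case (elim t)
      have "(\<Prod>l\<in>T. \<bar>\<gamma> t $ l\<bar> ^ k l) = t ^ ?n"
        using elim by (simp add: \<gamma>_def T_def power_sum)
      moreover have "norm (\<gamma> t - P) ^ Suc ?n = norm (1 :: real^'d) ^ Suc ?n * t * t ^ ?n"
        using elim by (simp add: \<gamma>_def power_mult_distrib)
      ultimately have "\<bar>B (\<gamma> t)\<bar> * t ^ ?n \<le> (C * norm (1 :: real^'d) ^ Suc ?n * t) * t ^ ?n"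
        using elim by (simp add: mult_ac)
      then show ?case using elim(2) by simp
    qed
    have l1: "((\<lambda>t. \<bar>B (\<gamma> t)\<bar>) \<longlongrightarrow> \<bar>B P\<bar>) (at_right 0)"
      using isCont_tendsto_compose[OF contB lim] by (rule tendsto_rabs)
    have l2: "((\<lambda>t. C * norm (1 :: real^'d) ^ Suc ?n * t) \<longlongrightarrow> 0) (at_right 0)"
      by (auto intro!: tendsto_eq_intros)
    have "\<bar>B P\<bar> \<le> 0" by (rule tendsto_le[OF trivial_limit_at_right_real l2 l1 le])
    then show False using B0 by simp
  qed
  show ?thesis using up low unfolding ord_at_def T_def by simp
qed

text \<open>A differentiable map satisfies a Lipschitz bound at the single point P, and an upper
  growth bound needs no more.\<close>

lemma bigO_at_compose:
  assumes F: "bigO_at F (\<psi> P) n" and \<psi>: "(\<psi> has_derivative D) (at P)"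
  shows "bigO_at (\<lambda>w. F (\<psi> w)) P n"
proof -
  obtain C where C: "\<forall>\<^sub>F w in nhds (\<psi> P). \<bar>F w\<bar> \<le> C * norm (w - \<psi> P) ^ n"
    using F unfolding bigO_at_def by blast
  have lim: "(\<psi> \<longlongrightarrow> \<psi> P) (nhds P)"
    using has_derivative_continuous[OF \<psi>] by (rule isCont_tendsto_nhds)
  obtain B where B: "\<And>w. norm (D w) \<le> norm w * B"
    using has_derivative_bounded_linear[OF \<psi>] bounded_linear.bounded by blast
  have "\<forall>\<^sub>F w in nhds P. norm (\<psi> w - \<psi> P) \<le> (B + 1) * norm (w - P)"
  proof -
    obtain d where d: "d > 0" "\<And>y. norm (y - P) < d \<Longrightarrow> norm (\<psi> y - \<psi> P - D (y - P)) \<le> 1 * norm (y - P)"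
      using \<psi> unfolding has_derivative_at_alt by (metis zero_less_one)
    have "norm (\<psi> w - \<psi> P) \<le> (B + 1) * norm (w - P)" if "dist w P < d" for w
    proof -
      have "norm (\<psi> w - \<psi> P) \<le> norm (\<psi> w - \<psi> P - D (w - P)) + norm (D (w - P))"
        by (metis diff_add_cancel norm_triangle_ineq)
      also have "\<dots> \<le> norm (w - P) + norm (w - P) * B"
        using d(2)[of w] that B[of "w - P"] by (simp add: dist_norm)
      finally show ?thesis by (simp add: algebra_simps)
    qed
    then show ?thesis using d(1) unfolding eventually_nhds_metric by blast
  qed
  moreover have "\<forall>\<^sub>F w in nhds P. \<bar>F (\<psi> w)\<bar> \<le> C * norm (\<psi> w - \<psi> P) ^ n"
    using filterlim_iff[THEN iffD1, OF lim, rule_format, OF C] .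
  ultimately have "\<forall>\<^sub>F w in nhds P. \<bar>F (\<psi> w)\<bar> \<le> (\<bar>C\<bar> * (B + 1) ^ n) * norm (w - P) ^ n"
  proof eventually_elim
    case (elim w)
    have "C * norm (\<psi> w - \<psi> P) ^ n \<le> \<bar>C\<bar> * norm (\<psi> w - \<psi> P) ^ n" by (intro mult_right_mono) auto
    also have "\<dots> \<le> \<bar>C\<bar> * ((B + 1) * norm (w - P)) ^ n"
      using elim by (intro mult_left_mono power_mono) auto
    finally show ?case using elim by (simp add: power_mult_distrib mult_ac)
  qed
  then show ?thesis unfolding bigO_at_def by blast
qed

lemma bigO_at_cong: "\<forall>\<^sub>F w in nhds P. \<bar>F w\<bar> = \<bar>G w\<bar> \<Longrightarrow> bigO_at F P n = bigO_at G P n"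
proof -
  assume e: "\<forall>\<^sub>F w in nhds P. \<bar>F w\<bar> = \<bar>G w\<bar>"
  have "(\<forall>\<^sub>F w in nhds P. \<bar>F w\<bar> \<le> C * norm (w - P) ^ n) \<longleftrightarrow> (\<forall>\<^sub>F w in nhds P. \<bar>G w\<bar> \<le> C * norm (w - P) ^ n)" for C
    by (rule eventually_subst) (use e in eventually_elim, simp)
  then show ?thesis unfolding bigO_at_def by simp
qed

lemma ord_at_cong: "ord_at F P n \<Longrightarrow> \<forall>\<^sub>F w in nhds P. \<bar>F w\<bar> = \<bar>G w\<bar> \<Longrightarrow> ord_at G P n"
  unfolding ord_at_def by (simp add: bigO_at_cong[where F = F and G = G])

lemma bigO_at_mult_bounded:
  assumes F: "bigO_at F P n" and D: "isCont D P"
  shows "bigO_at (\<lambda>w. F w * D w) P n"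
proof -
  obtain C where C: "\<forall>\<^sub>F w in nhds P. \<bar>F w\<bar> \<le> C * norm (w - P) ^ n"
    using F unfolding bigO_at_def by blast
  have "\<forall>\<^sub>F w in nhds P. \<bar>D w\<bar> < \<bar>D P\<bar> + 1"
  proof -
    have "isCont (\<lambda>w. \<bar>D w\<bar>) P" using D by (intro continuous_intros)
    then have "((\<lambda>w. \<bar>D w\<bar>) \<longlongrightarrow> \<bar>D P\<bar>) (nhds P)" by (rule isCont_tendsto_nhds)
    then show ?thesis by (rule order_tendstoD) simp
  qed
  with C have "\<forall>\<^sub>F w in nhds P. \<bar>F w * D w\<bar> \<le> (C * (\<bar>D P\<bar> + 1)) * norm (w - P) ^ n"
  proof eventually_elim
    case (elim w)
    have "\<bar>F w\<bar> * \<bar>D w\<bar> \<le> (C * norm (w - P) ^ n) * (\<bar>D P\<bar> + 1)"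
      using elim by (intro mult_mono) auto
    then show ?case by (simp add: abs_mult mult_ac)
  qed
  then show ?thesis unfolding bigO_at_def by blast
qed

lemma ord_at_mult_unit:
  assumes F: "ord_at F P n" and D: "isCont D P" "D P \<noteq> 0"
  shows "ord_at (\<lambda>w. F w * D w) P n"
proof -
  have "\<forall>\<^sub>F w in nhds P. D w \<noteq> 0"
    using D continuous_at_avoid[of P D 0] by (auto simp: eventually_nhds_metric dist_commute)
  then have "\<forall>\<^sub>F w in nhds P. \<bar>F w * D w * inverse (D w)\<bar> = \<bar>F w\<bar>"
    by eventually_elim (simp add: mult.assoc)
  then have cong: "bigO_at (\<lambda>w. F w * D w * inverse (D w)) P m = bigO_at F P m" for m
    by (rule bigO_at_cong)
  have "isCont (\<lambda>w. inverse (D w)) P" using D by (intro continuous_intros)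
  then have "bigO_at (\<lambda>w. F w * D w) P m \<Longrightarrow> bigO_at F P m" for m
    using bigO_at_mult_bounded[of "\<lambda>w. F w * D w" P m "\<lambda>w. inverse (D w)"] unfolding cong by blast
  then show ?thesis using F bigO_at_mult_bounded[of F P n D] D unfolding ord_at_def by blast
qed

section \<open>Analytic coordinate changes\<close>

definition Dmat :: "(real^'d::finite \<Rightarrow> real^'d) \<Rightarrow> real^'d \<Rightarrow> real^'d^'d" where
  "Dmat \<psi> u = (\<chi> i l. partial_deriv l (\<lambda>x. \<psi> x $ i) u)"

lemma analytic_has_derivative:
  fixes \<psi> :: "real^'d::finite \<Rightarrow> real^'d"
  assumes "\<And>i. real_analytic_at (\<lambda>x. \<psi> x $ i) u"
  shows "(\<psi> has_derivative (\<lambda>w. Dmat \<psi> u *v w)) (at u)"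
proof (subst has_derivative_componentwise_within, intro ballI)
  fix b :: "real^'d" assume "b \<in> Basis"
  then obtain i where b: "b = axis i 1" by (auto simp: Basis_vec_def)
  have "(\<lambda>w. (Dmat \<psi> u *v w) \<bullet> b) = (\<lambda>w. \<Sum>l\<in>UNIV. partial_deriv l (\<lambda>x. \<psi> x $ i) u * w $ l)"
    by (simp add: b inner_axis Dmat_def matrix_vector_mult_def)
  then show "((\<lambda>x. \<psi> x \<bullet> b) has_derivative (\<lambda>w. (Dmat \<psi> u *v w) \<bullet> b)) (at u)"
    using real_analytic_at_has_derivative[OF assms[of i]] by (simp add: b inner_axis)
qed

lemma jacobian_eq: "(f has_derivative (\<lambda>w. A *v w)) (at u) \<Longrightarrow> jacobian f (at u) = (A :: real^'d::finite^'d)"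
  unfolding jacobian_def by (metis frechet_derivative_at matrix_of_matrix_vector_mul)

lemma isCont_det_Dmat:
  assumes "\<And>i. real_analytic_at (\<lambda>x. \<psi> x $ i) u"
  shows "isCont (\<lambda>x. det (Dmat \<psi> x)) u"
  unfolding det_def Dmat_def vec_lambda_beta
  by (intro continuous_intros real_analytic_at_isCont[OF real_analytic_at_partial_deriv] assms)

lemma analytic_diffeoD:
  assumes "analytic_diffeo_on \<psi> V"
  shows "open V" "open (\<psi> ` V)" "inj_on \<psi> V"
    and "u \<in> V \<Longrightarrow> real_analytic_at (\<lambda>x. \<psi> x $ i) u"
    and "u \<in> V \<Longrightarrow> real_analytic_at (\<lambda>x. inv_into V \<psi> x $ i) (\<psi> u)"
  using assms unfolding analytic_diffeo_on_def analytic_map_on_def real_analytic_on_def by auto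

text \<open>The map and its inverse are both differentiable, so growth bounds transfer in both
  directions.\<close>

lemma ord_at_diffeo:
  assumes \<psi>: "analytic_diffeo_on \<psi> V" and u: "u \<in> V"
    and "ord_at F (\<psi> u) n" and "ord_at (\<lambda>w. F (\<psi> w)) u n'"
  shows "n = n'"
proof -
  note d = analytic_diffeoD[OF \<psi>]
  let ?\<chi> = "inv_into V \<psi>"
  have \<chi>u: "?\<chi> (\<psi> u) = u" using d(3) u by simp
  have fw: "bigO_at F (\<psi> u) m \<Longrightarrow> bigO_at (\<lambda>w. F (\<psi> w)) u m" for m
    using analytic_has_derivative[OF d(4)[OF u]] by (rule bigO_at_compose[rotated])
  have "\<forall>\<^sub>F v in nhds (\<psi> u). v \<in> \<psi> ` V" using d(2) u by (intro eventually_nhds_in_open) auto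
  then have "\<forall>\<^sub>F v in nhds (\<psi> u). \<bar>F (\<psi> (?\<chi> v))\<bar> = \<bar>F v\<bar>"
    by eventually_elim (simp add: f_inv_into_f)
  then have "bigO_at (\<lambda>w. F (\<psi> w)) u m \<Longrightarrow> bigO_at F (\<psi> u) m" for m
    using bigO_at_compose[of "\<lambda>w. F (\<psi> w)" ?\<chi> "\<psi> u" m] analytic_has_derivative[OF d(5)[OF u]] \<chi>u
      bigO_at_cong[where P = "\<psi> u" and F = "\<lambda>v. F (\<psi> (?\<chi> v))" and G = F] by auto
  with fw have "bigO_at F (\<psi> u) m \<longleftrightarrow> bigO_at (\<lambda>w. F (\<psi> w)) u m" for m by blast
  then show ?thesis using assms(3,4) ord_at_unique unfolding ord_at_def by blast
qed

lemma det_Dmat_diffeo: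
  fixes \<psi> :: "real^'d::finite \<Rightarrow> real^'d"
  assumes \<psi>: "analytic_diffeo_on \<psi> V" and u: "u \<in> V"
  shows "det (Dmat \<psi> u) \<noteq> 0"
proof -
  note d = analytic_diffeoD[OF \<psi>]
  let ?\<chi> = "inv_into V \<psi>"
  have \<chi>u: "?\<chi> (\<psi> u) = u" using d(3) u by simp
  have "((\<lambda>w. ?\<chi> (\<psi> w)) has_derivative (\<lambda>w. Dmat ?\<chi> (\<psi> u) *v (Dmat \<psi> u *v w))) (at u)"
    using analytic_has_derivative[OF d(4)[OF u]] analytic_has_derivative[OF d(5)[OF u]]
    by (rule has_derivative_compose)
  moreover have "\<forall>\<^sub>F w in nhds u. w = ?\<chi> (\<psi> w)"
    using eventually_nhds_in_open[OF d(1) u] by eventually_elim (simp add: d(3))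
  ultimately have "((\<lambda>w. w) has_derivative (\<lambda>w. Dmat ?\<chi> (\<psi> u) *v (Dmat \<psi> u *v w))) (at u)"
    by (smt (verit) eventually_mono has_derivative_transform_eventually eventually_nhds_conv_at UNIV_I)
  then have "(\<lambda>w. Dmat ?\<chi> (\<psi> u) *v (Dmat \<psi> u *v w)) = (\<lambda>w. w)"
    using has_derivative_unique has_derivative_ident by blast
  then have "Dmat ?\<chi> (\<psi> u) ** Dmat \<psi> u = mat 1"
    by (metis (no_types, lifting) matrix_eq matrix_vector_mul_assoc matrix_vector_mul_lid)
  then have "det (Dmat ?\<chi> (\<psi> u)) * det (Dmat \<psi> u) = 1" by (metis det_I det_mul)
  then show ?thesis by auto
qed

text \<open>The exponents along a coordinate hypersurface are the orders of vanishing at a generic point of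
  it, and these do not depend on the coordinates.\<close>

lemma nc_exponents_compare:
  fixes \<psi> :: "real^'d::finite \<Rightarrow> real^'d"
  assumes \<psi>: "analytic_diffeo_on \<psi> V" and 0: "0 \<in> V"
    and H: "\<forall>\<^sub>F v in nhds (\<psi> 0). H v = A v * (\<Prod>l\<in>UNIV. v $ l ^ k l)"
    and A: "\<forall>\<^sub>F v in nhds (\<psi> 0). isCont A v \<and> A v \<noteq> 0"
    and J: "\<forall>\<^sub>F v in nhds (\<psi> 0). \<bar>J v\<bar> = \<bar>B v * (\<Prod>l\<in>UNIV. v $ l ^ h l)\<bar>"
    and B: "\<forall>\<^sub>F v in nhds (\<psi> 0). isCont B v \<and> B v \<noteq> 0"
    and H': "\<And>u. u \<in> V \<Longrightarrow> H (\<psi> u) = a u * (\<Prod>l\<in>UNIV. u $ l ^ k' l)"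
    and J': "\<And>u. u \<in> V \<Longrightarrow> \<bar>J (\<psi> u) * det (Dmat \<psi> u)\<bar> = \<bar>b u * (\<Prod>l\<in>UNIV. u $ l ^ h' l)\<bar>"
    and ab: "real_analytic_at a 0" "real_analytic_at b 0" "a 0 \<noteq> 0" "b 0 \<noteq> 0"
    and k: "\<And>e. k e > 0 \<Longrightarrow> (e = i \<or> e = j) \<and> \<psi> 0 $ e = 0" and h: "\<And>e. h e > 0 \<Longrightarrow> k e > 0"
  shows "(\<Sum>l\<in>UNIV. k' l) = (\<Sum>l\<in>UNIV. k l)"
    and "k' l > 0 \<Longrightarrow> \<exists>e. k e > 0 \<and> k' l = k e \<and> h' l = h e"
proof -
  note d = analytic_diffeoD[OF \<psi>]
  have cont: "isCont \<psi> u" if "u \<in> V" for u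
    using analytic_has_derivative[OF d(4)[OF that]] has_derivative_continuous by blast
  have lim: "(\<psi> \<longlongrightarrow> \<psi> 0) (nhds 0)"
    using cont[OF 0] by (rule isCont_tendsto_nhds)
  have unit: "\<forall>\<^sub>F u in nhds 0. isCont f u \<and> f u \<noteq> 0" if f: "real_analytic_at f 0" "f 0 \<noteq> 0" for f :: "real^'d \<Rightarrow> real"
  proof -
    have "\<forall>\<^sub>F u in nhds 0. isCont f u"
      using eventually_real_analytic_at[OF f(1)] by eventually_elim (rule real_analytic_at_isCont)
    moreover have "\<forall>\<^sub>F u in nhds 0. f u \<noteq> 0"
      using continuous_at_avoid[OF real_analytic_at_isCont[OF f(1)] f(2)] by (auto simp: eventually_nhds_metric dist_commute)
    ultimately show ?thesis by eventually_elim simp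
  qed
  have pull: "\<forall>\<^sub>F u in nhds 0. \<forall>\<^sub>F v in nhds (\<psi> u). Q v" if "\<forall>\<^sub>F v in nhds (\<psi> 0). Q v" for Q
    using filterlim_iff[THEN iffD1, OF lim, rule_format, of "\<lambda>v. \<forall>\<^sub>F v in nhds v. Q v"] that
    by (simp add: eventually_eventually)
  \<comment> \<open>At u, the orders of K and of the Jacobian come out equal in the old and the new
    coordinates. This holds on a whole neighbourhood of 0, in which test points can then be
    chosen.\<close>
  define E where "E u \<longleftrightarrow> u \<in> V \<and> (\<Sum>l | u $ l = 0. k' l) = (\<Sum>l | \<psi> u $ l = 0. k l) \<and>
      (\<Sum>l | u $ l = 0. h' l) = (\<Sum>l | \<psi> u $ l = 0. h l)" for u
  have inV: "\<forall>\<^sub>F u in nhds 0. u \<in> V" using d(1) 0 by (rule eventually_nhds_in_open)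
  have E: "\<forall>\<^sub>F u in nhds 0. E u"
    using pull[OF H] pull[OF A] pull[OF J] pull[OF B] unit[OF ab(1,3)] unit[OF ab(2,4)] inV
  proof eventually_elim
    case (elim u)
    have V: "\<forall>\<^sub>F w in nhds u. w \<in> V" using d(1) elim by (intro eventually_nhds_in_open) auto
    have "ord_at H (\<psi> u) (\<Sum>l | \<psi> u $ l = 0. k l)"
    proof (rule ord_at_monomial[where A = A])
      show "isCont A (\<psi> u)" "A (\<psi> u) \<noteq> 0" using eventually_nhds_x_imp_x[OF elim(2)] by auto
      show "\<forall>\<^sub>F w in nhds (\<psi> u). \<bar>H w\<bar> = \<bar>A w * (\<Prod>l\<in>UNIV. w $ l ^ k l)\<bar>"
        using elim(1) by eventually_elim simp
    qed
    moreover have "ord_at (\<lambda>w. H (\<psi> w)) u (\<Sum>l | u $ l = 0. k' l)"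
    proof (rule ord_at_monomial[where A = a])
      show "isCont a u" "a u \<noteq> 0" using elim by auto
      show "\<forall>\<^sub>F w in nhds u. \<bar>H (\<psi> w)\<bar> = \<bar>a w * (\<Prod>l\<in>UNIV. w $ l ^ k' l)\<bar>"
        using V by eventually_elim (simp add: H')
    qed
    ultimately have 1: "(\<Sum>l | \<psi> u $ l = 0. k l) = (\<Sum>l | u $ l = 0. k' l)"
      using ord_at_diffeo[OF \<psi>] elim by blast
    have "ord_at J (\<psi> u) (\<Sum>l | \<psi> u $ l = 0. h l)"
    proof (rule ord_at_monomial[where A = B])
      show "isCont B (\<psi> u)" "B (\<psi> u) \<noteq> 0" using eventually_nhds_x_imp_x[OF elim(4)] by auto
      show "\<forall>\<^sub>F w in nhds (\<psi> u). \<bar>J w\<bar> = \<bar>B w * (\<Prod>l\<in>UNIV. w $ l ^ h l)\<bar>"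
        using elim(3) by eventually_elim simp
    qed
    moreover have "ord_at (\<lambda>w. J (\<psi> w)) u (\<Sum>l | u $ l = 0. h' l)"
    proof -
      have nz: "det (Dmat \<psi> u) \<noteq> 0" and ct: "isCont (\<lambda>x. det (Dmat \<psi> x)) u"
        using det_Dmat_diffeo[OF \<psi>] isCont_det_Dmat d(4) elim by blast+
      have "ord_at (\<lambda>w. J (\<psi> w) * det (Dmat \<psi> w)) u (\<Sum>l | u $ l = 0. h' l)"
      proof (rule ord_at_monomial[where A = b])
        show "isCont b u" "b u \<noteq> 0" using elim by auto
        show "\<forall>\<^sub>F w in nhds u. \<bar>J (\<psi> w) * det (Dmat \<psi> w)\<bar> = \<bar>b w * (\<Prod>l\<in>UNIV. w $ l ^ h' l)\<bar>"
          using V by eventually_elim (simp add: J')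
      qed
      then have "ord_at (\<lambda>w. J (\<psi> w) * det (Dmat \<psi> w) * inverse (det (Dmat \<psi> w))) u (\<Sum>l | u $ l = 0. h' l)"
        by (rule ord_at_mult_unit) (use nz ct in \<open>auto intro!: continuous_intros\<close>)
      moreover have "\<forall>\<^sub>F w in nhds u. \<bar>J (\<psi> w) * det (Dmat \<psi> w) * inverse (det (Dmat \<psi> w))\<bar> = \<bar>J (\<psi> w)\<bar>"
        using V by eventually_elim (simp add: det_Dmat_diffeo[OF \<psi>] mult.assoc)
      ultimately show ?thesis by (rule ord_at_cong)
    qed
    ultimately have 2: "(\<Sum>l | \<psi> u $ l = 0. h l) = (\<Sum>l | u $ l = 0. h' l)"
      using ord_at_diffeo[OF \<psi>] elim by blast
    show ?case using 1 2 elim unfolding E_def by simp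
  qed
  have sumk: "(\<Sum>l | v $ l = 0. k l) = (\<Sum>l\<in>{e. v $ e = 0 \<and> k e > 0}. k l)"
    and sumh: "(\<Sum>l | v $ l = 0. h l) = (\<Sum>l\<in>{e. v $ e = 0 \<and> k e > 0}. h l)" for v :: "real^'d"
    using h by (auto intro!: sum.mono_neutral_right)
  have "E 0" using E by (rule eventually_nhds_x_imp_x)
  moreover have "(\<Sum>l | \<psi> 0 $ l = 0. k l) = (\<Sum>l\<in>UNIV. k l)"
    using k by (intro sum.mono_neutral_left) auto
  ultimately show tot: "(\<Sum>l\<in>UNIV. k' l) = (\<Sum>l\<in>UNIV. k l)" by (simp add: E_def)
  show "\<exists>e. k e > 0 \<and> k' l = k e \<and> h' l = h e" if l: "k' l > 0"
  proof -
    \<comment> \<open>A generic point of the hypersurface u_l = 0: there the new orders are just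
      \<open>k' l\<close> and \<open>h' l\<close>.\<close>
    have "((\<lambda>t. \<chi> m. if m = l then 0 else t) \<longlongrightarrow> (0 :: real^'d)) (at_right 0)"
    proof (rule vec_tendstoI)
      show "((\<lambda>t. (\<chi> m. if m = l then 0 else t) $ m) \<longlongrightarrow> (0 :: real^'d) $ m) (at_right 0)" for m
        by (cases "m = l") (auto intro!: tendsto_eq_intros)
    qed
    from filterlim_iff[THEN iffD1, OF this, rule_format, OF E]
    have "\<forall>\<^sub>F t in at_right 0. E (\<chi> m. if m = l then 0 else t)" .
    moreover have "\<forall>\<^sub>F t :: real in at_right 0. t > 0" by (simp add: eventually_at_right_less)
    ultimately have "\<forall>\<^sub>F t in at_right 0. E (\<chi> m. if m = l then 0 else t) \<and> (t :: real) > 0"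
      by eventually_elim simp
    then obtain t where t: "E (\<chi> m. if m = l then 0 else t)" "(t :: real) > 0"
      using eventually_happens'[OF trivial_limit_at_right_real] by blast
    define u :: "real^'d" where "u = (\<chi> m. if m = l then 0 else t)"
    have "{m. u $ m = 0} = {l}" using t(2) by (auto simp: u_def)
    then have k'l: "k' l = (\<Sum>l\<in>{e. \<psi> u $ e = 0 \<and> k e > 0}. k l)"
      and h'l: "h' l = (\<Sum>l\<in>{e. \<psi> u $ e = 0 \<and> k e > 0}. h l)"
      using t(1) unfolding u_def[symmetric] E_def sumk sumh by auto
    \<comment> \<open>The old hypersurfaces through the image of the test point; there are one or
      two of them.\<close>
    let ?Y = "{e. \<psi> u $ e = 0 \<and> k e > 0}"
    have "?Y \<noteq> {}" using k'l l by (metis less_numeral_extra(3) sum.empty)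
    moreover have "?Y \<subseteq> {i, j}" using k by auto
    moreover have "(\<exists>e. Y = {e}) \<or> (Y = {i, j} \<and> i \<noteq> j)" if "Y \<noteq> {}" "Y \<subseteq> {i, j}" for Y
    proof (cases "i \<in> Y \<and> j \<in> Y \<and> i \<noteq> j")
      case False
      then have "Y = {i} \<or> Y = {j}" using that by blast
      then show ?thesis by blast
    qed (use that in blast)
    ultimately have "(\<exists>e. ?Y = {e}) \<or> (?Y = {i, j} \<and> i \<noteq> j)" by presburger
    then show ?thesis
    proof
      assume "\<exists>e. ?Y = {e}"
      then obtain e where e: "?Y = {e}" by blast
      then have "k e > 0" by auto
      then show ?thesis using k'l h'l unfolding e by auto
    next
      \<comment> \<open>Two are impossible: the whole exponent k i + k j would then sit on u_l.
        Moving off the hypersurface v_j = 0 along its axis leaves the order k i, but in the new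
        coordinates the order could only be 0 or k i + k j.\<close>
      assume Y: "?Y = {i, j} \<and> i \<noteq> j"
      then have ij: "k i > 0" "k j > 0" by auto
      have k'l2: "k' l = k i + k j" using k'l Y by simp
      have "(\<Sum>l\<in>UNIV. k l) = (\<Sum>l\<in>{i, j}. k l)" using k by (intro sum.mono_neutral_right) auto
      then have "(\<Sum>m\<in>UNIV. k' m) = k' l" using tot k'l2 Y by simp
      then have "(\<Sum>m\<in>UNIV - {l}. k' m) = 0" by (simp add: sum.remove[of UNIV l])
      then have k'0: "k' m = 0" if "m \<noteq> l" for m using that by simp
      have "real_analytic_at (\<lambda>x. inv_into V \<psi> x $ i) (\<psi> 0)" for i using d(5)[OF 0] .
      then have "isCont (inv_into V \<psi>) (\<psi> 0)"
        using analytic_has_derivative has_derivative_continuous by blast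
      then have lim\<chi>: "(inv_into V \<psi> \<longlongrightarrow> 0) (nhds (\<psi> 0))"
        using d(3) 0 isCont_tendsto_nhds by force
      have ev: "\<forall>\<^sub>F v in nhds (\<psi> 0). E (inv_into V \<psi> v) \<and> v \<in> \<psi> ` V"
        using filterlim_iff[THEN iffD1, OF lim\<chi>, rule_format, OF E]
          eventually_nhds_in_open[OF d(2) imageI[OF 0]] by eventually_elim simp
      have "((\<lambda>t. \<psi> 0 + t *\<^sub>R axis j 1) \<longlongrightarrow> \<psi> 0) (at_right 0)"
        by (auto intro!: tendsto_eq_intros)
      from filterlim_iff[THEN iffD1, OF this, rule_format, OF ev]
      have "\<forall>\<^sub>F t in at_right 0. E (inv_into V \<psi> (\<psi> 0 + t *\<^sub>R axis j 1)) \<and> \<psi> 0 + t *\<^sub>R axis j 1 \<in> \<psi> ` V" .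
      moreover have "\<forall>\<^sub>F t :: real in at_right 0. t > 0" by (simp add: eventually_at_right_less)
      ultimately have "\<forall>\<^sub>F t :: real in at_right 0. (E (inv_into V \<psi> (\<psi> 0 + t *\<^sub>R axis j 1)) \<and> \<psi> 0 + t *\<^sub>R axis j 1 \<in> \<psi> ` V) \<and> t > 0"
        by eventually_elim simp
      then obtain s :: real where s: "E (inv_into V \<psi> (\<psi> 0 + s *\<^sub>R axis j 1))" "\<psi> 0 + s *\<^sub>R axis j 1 \<in> \<psi> ` V" "s > 0"
        using eventually_happens'[OF trivial_limit_at_right_real] by blast
      let ?v = "\<psi> 0 + s *\<^sub>R axis j 1" and ?u = "inv_into V \<psi> (\<psi> 0 + s *\<^sub>R axis j 1)"
      have "{e. ?v $ e = 0 \<and> k e > 0} = {i}"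
        using k[of i] k[of j] k Y ij s(3) by (auto simp: axis_def)
      then have "(\<Sum>m | ?u $ m = 0. k' m) = k i"
        using s(1) f_inv_into_f[OF s(2)] unfolding E_def sumk by simp
      moreover have "(\<Sum>m | ?u $ m = 0. k' m) = (if ?u $ l = 0 then k' l else 0)"
      proof -
        have "(\<Sum>m | ?u $ m = 0. k' m) = (\<Sum>m\<in>{l}. k' m)" if "?u $ l = 0"
          by (intro sum.mono_neutral_right) (use k'0 that in auto)
        moreover have "(\<Sum>m | ?u $ m = 0. k' m) = 0" if "?u $ l \<noteq> 0"
          by (intro sum.neutral ballI k'0) (use that in auto)
        ultimately show ?thesis by simp
      qed
      ultimately show ?thesis using ij k'l2 by (auto split: if_splits)
    qed
  qed
qed

section \<open>The charts of the iterated blow-up\<close>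

definition Wt :: "'d set \<Rightarrow> nat \<Rightarrow> 'd \<Rightarrow> nat" where "Wt R n k = (if k \<in> R then n else 1)"

definition wt :: "'d::finite set \<Rightarrow> nat \<Rightarrow> ('d \<Rightarrow> nat) \<Rightarrow> nat" where
  "wt R n \<alpha> = (\<Sum>k\<in>UNIV. Wt R n k * \<alpha> k)"

text \<open>The Jacobian exponent of a weighted blow-up: the total weight of the coordinates minus
  one.\<close>

definition hexp :: "'d::finite set \<Rightarrow> nat \<Rightarrow> nat" where
  "hexp R n = (\<Sum>k\<in>UNIV. Wt R n k) - 1"

text \<open>The monomial map in which each exceptional coordinate \<open>e \<in> E\<close> scales the coordinates
  in \<open>R\<close> with weight \<open>N e\<close> and all others with weight \<open>1\<close>.\<close>

definition mono_map :: "'d::finite set \<Rightarrow> 'd set \<Rightarrow> ('d \<Rightarrow> nat) \<Rightarrow> real^'d \<Rightarrow> real^'d" where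
  "mono_map R E N v = (\<chi> k. (\<Prod>e\<in>E. v $ e ^ Wt R (N e) k) * (if k \<in> E then 1 else v $ k))"

text \<open>Normal forms of the chart names. Either all m steps go in one direction i outside
  \<open>R\<close>, with weight m; or n < m such steps are followed by one in a direction j of
  \<open>R\<close>, after which no center meets the chart. Then the exceptional coordinates i and j
  have weights n and n + 1; for n = 0 only j is exceptional and i is a dummy.\<close>

definition chart_data :: "'d set \<Rightarrow> nat \<Rightarrow> 'd list \<Rightarrow> 'd set \<Rightarrow> ('d \<Rightarrow> nat) \<Rightarrow> bool" where
  "chart_data R m c E N \<longleftrightarrow>
     (\<exists>i. i \<notin> R \<and> c = replicate m i \<and> E = {i} \<and> N = (\<lambda>_. m)) \<or>
     (\<exists>i j n. j \<in> R \<and> n < m \<and> c = j # replicate n i \<and> N = (\<lambda>e. if e \<in> R then n + 1 else n) \<and>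
        (if n = 0 then E = {j} else i \<notin> R \<and> E = {i, j}))"

lemma wt_alt: "wt R n \<alpha> = n * (\<Sum>k\<in>R. \<alpha> k) + (\<Sum>k\<in>-R. \<alpha> k)"
proof -
  have "wt R n \<alpha> = (\<Sum>k\<in>R. Wt R n k * \<alpha> k) + (\<Sum>k\<in>-R. Wt R n k * \<alpha> k)"
    unfolding wt_def by (metis Compl_partition Compl_disjoint finite sum.union_disjoint)
  then show ?thesis by (simp add: Wt_def sum_distrib_left)
qed

lemma hexp_alt: "hexp R n = n * card R + card (- R) - 1"
proof -
  have "(\<Sum>k\<in>UNIV. Wt R n k) = (\<Sum>k\<in>R. Wt R n k) + (\<Sum>k\<in>-R. Wt R n k)"
    by (metis Compl_partition Compl_disjoint finite sum.union_disjoint)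
  then show ?thesis by (simp add: hexp_def Wt_def mult.commute)
qed

lemma hexp_Suc: "n \<ge> 1 \<Longrightarrow> hexp R (Suc n) = hexp R n + card R"
proof -
  assume "n \<ge> 1"
  have "card R + card (- R) \<ge> 1"
  proof -
    have "card (R \<union> - R) = card R + card (- R)" by (rule card_Un_disjoint) auto
    then have "card R + card (- R) = CARD('a)" by simp
    then show ?thesis by (metis One_nat_def Suc_leI finite_UNIV_card_ge_0 finite)
  qed
  moreover have "n * card R \<ge> card R" using \<open>n \<ge> 1\<close> by simp
  ultimately show ?thesis unfolding hexp_alt mult_Suc by linarith

qed

lemma hexp_1: "hexp (R :: 'd::finite set) (Suc 0) = CARD('d) - 1"
proof -
  have "Wt R (Suc 0) k = 1" for k by (simp add: Wt_def)
  then show ?thesis by (simp add: hexp_def)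
qed

text \<open>A list grows only while its head lies outside \<open>R\<close>, and after the first step
  only by that head or by an index of \<open>R\<close>. So it is constant outside \<open>R\<close>,
  except for at most one final choice in \<open>R\<close> at its head.\<close>

lemma blowup_charts_iff:
  assumes "m \<ge> 1"
  shows "c \<in> blowup_charts R m \<longleftrightarrow> (\<exists>E N. chart_data R m c E N)"
proof -
  have ex: "(\<exists>E N. chart_data R m c E N) \<longleftrightarrow>
    (\<exists>i. i \<notin> R \<and> c = replicate m i) \<or>
    (\<exists>i j n. j \<in> R \<and> n < m \<and> c = j # replicate n i \<and> (n = 0 \<or> i \<notin> R))"
    (is "?L \<longleftrightarrow> ?R") for m c
  proof
    assume ?R
    then consider i where "i \<notin> R" "c = replicate m i"
      | i j n where "j \<in> R" "n < m" "c = j # replicate n i" "n = 0 \<or> i \<notin> R" by metis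
    then show ?L
    proof cases
      case 1
      then have "chart_data R m c {i} (\<lambda>_. m)" unfolding chart_data_def by auto
      then show ?thesis by (intro exI)
    next
      case 2
      then have "chart_data R m c (if n = 0 then {j} else {i, j}) (\<lambda>e. if e \<in> R then n + 1 else n)"
        unfolding chart_data_def by (intro disjI2 exI[of _ i] exI[of _ j] exI[of _ n]) auto
      then show ?thesis by (intro exI)
    qed
  next
    assume ?L
    then obtain E N where "chart_data R m c E N" by blast
    then show ?R unfolding chart_data_def by metis
  qed
  show ?thesis unfolding ex using assms
  proof (induction m arbitrary: c rule: dec_induct)
    case base
    have "(\<exists>i j n. j \<in> R \<and> n < Suc 0 \<and> c = j # replicate n i \<and> (n = 0 \<or> i \<notin> R)) \<longleftrightarrow> (\<exists>j\<in>R. c = [j])"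
      by auto
    then show ?case by auto
  next
    case (step m)
    note IH = step.IH
    show ?case
    proof
      assume "c \<in> blowup_charts R (Suc m)"
      then obtain c' where c': "c' \<in> blowup_charts R m"
        "c \<in> (if center_coords R c' = {} then {c'} else {j # c' | j. j \<in> center_coords R c'})"
        unfolding blowup_charts.simps by (elim UN_E)
      from c'(1) consider i where "i \<notin> R" "c' = replicate m i"
        | i j n where "j \<in> R" "n < m" "c' = j # replicate n i" "n = 0 \<or> i \<notin> R"
        using IH by metis
      then show "(\<exists>i. i \<notin> R \<and> c = replicate (Suc m) i) \<or>
          (\<exists>i j n. j \<in> R \<and> n < Suc m \<and> c = j # replicate n i \<and> (n = 0 \<or> i \<notin> R))"
      proof cases
        case 1
        then have "center_coords R c' = insert i R" using step.hyps by (cases m) auto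
        then obtain j where "j \<in> insert i R" "c = j # replicate m i" using c'(2) 1 by auto
        then show ?thesis using 1 by auto
      next
        case 2
        then have "c = c'" using c'(2) by auto
        then show ?thesis using 2 by (metis less_SucI)
      qed
    next
      assume "(\<exists>i. i \<notin> R \<and> c = replicate (Suc m) i) \<or>
          (\<exists>i j n. j \<in> R \<and> n < Suc m \<and> c = j # replicate n i \<and> (n = 0 \<or> i \<notin> R))"
      then consider i where "i \<notin> R" "c = replicate (Suc m) i"
        | i j n where "j \<in> R" "n < Suc m" "c = j # replicate n i" "n = 0 \<or> i \<notin> R" by metis
      then show "c \<in> blowup_charts R (Suc m)"
      proof cases
        case 1
        show ?thesis unfolding 1(2) by (rule replicate_in_blowup_charts[OF 1(1)])
      next
        case 2
        show ?thesis
        proof (cases "n = m")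
          case True
          then have i: "i \<notin> R" using 2 step.hyps by auto
          have "center_coords R (replicate m i) = insert i R" using i step.hyps by (cases m) auto
          moreover have "replicate m i \<in> blowup_charts R m" using i by (rule replicate_in_blowup_charts)
          ultimately show ?thesis using 2 True by (auto intro!: bexI[of _ "replicate m i"])
        next
          case False
          then have "c \<in> blowup_charts R m" using 2 IH by (metis less_antisym)
          moreover have "center_coords R c = {}" using 2 by simp
          ultimately show ?thesis by auto
        qed
      qed
    qed
  qed
qed

lemma chart_dataE:
  assumes "chart_data R m c E N"
  obtains i where "i \<notin> R" "c = replicate m i" "E = {i}" "N = (\<lambda>_. m)"
    | i j n where "j \<in> R" "n < m" "c = j # replicate n i" "N = (\<lambda>e. if e \<in> R then n + 1 else n)"
      "if n = 0 then E = {j} else i \<notin> R \<and> E = {i, j}"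
  using assms unfolding chart_data_def
proof (elim disjE exE conjE)
  fix i assume "i \<notin> R" "c = replicate m i" "E = {i}" "N = (\<lambda>_. m)"
  then show thesis by (rule that(1))
next
  fix i j n assume "j \<in> R" "n < m" "c = j # replicate n i" "N = (\<lambda>e. if e \<in> R then n + 1 else n)"
      "if n = 0 then E = {j} else i \<notin> R \<and> E = {i, j}"
  then show thesis by (rule that(2))
qed

lemma chart_map_eq_mono_map:
  assumes "chart_data R m c E N" "m \<ge> 1"
  shows "chart_map R c v = mono_map R E N v"
proof -
  from assms(1) show ?thesis
  proof (cases rule: chart_dataE)
    case (1 i)
    then show ?thesis using assms(2)
      by (auto simp: chart_map_replicate mono_map_def vec_eq_iff Wt_def)
  next
    case (2 i j n)
    show ?thesis
    proof (cases "n = 0")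
      case True
      then show ?thesis using 2
        by (auto simp: mono_map_def vec_eq_iff Wt_def blowup_chart_def)
    next
      case False
      then have ij: "i \<noteq> j" "i \<notin> R" "E = {i, j}" and cc: "center_coords R (replicate n i) = insert i R"
        using 2 by (auto intro: gr0_conv_Suc[THEN iffD1, elim_format])
      \<comment> \<open>The last blow-up replaces u_i by u_j u_i. On \<open>R\<close> this gives u_j
        the weight n, and the scaling by the new center adds one; outside \<open>R\<close> it gives
        u_j the weight 1.\<close>
      show ?thesis
        using 2 ij False unfolding 2(3) chart_map.simps cc
        by (auto simp: mono_map_def vec_eq_iff Wt_def blowup_chart_def chart_map_replicate power_mult_distrib mult_ac)
    qed
  qed
qed

section \<open>Jacobian determinants of the charts\<close>

lemma det_single_column:
  fixes A :: "real^'d::finite^'d"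
  assumes "\<And>k l. l \<noteq> k \<Longrightarrow> l \<noteq> j \<Longrightarrow> A $ k $ l = 0" and "\<And>l. l \<noteq> j \<Longrightarrow> A $ j $ l = 0"
  shows "det A = (\<Prod>k\<in>UNIV. A $ k $ k)"
proof -
  \<comment> \<open>A permutation moving j meets a zero in row j; one fixing j but not all indices
    meets an off-diagonal zero outside column j.\<close>
  have z: "(\<Prod>k\<in>UNIV. A $ k $ p k) = 0" if p: "p permutes UNIV" "p \<noteq> id" for p
  proof (cases "p j = j")
    case False
    then have "A $ j $ p j = 0" using assms(2) by blast
    then show ?thesis by (auto intro!: exI[of _ j])
  next
    case True
    obtain k where k: "p k \<noteq> k" using p(2) by (auto simp: fun_eq_iff)
    then have "p k \<noteq> j" using True p(1) by (metis permutes_inj injD)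
    then have "A $ k $ p k = 0" using assms(1) k by blast
    then show ?thesis by (auto intro!: exI[of _ k])
  qed
  have "det A = (\<Sum>p\<in>{id}. of_int (sign p) * (\<Prod>k\<in>UNIV. A $ k $ p k))"
    unfolding det_def using z
    by (intro sum.mono_neutral_right) (auto simp: permutes_id finite_permutations)
  then show ?thesis by simp
qed

definition blowup_matrix :: "'d::finite set \<Rightarrow> 'd \<Rightarrow> real^'d \<Rightarrow> real^'d^'d" where
  "blowup_matrix J j u = (\<chi> k l. if k \<in> J \<and> k \<noteq> j
     then (if l = k then u $ j else if l = j then u $ k else 0) else (if l = k then 1 else 0))"

lemma blowup_chart_has_derivative:
  "(blowup_chart J j has_derivative (\<lambda>w. blowup_matrix J j u *v w)) (at u)"
proof (subst has_derivative_componentwise_within, intro ballI)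
  fix b :: "real^'a" assume "b \<in> Basis"
  then obtain k where b: "b = axis k 1" by (auto simp: Basis_vec_def)
  have m: "(blowup_matrix J j u *v w) $ k = (if k \<in> J \<and> k \<noteq> j then u $ j * w $ k + u $ k * w $ j else w $ k)" for w
  proof -
    have "(blowup_matrix J j u *v w) $ k =
      (\<Sum>l\<in>UNIV. if l = k then (if k \<in> J \<and> k \<noteq> j then u $ j else 1) * w $ l else 0) +
      (\<Sum>l\<in>UNIV. if l = j then (if k \<in> J \<and> k \<noteq> j then u $ k else 0) * w $ l else 0)"
      unfolding sum.distrib[symmetric] matrix_vector_mult_def blowup_matrix_def
      by (auto intro!: sum.cong)
    then show ?thesis by (simp add: sum.delta)
  qed
  have nth: "((\<lambda>x. x $ l) has_derivative (\<lambda>w. w $ l)) (at u)" for l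
    by (rule bounded_linear_imp_has_derivative) (rule bounded_linear_vec_nth)
  show "((\<lambda>x. blowup_chart J j x \<bullet> b) has_derivative (\<lambda>w. (blowup_matrix J j u *v w) \<bullet> b)) (at u)"
    unfolding b inner_axis inner_real_def m
    using has_derivative_mult[OF nth[of j] nth[of k]] nth[of k]
    by (cases "k \<in> J \<and> k \<noteq> j") (auto simp: blowup_chart_def mult.commute)
qed

lemma det_blowup_matrix:
  assumes "j \<in> J"
  shows "det (blowup_matrix J j u) = u $ j ^ (card J - 1)"
proof -
  have "det (blowup_matrix J j u) = (\<Prod>k\<in>UNIV. blowup_matrix J j u $ k $ k)"
    by (rule det_single_column[where j = j]) (auto simp: blowup_matrix_def)
  also have "\<dots> = (\<Prod>k\<in>UNIV. if k \<in> J - {j} then u $ j else 1)"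
    by (intro prod.cong) (auto simp: blowup_matrix_def)
  also have "\<dots> = (\<Prod>k\<in>UNIV \<inter> (J - {j}). u $ j)"
    by (rule prod.inter_restrict[symmetric]) simp
  also have "\<dots> = u $ j ^ (card J - 1)" using assms by simp
  finally show ?thesis .
qed

lemma chart_map_Cons_has_derivative:
  assumes "(chart_map R c has_derivative (\<lambda>w. A *v w)) (at (blowup_chart (center_coords R c) j u))"
  shows "(chart_map R (j # c) has_derivative (\<lambda>w. (A ** blowup_matrix (center_coords R c) j u) *v w)) (at u)"
  using has_derivative_compose[OF blowup_chart_has_derivative assms]
  by (simp add: o_def matrix_vector_mul_assoc)

text \<open>The first blow-up contributes the exponent d - 1, each further one |R|, which is the
  recursion of \<open>hexp\<close>.\<close>

lemma chart_map_replicate_has_derivative: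
  assumes "i \<notin> R" "n \<ge> 1"
  shows "\<exists>A. (chart_map R (replicate n i) has_derivative (\<lambda>w. A *v w)) (at v) \<and> det A = v $ i ^ hexp R n"
  using assms(2)
proof (induction n arbitrary: v rule: dec_induct)
  case base
  have "(chart_map R [] has_derivative (\<lambda>w. mat 1 *v w)) (at (blowup_chart (center_coords R []) i v))"
    by (simp add: id_def)
  from chart_map_Cons_has_derivative[OF this]
  have "(chart_map R (replicate 1 i) has_derivative (\<lambda>w. (mat 1 ** blowup_matrix UNIV i v) *v w)) (at v)"
    by simp
  moreover have "det (mat 1 ** blowup_matrix UNIV i v) = v $ i ^ hexp R 1"
    by (simp add: det_blowup_matrix hexp_1)
  ultimately show ?case by blast
next
  case (step n)
  have cc: "center_coords R (replicate n i) = insert i R" using step.hyps assms(1) by (cases n) auto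
  obtain A where A: "(chart_map R (replicate n i) has_derivative (\<lambda>w. A *v w)) (at (blowup_chart (insert i R) i v))"
    "det A = blowup_chart (insert i R) i v $ i ^ hexp R n" using step.IH by blast
  have "(chart_map R (replicate (Suc n) i) has_derivative (\<lambda>w. (A ** blowup_matrix (insert i R) i v) *v w)) (at v)"
    using chart_map_Cons_has_derivative[of R "replicate n i" A i v] A(1) unfolding cc by simp
  moreover have "det (A ** blowup_matrix (insert i R) i v) = v $ i ^ hexp R (Suc n)"
    using assms(1) step.hyps
    by (simp add: det_mul A(2) det_blowup_matrix hexp_Suc power_add) (simp add: blowup_chart_def)
  ultimately show ?case by blast
qed

lemma chart_map_has_derivative:
  assumes "chart_data R m c E N" "m \<ge> 1"
  shows "\<exists>A. (chart_map R c has_derivative (\<lambda>w. A *v w)) (at v) \<and> det A = (\<Prod>e\<in>E. v $ e ^ hexp R (N e))"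
proof -
  from assms(1) show ?thesis
  proof (cases rule: chart_dataE)
    case (1 i)
    then show ?thesis using chart_map_replicate_has_derivative[of i R m v] assms(2) by simp
  next
    case (2 i j n)
    show ?thesis
    proof (cases "n = 0")
      case True
      have "(chart_map R [] has_derivative (\<lambda>w. mat 1 *v w)) (at (blowup_chart (center_coords R []) j v))"
        by (simp add: id_def)
      from chart_map_Cons_has_derivative[OF this]
      have "(chart_map R c has_derivative (\<lambda>w. (mat 1 ** blowup_matrix UNIV j v) *v w)) (at v)"
        using 2 True by simp
      moreover have "det (mat 1 ** blowup_matrix UNIV j v) = (\<Prod>e\<in>E. v $ e ^ hexp R (N e))"
        using 2 True by (simp add: det_blowup_matrix hexp_1)
      ultimately show ?thesis by blast
    next
      case False
      then have ij: "i \<noteq> j" "i \<notin> R" "E = {i, j}" and cc: "center_coords R (replicate n i) = insert i R"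
        using 2 by (auto intro: gr0_conv_Suc[THEN iffD1, elim_format])
      obtain A where A: "(chart_map R (replicate n i) has_derivative (\<lambda>w. A *v w)) (at (blowup_chart (insert i R) j v))"
        "det A = blowup_chart (insert i R) j v $ i ^ hexp R n"
        using chart_map_replicate_has_derivative[of i R n] False ij by auto
      have "(chart_map R c has_derivative (\<lambda>w. (A ** blowup_matrix (insert i R) j v) *v w)) (at v)"
        using chart_map_Cons_has_derivative[of R "replicate n i" A j v] A(1) unfolding cc 2(3) by simp
      \<comment> \<open>The factor (u_i u_j)^\<open>hexp R n\<close> and the new factor u_j^|R|
        combine to the exponent \<open>hexp R (n + 1)\<close> at j.\<close>
      moreover have "det (A ** blowup_matrix (insert i R) j v) = (\<Prod>e\<in>E. v $ e ^ hexp R (N e))"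
        using 2 ij False
        by (simp add: det_mul A(2) det_blowup_matrix hexp_Suc power_add)
          (simp add: blowup_chart_def power_mult_distrib mult_ac)
      ultimately show ?thesis by blast
    qed
  qed
qed

section \<open>The function in a chart\<close>

text \<open>Weights turn into exponents of the exceptional coordinates, so a lower bound on weights
  becomes divisibility of the pulled-back series.\<close>

definition bexp :: "'d::finite set \<Rightarrow> 'd set \<Rightarrow> ('d \<Rightarrow> nat) \<Rightarrow> ('d \<Rightarrow> nat) \<Rightarrow> 'd \<Rightarrow> nat" where
  "bexp R E N \<alpha> l = (if l \<in> E then wt R (N l) \<alpha> else \<alpha> l)"

lemma mpow_mono_map: "mpow (mono_map R E N v) \<alpha> = mpow v (bexp R E N \<alpha>)"
proof -
  have "mpow (mono_map R E N v) \<alpha> =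
      (\<Prod>k\<in>UNIV. (\<Prod>e\<in>E. v $ e ^ (Wt R (N e) k * \<alpha> k)) * (if k \<in> E then 1 else v $ k ^ \<alpha> k))"
    unfolding mpow_def mono_map_def
    by (intro prod.cong) (auto simp: power_mult_distrib prod_power_distrib power_mult)
  also have "\<dots> = (\<Prod>e\<in>E. \<Prod>k\<in>UNIV. v $ e ^ (Wt R (N e) k * \<alpha> k)) * (\<Prod>k\<in>UNIV. if k \<in> E then 1 else v $ k ^ \<alpha> k)"
    by (simp add: prod.distrib prod.swap[of _ UNIV])
  also have "(\<Prod>e\<in>E. \<Prod>k\<in>UNIV. v $ e ^ (Wt R (N e) k * \<alpha> k)) = (\<Prod>e\<in>UNIV. if e \<in> E then v $ e ^ wt R (N e) \<alpha> else 1)"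
    by (simp add: wt_def power_sum prod.If_cases)
  also have "\<dots> * (\<Prod>k\<in>UNIV. if k \<in> E then 1 else v $ k ^ \<alpha> k) = mpow v (bexp R E N \<alpha>)"
    unfolding prod.distrib[symmetric] mpow_def bexp_def by (intro prod.cong) auto
  finally show ?thesis .
qed

lemma finite_wt_eq: "n \<ge> 1 \<Longrightarrow> finite {\<alpha> :: 'd::finite \<Rightarrow> nat. wt R n \<alpha> = w}"
proof (rule finite_subset[OF _ finite_idx_le[of "\<lambda>_. w"]], safe)
  fix \<alpha> :: "'d \<Rightarrow> nat" and i assume n: "n \<ge> 1" and w: "w = wt R n \<alpha>"
  have "\<alpha> i \<le> Wt R n i * \<alpha> i" using n by (simp add: Wt_def)
  also have "\<dots> \<le> wt R n \<alpha>" unfolding wt_def by (rule member_le_sum) auto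
  finally show "\<alpha> i \<le> wt R n \<alpha>" .
qed

definition lead_form :: "'d::finite set \<Rightarrow> (('d \<Rightarrow> nat) \<Rightarrow> real) \<Rightarrow> nat \<Rightarrow> real^'d \<Rightarrow> real" where
  "lead_form R \<kappa> n \<theta> = (\<Sum>\<alpha> | wt R n \<alpha> = 2 * n. \<kappa> \<alpha> * mpow \<theta> \<alpha>)"

lemma isCont_mono_map: "isCont (\<lambda>v. mono_map R E N v $ k) v0"
  unfolding mono_map_def vec_lambda_beta
  by (cases "k \<in> E") (auto intro!: continuous_intros)

lemma abs_mono_map_le:
  assumes "\<And>l. \<bar>v $ l\<bar> \<le> s $ l"
  shows "\<bar>mono_map R E N v $ k\<bar> \<le> mono_map R E N s $ k"
proof -
  have s0: "s $ l \<ge> 0" for l using assms[of l] by linarith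
  have "\<bar>mono_map R E N v $ k\<bar> = (\<Prod>e\<in>E. \<bar>v $ e\<bar> ^ Wt R (N e) k) * (if k \<in> E then 1 else \<bar>v $ k\<bar>)"
    by (simp add: mono_map_def abs_mult abs_prod power_abs)
  also have "\<dots> \<le> (\<Prod>e\<in>E. s $ e ^ Wt R (N e) k) * (if k \<in> E then 1 else s $ k)"
    using assms s0 by (intro mult_mono prod_mono conjI power_mono) (auto intro!: prod_nonneg)
  finally show ?thesis by (simp add: mono_map_def)
qed

lemma mono_map_zero:
  assumes "z \<in> E" "N z \<ge> 1" "v $ z = 0"
  shows "mono_map R E N v = 0"
proof -
  have "(\<Prod>e\<in>E. v $ e ^ Wt R (N e) k) = 0" for k
    using assms by (intro prod_zero) (auto simp: Wt_def intro!: bexI[of _ z])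
  then show ?thesis by (simp add: mono_map_def vec_eq_iff)
qed

text \<open>Every monomial of the pull-back is divisible by the product of the
  \<open>2 * N e\<close>-th powers over \<open>Z\<close>; dividing term by term leaves an analytic
  cofactor. Exceptional coordinates not vanishing at v0 stay in the cofactor. Its value at v0 keeps
  only the exponents of minimal weight for all of \<open>Z\<close> at once.\<close>

lemma mono_map_local_form:
  fixes K :: "real^'d::finite \<Rightarrow> real" and v0 :: "real^'d"
  assumes \<kappa>: "pseries \<kappa> (\<lambda>_. \<epsilon>) K" "\<epsilon> > 0"
    and N: "\<And>e. e \<in> E \<Longrightarrow> N e \<ge> 1"
    and low: "\<And>e \<alpha>. e \<in> E \<Longrightarrow> wt R (N e) \<alpha> < 2 * N e \<Longrightarrow> \<kappa> \<alpha> = 0"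
    and Z: "Z = {e \<in> E. v0 $ e = 0}" "Z \<noteq> {}"
  obtains a where "real_analytic_at a v0"
    and "\<forall>\<^sub>F v in nhds v0. K (mono_map R E N v) = a v * (\<Prod>l\<in>UNIV. v $ l ^ (if l \<in> Z then 2 * N l else 0))"
    and "a v0 = (\<Sum>\<alpha> | \<forall>e\<in>Z. wt R (N e) \<alpha> = 2 * N e.
           \<kappa> \<alpha> * mpow (mono_map R E N (\<chi> l. if l \<in> Z then 1 else v0 $ l)) \<alpha>)"
proof -
  let ?G = "mono_map R E N"
  obtain z where z: "z \<in> Z" using Z by blast
  \<comment> \<open>The polydisc contains v0 in its interior, and is so thin in the one vanishing
    coordinate z that its image lies in the cube where the series of K converges.\<close>
  define s :: "real \<Rightarrow> real^'d" where "s \<delta> = (\<chi> l. if l = z then \<delta> else \<bar>v0 $ l\<bar> + 1)" for \<delta>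
  have "\<forall>\<^sub>F \<delta> in at_right 0. \<forall>k. ?G (s \<delta>) $ k < \<epsilon>"
  proof (rule eventually_all_finite)
    fix k
    have "(s \<longlongrightarrow> s 0) (at_right 0)"
    proof (rule vec_tendstoI)
      show "((\<lambda>\<delta>. s \<delta> $ l) \<longlongrightarrow> s 0 $ l) (at_right 0)" for l
        by (cases "l = z") (auto simp: s_def)
    qed
    with isCont_mono_map have "((\<lambda>\<delta>. ?G (s \<delta>) $ k) \<longlongrightarrow> ?G (s 0) $ k) (at_right 0)"
      by (rule isCont_tendsto_compose)
    moreover have "?G (s 0) = 0" using z Z N by (intro mono_map_zero[of z]) (auto simp: s_def)
    ultimately show "\<forall>\<^sub>F \<delta> in at_right 0. ?G (s \<delta>) $ k < \<epsilon>"
      using order_tendstoD(2) \<kappa>(2) by (metis zero_index)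
  qed
  moreover have "\<forall>\<^sub>F \<delta> :: real in at_right 0. \<delta> > 0" by (simp add: eventually_at_right_less)
  ultimately have "\<forall>\<^sub>F \<delta> in at_right 0. (\<forall>k. ?G (s \<delta>) $ k < \<epsilon>) \<and> \<delta> > 0" by eventually_elim simp
  then obtain \<delta> where \<delta>: "\<And>k. ?G (s \<delta>) $ k < \<epsilon>" "\<delta> > 0"
    using eventually_happens'[OF trivial_limit_at_right_real] by blast
  define \<rho> where "\<rho> l = s \<delta> $ l" for l
  have \<rho>: "\<rho> l > 0" "\<bar>v0 $ l\<bar> < \<rho> l" for l
    using \<delta>(2) z Z by (auto simp: \<rho>_def s_def)
  have Geps: "\<bar>?G v $ k\<bar> < \<epsilon>" if "\<And>l. \<bar>v $ l\<bar> < \<rho> l" for v k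
    using abs_mono_map_le[of v "s \<delta>" R E N k] \<delta>(1)[of k] that by (fastforce simp: \<rho>_def less_imp_le)
  \<comment> \<open>Discarding zero coefficients makes the truncated subtraction in \<open>b\<close>
    exact: the remaining indices have weight at least \<open>2 * N l\<close>.\<close>
  define I where "I = {\<alpha>. \<kappa> \<alpha> \<noteq> 0}"
  define b where "b \<alpha> l = (if l \<in> Z then wt R (N l) \<alpha> - 2 * N l else bexp R E N \<alpha> l)" for \<alpha> l
  define x where "x l = (if l \<in> Z then 2 * N l else 0)" for l
  have bx: "bexp R E N \<alpha> = (\<lambda>l. b \<alpha> l + x l)" if "\<alpha> \<in> I" for \<alpha>
  proof
    fix l
    have "2 * N l \<le> wt R (N l) \<alpha>" if "l \<in> Z"
      using low[of l \<alpha>] that \<open>\<alpha> \<in> I\<close> Z by (auto simp: I_def intro: leI)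
    then show "bexp R E N \<alpha> l = b \<alpha> l + x l"
      using Z by (auto simp: b_def x_def bexp_def)
  qed
  have mb: "mpow (?G v) \<alpha> = mpow v (b \<alpha>) * mpow v x" if "\<alpha> \<in> I" for \<alpha> v
    by (simp add: mpow_mono_map bx[OF that] mpow_add)
  define a where "a v = infsum (\<lambda>\<alpha>. \<kappa> \<alpha> * mpow v (b \<alpha>)) I" for v
  have KI: "((\<lambda>\<alpha>. \<kappa> \<alpha> * mpow (?G v) \<alpha>) has_sum K (?G v)) I" if v: "\<And>l. \<bar>v $ l\<bar> < \<rho> l" for v
  proof -
    have "((\<lambda>\<alpha>. \<kappa> \<alpha> * mpow (?G v) \<alpha>) has_sum K (?G v)) UNIV"
      using \<kappa>(1) by (rule pseriesD) (rule Geps[OF v])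
    then show ?thesis by (rule has_sum_cong_neutral[THEN iffD1, rotated 3]) (auto simp: I_def)
  qed
  have aI: "((\<lambda>\<alpha>. \<kappa> \<alpha> * mpow v (b \<alpha>)) has_sum a v) I" if v: "\<And>l. \<bar>v $ l\<bar> < \<rho> l" for v
  proof -
    \<comment> \<open>Division by the monomial \<open>mpow v x\<close> fails where v has zero
      coordinates. It is done at a positive point t that dominates v, and the quotient series at v
      follows by comparison.\<close>
    define t :: "real^'d" where "t = (\<chi> l. (\<bar>v $ l\<bar> + \<rho> l) / 2)"
    have t: "t $ l > 0" "\<bar>v $ l\<bar> \<le> t $ l" "\<bar>t $ l\<bar> < \<rho> l" for l
      using v[of l] \<rho>(1)[of l] by (auto simp: t_def)
    have tx: "mpow t x > 0" using t(1) by (rule mpow_pos)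
    have "(\<lambda>\<alpha>. \<bar>\<kappa> \<alpha> * mpow (?G t) \<alpha>\<bar> * inverse (mpow t x)) summable_on I"
      by (intro summable_on_cmult_left summable_abs_real[THEN iffD1] has_sum_imp_summable[OF KI[OF t(3)]])
    then have "(\<lambda>\<alpha>. \<bar>\<kappa> \<alpha>\<bar> * mpow t (b \<alpha>)) summable_on I"
      using tx mpow_nonneg[of t] t(1)
      by (subst summable_on_cong[where g = "\<lambda>\<alpha>. \<bar>\<kappa> \<alpha> * mpow (?G t) \<alpha>\<bar> * inverse (mpow t x)"])
        (auto simp: mb abs_mult less_imp_le)
    moreover have "\<bar>\<kappa> \<alpha> * mpow v (b \<alpha>)\<bar> \<le> \<bar>\<kappa> \<alpha>\<bar> * mpow t (b \<alpha>)" for \<alpha>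
      unfolding abs_mult abs_mpow[of v] using t(2) by (intro mult_left_mono mpow_mono) auto
    ultimately have "(\<lambda>\<alpha>. \<bar>\<kappa> \<alpha> * mpow v (b \<alpha>)\<bar>) summable_on I"
      by (rule summable_on_comparison_test) simp
    then show ?thesis unfolding a_def by (rule has_sum_infsum[OF summable_abs_real[THEN iffD2]])
  qed
  have pa: "pseries (\<lambda>\<beta>. infsum \<kappa> {\<alpha> \<in> I. b \<alpha> = \<beta>}) \<rho> a"
    by (rule pseries_group(2)) (use aI \<rho> in auto)
  show ?thesis
  proof (rule that)
    show "real_analytic_at a v0"
      using pseries_shift[OF pa \<rho>(2)] by (rule pseries_imp_real_analytic_at) (simp add: \<rho>)
    have "\<forall>\<^sub>F v in nhds v0. \<forall>l. \<bar>v $ l\<bar> < \<rho> l"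
    proof (rule eventually_all_finite)
      fix l
      have "((\<lambda>v :: real^'d. \<bar>v $ l\<bar>) \<longlongrightarrow> \<bar>v0 $ l\<bar>) (nhds v0)"
        by (intro isCont_tendsto_nhds continuous_intros)
      then show "\<forall>\<^sub>F v in nhds v0. \<bar>v $ l\<bar> < \<rho> l" using \<rho>(2) by (rule order_tendstoD)
    qed
    then show "\<forall>\<^sub>F v in nhds v0. K (?G v) = a v * (\<Prod>l\<in>UNIV. v $ l ^ (if l \<in> Z then 2 * N l else 0))"
    proof eventually_elim
      case (elim v)
      have "((\<lambda>\<alpha>. \<kappa> \<alpha> * mpow (?G v) \<alpha>) has_sum a v * mpow v x) I"
        using has_sum_cmult_left[OF aI, of v "mpow v x"] elim
        by (subst has_sum_cong[where g = "\<lambda>\<alpha>. \<kappa> \<alpha> * mpow v (b \<alpha>) * mpow v x"]) (auto simp: mb)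
      then have "K (?G v) = a v * mpow v x" using KI elim has_sum_unique by blast
      then show ?case by (simp add: mpow_def x_def)
    qed
    \<comment> \<open>At v0 the coordinates in \<open>Z\<close> are 0, so only indices with b = 0 on
      \<open>Z\<close> survive. Since 0^0 = 1, these coordinates can as well be set to 1, which
      gives \<open>?v1\<close>.\<close>
    let ?S = "{\<alpha>. \<forall>e\<in>Z. wt R (N e) \<alpha> = 2 * N e}" and ?v1 = "\<chi> l. if l \<in> Z then 1 else v0 $ l"
    have fS: "finite ?S"
      by (rule finite_subset[OF _ finite_wt_eq[of "N z" R "2 * N z"]]) (use z Z N in auto)
    have "((\<lambda>\<alpha>. \<kappa> \<alpha> * mpow v0 (b \<alpha>)) has_sum (\<Sum>\<alpha>\<in>?S. \<kappa> \<alpha> * mpow (?G ?v1) \<alpha>)) I"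
    proof -
      have 1: "mpow v0 (b \<alpha>) = 0" if \<alpha>: "\<alpha> \<in> I" "\<alpha> \<notin> ?S" for \<alpha>
      proof -
        obtain e where e: "e \<in> Z" "wt R (N e) \<alpha> \<noteq> 2 * N e" using \<alpha>(2) by blast
        then have "b \<alpha> e \<noteq> 0" using low[of e \<alpha>] \<alpha>(1) Z by (force simp: b_def I_def not_less)
        then show ?thesis using e(1) Z by (auto simp: mpow_def intro!: exI[of _ e])
      qed
      have 2: "mpow v0 (b \<alpha>) = mpow (?G ?v1) \<alpha>" if "\<alpha> \<in> ?S" for \<alpha>
        unfolding mpow_mono_map unfolding mpow_def
        using that Z by (intro prod.cong) (auto simp: b_def)
      have "((\<lambda>\<alpha>. \<kappa> \<alpha> * mpow (?G ?v1) \<alpha>) has_sum (\<Sum>\<alpha>\<in>?S. \<kappa> \<alpha> * mpow (?G ?v1) \<alpha>)) ?S"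
        using fS by simp
      then show ?thesis
        by (rule has_sum_cong_neutral[THEN iffD1, rotated 3]) (auto simp: 1 2 I_def)
    qed
    then show "a v0 = (\<Sum>\<alpha>\<in>?S. \<kappa> \<alpha> * mpow (?G ?v1) \<alpha>)"
      using aI[OF \<rho>(2)] has_sum_unique by blast
  qed
qed

section \<open>The leading forms of the Kullback-Leibler divergence\<close>

text \<open>Derivatives at 0 determine the coefficients of a series, and here the series represents
  the zero function.\<close>

lemma polynomial_coeffs_zero:
  fixes d :: "('d::finite \<Rightarrow> nat) \<Rightarrow> real"
  assumes "finite T" "\<And>\<theta>. (\<Sum>\<beta>\<in>T. d \<beta> * mpow \<theta> \<beta>) = 0" "\<beta> \<in> T"
  shows "d \<beta> = 0"
proof -
  have "pseries (\<lambda>\<beta>. if \<beta> \<in> T then d \<beta> else 0) (\<lambda>_. 1) (\<lambda>_. 0)"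
    unfolding pseries_def
  proof safe
    fix w :: "real^'d"
    have "((\<lambda>\<alpha>. (if \<alpha> \<in> T then d \<alpha> else 0) * mpow w \<alpha>) has_sum (\<Sum>\<beta>\<in>T. d \<beta> * mpow w \<beta>)) UNIV"
      using assms(1) by (intro has_sum_finite_neutralI[of T]) auto
    then show "((\<lambda>\<alpha>. (if \<alpha> \<in> T then d \<alpha> else 0) * mpow w \<alpha>) has_sum 0) UNIV" using assms(2) by simp
  qed
  from multi_deriv_pseries[OF this, of \<beta>] have "multi_deriv \<beta> (\<lambda>_. 0) (0 :: real^'d) = mfact \<beta> * d \<beta>"
    using assms(3) by simp
  moreover have "multi_deriv \<beta> (\<lambda>_. 0) (0 :: real^'d) = mfact \<beta> * 0"
    using multi_deriv_pseries[OF pseries_const[of 0 "\<lambda>_. 1"], of \<beta>] by simp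
  ultimately show ?thesis using mfact_pos[of \<beta>] by simp
qed

lemma isCont_mpow: "isCont (\<lambda>\<theta>. mpow \<theta> \<beta>) \<theta>0"
  unfolding mpow_def by (intro continuous_intros)

text \<open>The exceptional null set depends on \<theta>. A countable dense set of \<theta> yields a
  common one, and continuity of the polynomial extends the identity to all \<theta>.\<close>

lemma AE_polynomial_coeffs_zero:
  fixes d :: "('d::finite \<Rightarrow> nat) \<Rightarrow> 'w \<Rightarrow> real"
  assumes T: "finite T" and z: "\<And>\<theta>. AE \<omega> in N. (\<Sum>\<beta>\<in>T. d \<beta> \<omega> * mpow \<theta> \<beta>) = 0"
  shows "AE \<omega> in N. \<forall>\<beta>\<in>T. d \<beta> \<omega> = 0"
proof -
  obtain D :: "(real^'d) set" where D: "countable D" "\<And>X. open X \<Longrightarrow> X \<noteq> {} \<Longrightarrow> \<exists>x\<in>D. x \<in> X"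
    using countable_dense_exists by blast
  have "AE \<omega> in N. \<forall>\<theta>\<in>D. (\<Sum>\<beta>\<in>T. d \<beta> \<omega> * mpow \<theta> \<beta>) = 0"
    using D(1) z by (subst AE_ball_countable) auto
  then show ?thesis
  proof eventually_elim
    case (elim \<omega>)
    have cont: "continuous_on UNIV (\<lambda>\<theta>. \<Sum>\<beta>\<in>T. d \<beta> \<omega> * mpow \<theta> \<beta>)"
      by (intro continuous_on_sum continuous_on_mult continuous_on_const)
        (simp add: continuous_at_imp_continuous_on isCont_mpow)
    have "open ((\<lambda>\<theta>. \<Sum>\<beta>\<in>T. d \<beta> \<omega> * mpow \<theta> \<beta>) -` (- {0}))"
      using cont by (intro open_vimage) auto
    from D(2)[OF this] elim have "(\<Sum>\<beta>\<in>T. d \<beta> \<omega> * mpow \<theta> \<beta>) = 0" for \<theta> by fastforce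
    then show ?case by (intro ballI polynomial_coeffs_zero[OF T, of "\<lambda>\<beta>. d \<beta> \<omega>"])
  qed
qed

lemma wt_add: "wt R n (\<lambda>i. \<alpha> i + \<beta> i) = wt R n \<alpha> + wt R n \<beta>"
  by (simp add: wt_def distrib_left sum.distrib)

text \<open>In a product of total weight 2n, a factor of weight above n forces the other below n,
  where the coefficient is zero. Only pairs of weight n each remain.\<close>

lemma sum_wt_square:
  fixes c :: "('d::finite \<Rightarrow> nat) \<Rightarrow> real"
  assumes n: "n \<ge> 1" and low: "\<And>\<beta>. wt R n \<beta> < n \<Longrightarrow> c \<beta> = 0"
  shows "(\<Sum>\<alpha> | wt R n \<alpha> = 2 * n. (\<Sum>\<beta> | \<forall>i. \<beta> i \<le> \<alpha> i. c \<beta> * c (\<lambda>i. \<alpha> i - \<beta> i)) * mpow \<theta> \<alpha>) =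
    (\<Sum>\<beta> | wt R n \<beta> = n. c \<beta> * mpow \<theta> \<beta>)^2"
proof -
  let ?A = "{\<alpha> :: 'd \<Rightarrow> nat. wt R n \<alpha> = 2 * n}" and ?B = "{\<beta> :: 'd \<Rightarrow> nat. wt R n \<beta> = n}"
  let ?S = "Sigma ?A (\<lambda>\<alpha>. {\<beta>. \<forall>i. \<beta> i \<le> \<alpha> i})"
  let ?f = "\<lambda>(\<alpha>, \<beta>). c \<beta> * c (\<lambda>i. \<alpha> i - \<beta> i) * mpow \<theta> \<alpha>"
  let ?j = "\<lambda>(\<beta>, \<gamma>). (\<lambda>i. \<beta> i + \<gamma> i :: nat, \<beta>)"
  have fin: "finite ?A" "finite ?B" using n by (auto intro: finite_wt_eq)
  have "(\<Sum>\<alpha>\<in>?A. (\<Sum>\<beta> | \<forall>i. \<beta> i \<le> \<alpha> i. c \<beta> * c (\<lambda>i. \<alpha> i - \<beta> i)) * mpow \<theta> \<alpha>) =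
      (\<Sum>\<alpha>\<in>?A. \<Sum>\<beta> | \<forall>i. \<beta> i \<le> \<alpha> i. c \<beta> * c (\<lambda>i. \<alpha> i - \<beta> i) * mpow \<theta> \<alpha>)"
    by (simp add: sum_distrib_right)
  also have "\<dots> = (\<Sum>x\<in>?S. ?f x)" using fin finite_idx_le by (subst sum.Sigma) auto
  also have "\<dots> = (\<Sum>x\<in>?j ` (?B \<times> ?B). ?f x)"
  proof (rule sum.mono_neutral_right)
    show "finite ?S" using fin finite_idx_le by blast
    show "?j ` (?B \<times> ?B) \<subseteq> ?S" by (auto simp: wt_add)
    show "\<forall>x\<in>?S - ?j ` (?B \<times> ?B). ?f x = 0"
    proof (clarsimp, rule ccontr)
      fix \<alpha> \<beta> assume a: "wt R n \<alpha> = 2 * n" "\<forall>i. \<beta> i \<le> \<alpha> i" "(\<alpha>, \<beta>) \<notin> ?j ` (?B \<times> ?B)"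
        and nz: "c \<beta> \<noteq> 0" "c (\<lambda>i. \<alpha> i - \<beta> i) \<noteq> 0" "mpow \<theta> \<alpha> \<noteq> 0"
      have \<alpha>: "\<alpha> = (\<lambda>i. \<beta> i + (\<alpha> i - \<beta> i))" using a(2) by auto
      then have "wt R n \<alpha> = wt R n \<beta> + wt R n (\<lambda>i. \<alpha> i - \<beta> i)" using wt_add by metis
      moreover have "wt R n \<beta> \<ge> n" "wt R n (\<lambda>i. \<alpha> i - \<beta> i) \<ge> n" using low nz by (meson leI)+
      ultimately have "(\<beta>, \<lambda>i. \<alpha> i - \<beta> i) \<in> ?B \<times> ?B" using a(1) by auto
      moreover have "(\<alpha>, \<beta>) = ?j (\<beta>, \<lambda>i. \<alpha> i - \<beta> i)" using \<alpha> by simp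
      ultimately have "(\<alpha>, \<beta>) \<in> ?j ` (?B \<times> ?B)" by (rule image_eqI[rotated])
      then show False using a(3) by contradiction
    qed
  qed
  also have "\<dots> = (\<Sum>(\<beta>, \<gamma>)\<in>?B \<times> ?B. c \<beta> * c \<gamma> * (mpow \<theta> \<beta> * mpow \<theta> \<gamma>))"
  proof (subst sum.reindex)
    show "inj_on ?j (?B \<times> ?B)" by (auto simp: inj_on_def fun_eq_iff)
    show "sum (?f \<circ> ?j) (?B \<times> ?B) = (\<Sum>(\<beta>, \<gamma>)\<in>?B \<times> ?B. c \<beta> * c \<gamma> * (mpow \<theta> \<beta> * mpow \<theta> \<gamma>))"
      by (intro sum.cong) (auto simp: mpow_add)
  qed
  also have "\<dots> = (\<Sum>\<beta>\<in>?B. c \<beta> * mpow \<theta> \<beta>)^2"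
    unfolding power2_eq_square sum_product sum.cartesian_product by (intro sum.cong) (auto simp: mult_ac)
  finally show ?thesis .
qed

lemma sum_idx_eq_1:
  fixes \<beta> :: "'d::finite \<Rightarrow> nat"
  assumes s: "(\<Sum>k\<in>R. \<beta> k) = 1" and z: "\<And>i. i \<notin> R \<Longrightarrow> \<beta> i = 0"
  shows "\<exists>k\<in>R. \<beta> = uidx k"
proof -
  obtain k where k: "k \<in> R" "\<beta> k = 1" "\<forall>i\<in>R. k \<noteq> i \<longrightarrow> \<beta> i = 0"
    using s sum_eq_1_iff[of R \<beta>] by auto
  then have "\<beta> = uidx k" unfolding uidx_def fun_eq_iff using z by metis
  with k show ?thesis by blast
qed

text \<open>Since a coordinate in \<open>R\<close> already has weight n, an index of weight n is
  either one such coordinate alone or has degree n in the remaining coordinates. So (A1) and the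
  form of (A3) enter through one and the same sum.\<close>

lemma sum_wt_eq_taylor_form:
  fixes f :: "real^'d::finite \<Rightarrow> real"
  assumes n: "n \<ge> 1" and c: "pseries c \<rho> f" "\<And>i. \<rho> i > 0"
  shows "(\<Sum>\<beta> | wt R n \<beta> = n. c \<beta> * mpow \<theta> \<beta>) =
    (\<Sum>k\<in>R. \<theta> $ k * partial_deriv k f 0) + taylor_form f n (- R) \<theta>"
proof -
  define T where "T = {\<beta> :: 'd \<Rightarrow> nat. (\<forall>i. i \<notin> - R \<longrightarrow> \<beta> i = 0) \<and> (\<Sum>i\<in>-R. \<beta> i) = n}"
  have B: "{\<beta>. wt R n \<beta> = n} = uidx ` R \<union> T"
  proof (intro set_eqI iffI)
    fix \<beta> assume "\<beta> \<in> {\<beta>. wt R n \<beta> = n}"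
    then have w: "n * (\<Sum>k\<in>R. \<beta> k) + (\<Sum>k\<in>-R. \<beta> k) = n" by (simp add: wt_alt)
    show "\<beta> \<in> uidx ` R \<union> T"
    proof (cases "(\<Sum>k\<in>R. \<beta> k) = 0")
      case True
      then show ?thesis using w by (auto simp: T_def)
    next
      case False
      then have 1: "(\<Sum>k\<in>R. \<beta> k) = 1"
      proof -
        have "(\<Sum>k\<in>R. \<beta> k) \<le> 1"
        proof (rule ccontr)
          assume "\<not> (\<Sum>k\<in>R. \<beta> k) \<le> 1"
          then have "n * 2 \<le> n * (\<Sum>k\<in>R. \<beta> k)" by (intro mult_le_mono) auto
          then show False using w n by linarith
        qed
        then show ?thesis using False by linarith
      qed
      then have "(\<Sum>k\<in>-R. \<beta> k) = 0" using w by simp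
      then have "\<exists>k\<in>R. \<beta> = uidx k" by (intro sum_idx_eq_1[OF 1]) auto
      then show ?thesis by blast
    qed
  next
    fix \<beta> assume "\<beta> \<in> uidx ` R \<union> T"
    then show "\<beta> \<in> {\<beta>. wt R n \<beta> = n}"
    proof
      assume "\<beta> \<in> uidx ` R"
      then obtain k where k: "k \<in> R" "\<beta> = uidx k" by blast
      have "(\<Sum>l\<in>R. uidx k l) = (\<Sum>l\<in>R. if l = k then 1 else 0)" by (simp add: uidx_def)
      then have "(\<Sum>l\<in>R. uidx k l) = 1" using k(1) by (simp add: sum.delta)
      moreover have "(\<Sum>l\<in>-R. uidx k l) = 0" using k(1) by (intro sum.neutral) (auto simp: uidx_def)
      ultimately show ?thesis using k(2) by (simp add: wt_alt)
    next
      assume "\<beta> \<in> T"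
      then have "(\<Sum>l\<in>R. \<beta> l) = 0" "(\<Sum>l\<in>-R. \<beta> l) = n" unfolding T_def by auto
      then show ?thesis by (simp add: wt_alt)
    qed
  qed
  have fin: "finite {\<beta> :: 'd \<Rightarrow> nat. wt R n \<beta> = n}" using n by (rule finite_wt_eq)
  have disj: "uidx ` R \<inter> T = {}" by (auto simp: T_def uidx_def)
  have "(\<Sum>\<beta> | wt R n \<beta> = n. c \<beta> * mpow \<theta> \<beta>) = (\<Sum>\<beta>\<in>uidx ` R. c \<beta> * mpow \<theta> \<beta>) + (\<Sum>\<beta>\<in>T. c \<beta> * mpow \<theta> \<beta>)"
    unfolding B using fin disj unfolding B by (intro sum.union_disjoint) auto
  also have "(\<Sum>\<beta>\<in>uidx ` R. c \<beta> * mpow \<theta> \<beta>) = (\<Sum>k\<in>R. \<theta> $ k * partial_deriv k f 0)"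
    by (subst sum.reindex) (auto simp: inj_on_def mpow_uidx partial_deriv_pseries[OF c] intro!: sum.cong)
  also have "(\<Sum>\<beta>\<in>T. c \<beta> * mpow \<theta> \<beta>) = taylor_form f n (- R) \<theta>"
    unfolding taylor_form_def T_def[symmetric]
  proof (rule sum.cong[OF refl])
    fix \<beta> assume "\<beta> \<in> T"
    then have z: "\<And>i. i \<in> R \<Longrightarrow> \<beta> i = 0" by (simp add: T_def)
    have "mfact \<beta> = (\<Prod>i\<in>-R. fact (\<beta> i))" unfolding mfact_def by (intro prod.mono_neutral_right) (auto simp: z)
    moreover have "mpow \<theta> \<beta> = (\<Prod>i\<in>-R. \<theta> $ i ^ \<beta> i)" unfolding mpow_def by (intro prod.mono_neutral_right) (auto simp: z)
    ultimately show "c \<beta> * mpow \<theta> \<beta> = 1 / (\<Prod>i\<in>-R. fact (\<beta> i)) * multi_deriv \<beta> f 0 * (\<Prod>i\<in>-R. \<theta> $ i ^ \<beta> i)"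
      using multi_deriv_pseries[OF c, of \<beta>] mfact_pos[of \<beta>] by simp
  qed
  finally show ?thesis .
qed

section \<open>Taylor coefficients of the likelihood ratio and of the divergence\<close>

context realizable_model
begin

abbreviation "lr \<omega> \<equiv> loglik_ratio p (X \<omega>)"

definition fcoeff :: "('d \<Rightarrow> nat) \<Rightarrow> 'w \<Rightarrow> real" where
  "fcoeff \<alpha> \<omega> = multi_deriv \<alpha> (lr \<omega>) 0 / mfact \<alpha>"

definition kcoeff :: "('d \<Rightarrow> nat) \<Rightarrow> real" where
  "kcoeff \<alpha> = multi_deriv \<alpha> (kl_div N X p) 0 / mfact \<alpha>"

text \<open>One neighbourhood witnessing \<open>regularity\<close> is fixed by choice, so that its
  properties can be stated as separate facts about the same set.\<close>

definition W0 :: "(real^'d) set" where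
  "W0 = (SOME W. W \<subseteq> \<Theta> \<and> open W \<and> 0 \<in> W \<and>
      (\<forall>\<theta>\<in>W. integrable N (\<lambda>\<omega>. (loglik_ratio p (X \<omega>) \<theta>)\<^sup>2)) \<and>
      (AE \<omega> in N. real_analytic_on (loglik_ratio p (X \<omega>)) W) \<and>
      real_analytic_on (kl_div N X p) W \<and>
      (\<forall>\<theta>\<in>W. \<forall>\<alpha>. integrable N (\<lambda>\<omega>. multi_deriv \<alpha> (loglik_ratio p (X \<omega>)) \<theta>) \<and>
         multi_deriv \<alpha> (kl_div N X p) \<theta> =
           expectation (\<lambda>\<omega>. multi_deriv \<alpha> (loglik_ratio p (X \<omega>)) \<theta>)) \<and>
      (\<forall>\<theta>\<in>W. \<forall>\<alpha>. integrable N (\<lambda>\<omega>. multi_deriv \<alpha> (\<lambda>\<theta>'. p (X \<omega>) \<theta>' / q (X \<omega>)) \<theta>) \<and>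
         multi_deriv \<alpha> (\<lambda>\<theta>'. expectation (\<lambda>\<omega>. p (X \<omega>) \<theta>' / q (X \<omega>))) \<theta> =
           expectation (\<lambda>\<omega>. multi_deriv \<alpha> (\<lambda>\<theta>'. p (X \<omega>) \<theta>' / q (X \<omega>)) \<theta>)))"

lemma
  shows W0: "W0 \<subseteq> \<Theta>" "open W0" "0 \<in> W0"
    and lr_analytic: "AE \<omega> in N. real_analytic_on (lr \<omega>) W0"
    and kl_analytic: "real_analytic_on (kl_div N X p) W0"
    and lr_interchange: "\<theta> \<in> W0 \<Longrightarrow> integrable N (\<lambda>\<omega>. multi_deriv \<alpha> (lr \<omega>) \<theta>)"
      "\<theta> \<in> W0 \<Longrightarrow> multi_deriv \<alpha> (kl_div N X p) \<theta> = expectation (\<lambda>\<omega>. multi_deriv \<alpha> (lr \<omega>) \<theta>)"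
    and p_interchange: "\<theta> \<in> W0 \<Longrightarrow> integrable N (\<lambda>\<omega>. multi_deriv \<alpha> (\<lambda>\<theta>'. p (X \<omega>) \<theta>' / q (X \<omega>)) \<theta>)"
      "\<theta> \<in> W0 \<Longrightarrow> multi_deriv \<alpha> (\<lambda>\<theta>'. expectation (\<lambda>\<omega>. p (X \<omega>) \<theta>' / q (X \<omega>))) \<theta> =
           expectation (\<lambda>\<omega>. multi_deriv \<alpha> (\<lambda>\<theta>'. p (X \<omega>) \<theta>' / q (X \<omega>)) \<theta>)"
  using someI_ex[OF regularity] unfolding W0_def[symmetric] by blast+

lemma zero_in_Theta: "0 \<in> \<Theta>" using W0 by blast

lemma X_measurable: "X \<in> measurable N M"
  using true_density unfolding distributed_def by blast

lemma X_space: "\<omega> \<in> space N \<Longrightarrow> X \<omega> \<in> space M"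
  using X_measurable by (rule measurable_space)

text \<open>The law of \<open>X\<close> has a density with respect to \<open>M\<close>, so null sets
  of \<open>M\<close> are null for it.\<close>

lemma AE_q_eq: "AE \<omega> in N. q (X \<omega>) = p (X \<omega>) 0"
proof -
  have 1: "AE x in density M (\<lambda>x. ennreal (q x)). q x = p x 0"
    using true_density realizable by (subst AE_density) (auto simp: distributed_def)
  have 2: "distr N M X = density M (\<lambda>x. ennreal (q x))" using true_density by (simp add: distributed_def)
  have "AE x in distr N M X. q x = p x 0" unfolding 2 by (rule 1)
  then show ?thesis using X_measurable by (rule AE_distrD[rotated])
qed

lemma multi_deriv_0:
  fixes h :: "real^'d \<Rightarrow> real"
  shows "multi_deriv (\<lambda>_. 0) h \<theta> = h \<theta>"
proof -
  have "fold (\<lambda>i. partial_deriv i ^^ 0) xs h = h" for xs and h :: "real^'d \<Rightarrow> real"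
    by (induction xs) auto
  then show ?thesis unfolding multi_deriv_def by (rule fun_cong)
qed

lemma expectation_p_ratio:
  assumes "\<theta> \<in> W0"
  shows "expectation (\<lambda>\<omega>. p (X \<omega>) \<theta> / q (X \<omega>)) = 1"
proof -
  have \<theta>: "\<theta> \<in> \<Theta>" using assms W0 by blast
  have meas: "(\<lambda>x. p x \<theta>) \<in> borel_measurable M" "(\<lambda>x. p x 0) \<in> borel_measurable M"
    using density_measurable \<theta> zero_in_Theta by auto
  have "integrable N (\<lambda>\<omega>. p (X \<omega>) \<theta> / q (X \<omega>))"
    using p_interchange(1)[OF assms, of "\<lambda>_. 0"] by (simp add: multi_deriv_0)
  moreover have "(\<lambda>\<omega>. p (X \<omega>) \<theta> / p (X \<omega>) 0) \<in> borel_measurable N"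
    using meas X_measurable by (auto intro: measurable_compose)
  \<comment> \<open>The true density is replaced by p at parameter 0, which is positive on the whole
    space and hence cancels in the integral over \<open>M\<close>.\<close>
  ultimately have "expectation (\<lambda>\<omega>. p (X \<omega>) \<theta> / q (X \<omega>)) = expectation (\<lambda>\<omega>. p (X \<omega>) \<theta> / p (X \<omega>) 0)"
    using AE_q_eq by (intro integral_cong_AE) auto
  also have "\<dots> = (\<integral>x. p x 0 * (p x \<theta> / p x 0) \<partial>M)"
  proof (rule distributed_integral[symmetric])
    have "AE x in M. ennreal (q x) = ennreal (p x 0)" using realizable by eventually_elim simp
    then have "density M (\<lambda>x. ennreal (q x)) = density M (\<lambda>x. ennreal (p x 0))"
      using true_density meas by (intro density_cong) (auto simp: distributed_def)
    then show "distributed N M X (\<lambda>x. ennreal (p x 0))"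
      using true_density meas by (auto simp: distributed_def)
    show "(\<lambda>x. p x \<theta> / p x 0) \<in> borel_measurable M" using meas by simp
    show "0 \<le> p x 0" if "x \<in> space M" for x using density_pos[OF zero_in_Theta that] by simp
  qed
  also have "\<dots> = (\<integral>x. p x \<theta> \<partial>M)"
    using density_pos[OF zero_in_Theta] by (intro Bochner_Integration.integral_cong) (auto, fastforce)
  also have "\<dots> = 1"
  proof -
    have "(\<integral>x. p x \<theta> \<partial>M) = enn2real (\<integral>\<^sup>+x. ennreal (p x \<theta>) \<partial>M)"
      using meas density_pos[OF \<theta>] by (intro integral_eq_nn_integral) (auto intro!: AE_I2 less_imp_le)
    then show ?thesis using density_integral[OF \<theta>] by simp
  qed
  finally show ?thesis .
qed

lemma W0_box: obtains e where "e > 0" "\<And>w. (\<And>i. \<bar>w $ i\<bar> < e) \<Longrightarrow> w \<in> W0"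
proof -
  obtain r where r: "r > 0" "ball 0 r \<subseteq> W0" using W0(2,3) open_contains_ball by blast
  show thesis
  proof (rule that[of "r / real CARD('d)"])
    show "r / real CARD('d) > 0" using r by simp
    fix w :: "real^'d" assume w: "\<And>i. \<bar>w $ i\<bar> < r / real CARD('d)"
    have "norm w \<le> (\<Sum>i\<in>UNIV. \<bar>w $ i\<bar>)" by (rule norm_le_l1_cart)
    also have "\<dots> < (\<Sum>i\<in>(UNIV :: 'd set). r / real CARD('d))"
      using w by (intro sum_strict_mono) auto
    also have "\<dots> = r" by simp
    finally show "w \<in> W0" using r(2) by (auto simp: subset_eq)
  qed
qed

lemma pseries_of_analytic:
  assumes "real_analytic_at h (0 :: real^'d)"
  shows "\<exists>e>0. pseries (\<lambda>\<alpha>. multi_deriv \<alpha> h 0 / mfact \<alpha>) (\<lambda>_. e) h"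
proof -
  obtain c e where c: "e > 0" "pseries c (\<lambda>_. e) (\<lambda>w. h (0 + w))"
    using assms unfolding real_analytic_at_iff_pseries by blast
  have "multi_deriv \<alpha> h 0 / mfact \<alpha> = c \<alpha>" for \<alpha>
    using multi_deriv_pseries[of c "\<lambda>_. e" h \<alpha>] c mfact_pos[of \<alpha>] by simp
  then show ?thesis using c by auto
qed

lemma AE_pseries_lr: "AE \<omega> in N. \<exists>e>0. pseries (\<lambda>\<alpha>. fcoeff \<alpha> \<omega>) (\<lambda>_. e) (lr \<omega>)"
  using lr_analytic
  by eventually_elim (use W0(3) in \<open>auto simp: real_analytic_on_def fcoeff_def intro: pseries_of_analytic\<close>)

lemma pseries_kl: "\<exists>e>0. pseries kcoeff (\<lambda>_. e) (kl_div N X p)"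
  using pseries_of_analytic[of "kl_div N X p"] kl_analytic W0(3)
  unfolding real_analytic_on_def kcoeff_def by blast

lemma lr_zero: "\<omega> \<in> space N \<Longrightarrow> lr \<omega> 0 = 0"
  using density_pos[OF zero_in_Theta X_space] by (simp add: loglik_ratio_def)

definition pcoeff :: "('d \<Rightarrow> nat) \<Rightarrow> 'w \<Rightarrow> real" where
  "pcoeff \<alpha> \<omega> = multi_deriv \<alpha> (\<lambda>\<theta>. p (X \<omega>) \<theta> / q (X \<omega>)) 0 / mfact \<alpha>"

text \<open>The expectation of p/q is constantly 1 near 0. Its coefficients of positive degree
  therefore vanish, and by the interchange they are the expectations of the coefficients of
  p/q.\<close>

lemma pcoeff_integral:
  assumes "\<alpha> \<noteq> (\<lambda>_. 0)"
  shows "integrable N (pcoeff \<alpha>)" "expectation (pcoeff \<alpha>) = 0"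
proof -
  show "integrable N (pcoeff \<alpha>)" unfolding pcoeff_def using p_interchange(1)[OF W0(3)] by simp
  obtain e where e: "e > 0" "\<And>w. (\<And>i. \<bar>w $ i\<bar> < e) \<Longrightarrow> w \<in> W0" by (rule W0_box) blast
  have "pseries (\<lambda>\<alpha>. if \<alpha> = (\<lambda>_. 0) then 1 else 0) (\<lambda>_. e) (\<lambda>\<theta>. expectation (\<lambda>\<omega>. p (X \<omega>) \<theta> / q (X \<omega>)))"
    unfolding pseries_def
  proof safe
    fix w :: "real^'d" assume "\<forall>i. \<bar>w $ i\<bar> < e"
    then have "expectation (\<lambda>\<omega>. p (X \<omega>) w / q (X \<omega>)) = 1" by (intro expectation_p_ratio e) auto
    then show "((\<lambda>\<alpha>. (if \<alpha> = (\<lambda>_. 0) then 1 else 0) * mpow w \<alpha>) has_sum expectation (\<lambda>\<omega>. p (X \<omega>) w / q (X \<omega>))) UNIV"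
      using pseriesD[OF pseries_const[of 1 "\<lambda>i. \<bar>w $ i\<bar> + 1"], of w] by simp
  qed
  from multi_deriv_pseries[OF this e(1), of \<alpha>] assms
  have "multi_deriv \<alpha> (\<lambda>\<theta>. expectation (\<lambda>\<omega>. p (X \<omega>) \<theta> / q (X \<omega>))) 0 = 0" by simp
  then show "expectation (pcoeff \<alpha>) = 0" unfolding pcoeff_def using p_interchange(2)[OF W0(3)] by simp
qed

lemma fcoeff_integral: "integrable N (fcoeff \<alpha>)" "expectation (fcoeff \<alpha>) = kcoeff \<alpha>"
  unfolding fcoeff_def kcoeff_def using lr_interchange[OF W0(3)] by simp_all

text \<open>Almost surely p/q = exp (- f) near 0, so the two series have the same coefficients. As f
  has weighted order at least n, up to weight 2n only the linear and the quadratic term of the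
  exponential contribute. The quadratic term is isolated because the left side is integrable
  coefficient by coefficient.\<close>

lemma AE_pcoeff:
  assumes n: "n \<ge> 1" and low: "AE \<omega> in N. \<forall>\<beta>. wt R n \<beta> < n \<longrightarrow> fcoeff \<beta> \<omega> = 0"
  shows "AE \<omega> in N. \<forall>\<alpha>. \<alpha> \<noteq> (\<lambda>_. 0) \<longrightarrow> wt R n \<alpha> \<le> 2 * n \<longrightarrow>
    2 * (pcoeff \<alpha> \<omega> + fcoeff \<alpha> \<omega>) = (\<Sum>\<beta> | \<forall>i. \<beta> i \<le> \<alpha> i. fcoeff \<beta> \<omega> * fcoeff (\<lambda>i. \<alpha> i - \<beta> i) \<omega>)"
  using AE_pseries_lr low AE_q_eq AE_space
proof eventually_elim
  case (elim \<omega>)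
  obtain e where e: "e > 0" "pseries (\<lambda>\<alpha>. fcoeff \<alpha> \<omega>) (\<lambda>_. e) (lr \<omega>)" using elim by blast
  have neg: "pseries (\<lambda>\<alpha>. -1 * fcoeff \<alpha> \<omega>) (\<lambda>_. e) (\<lambda>\<theta>. -1 * lr \<omega> \<theta>)" using e(2) by (rule pseries_cmult)
  have "fcoeff (\<lambda>_. 0) \<omega> = 0" using pseries_zero[OF e(2,1)] lr_zero elim by simp
  then obtain \<sigma> where \<sigma>: "\<sigma> > 0" "pseries (comp_coeff (\<lambda>k. 1 / fact k) (\<lambda>\<alpha>. -1 * fcoeff \<alpha> \<omega>)) (\<lambda>_. \<sigma>) (\<lambda>\<theta>. exp (-1 * lr \<omega> \<theta>))"
    using pseries_exp[OF neg e(1)] by auto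
  obtain e' where e': "e' > 0" "\<And>w. (\<And>i. \<bar>w $ i\<bar> < e') \<Longrightarrow> w \<in> W0" by (rule W0_box) blast
  have "pseries (comp_coeff (\<lambda>k. 1 / fact k) (\<lambda>\<alpha>. -1 * fcoeff \<alpha> \<omega>)) (\<lambda>_. min \<sigma> e') (\<lambda>\<theta>. p (X \<omega>) \<theta> / q (X \<omega>))"
    unfolding pseries_def
  proof safe
    fix w :: "real^'d" assume w: "\<forall>i. \<bar>w $ i\<bar> < min \<sigma> e'"
    then have "w \<in> \<Theta>" using e'(2)[of w] W0(1) by auto
    then have "p (X \<omega>) w > 0" "p (X \<omega>) 0 > 0" using density_pos X_space elim zero_in_Theta by auto
    then have "exp (-1 * lr \<omega> w) = p (X \<omega>) w / q (X \<omega>)"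
      using elim by (simp add: loglik_ratio_def exp_minus inverse_eq_divide)
    then show "((\<lambda>\<alpha>. comp_coeff (\<lambda>k. 1 / fact k) (\<lambda>\<alpha>. -1 * fcoeff \<alpha> \<omega>) \<alpha> * mpow w \<alpha>) has_sum p (X \<omega>) w / q (X \<omega>)) UNIV"
      using pseriesD[OF \<sigma>(2), of w] w by simp
  qed
  from multi_deriv_pseries[OF this] have pc: "pcoeff \<alpha> \<omega> = comp_coeff (\<lambda>k. 1 / fact k) (\<lambda>\<alpha>. -1 * fcoeff \<alpha> \<omega>) \<alpha>" for \<alpha>
    using \<sigma> e' mfact_pos[of \<alpha>] unfolding pcoeff_def by simp
  show ?case
  proof safe
    fix \<alpha> :: "'d \<Rightarrow> nat" assume \<alpha>: "\<alpha> \<noteq> (\<lambda>_. 0)" "wt R n \<alpha> \<le> 2 * n"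
    have "comp_coeff (\<lambda>k. 1 / fact k) (\<lambda>\<alpha>. -1 * fcoeff \<alpha> \<omega>) \<alpha> =
        -1 * fcoeff \<alpha> \<omega> + (\<Sum>\<beta> | \<forall>i. \<beta> i \<le> \<alpha> i. (-1 * fcoeff \<beta> \<omega>) * (-1 * fcoeff (\<lambda>i. \<alpha> i - \<beta> i) \<omega>)) / 2"
      by (rule comp_coeff_exp_low[where wt = "wt R n" and n = n]) (use \<alpha> n elim in \<open>auto simp: wt_add\<close>)
    then show "2 * (pcoeff \<alpha> \<omega> + fcoeff \<alpha> \<omega>) = (\<Sum>\<beta> | \<forall>i. \<beta> i \<le> \<alpha> i. fcoeff \<beta> \<omega> * fcoeff (\<lambda>i. \<alpha> i - \<beta> i) \<omega>)"
      unfolding pc by simp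
  qed
qed

text \<open>Adding \<open>pcoeff\<close>, of expectation 0, does not change the expectation of
  \<open>fcoeff\<close>. This form makes K accessible to the quadratic identity of
  \<open>AE_pcoeff\<close>.\<close>

lemma kcoeff_eq:
  assumes "\<alpha> \<noteq> (\<lambda>_. 0)"
  shows "kcoeff \<alpha> = expectation (\<lambda>\<omega>. 2 * (pcoeff \<alpha> \<omega> + fcoeff \<alpha> \<omega>)) / 2"
    "integrable N (\<lambda>\<omega>. 2 * (pcoeff \<alpha> \<omega> + fcoeff \<alpha> \<omega>))"
  using pcoeff_integral[OF assms] fcoeff_integral[of \<alpha>] by simp_all

lemma kcoeff_zero: "kcoeff (\<lambda>_. 0) = 0"
proof -
  have "kl_div N X p 0 = expectation (\<lambda>\<omega>. 0)"
    unfolding kl_div_def by (intro Bochner_Integration.integral_cong) (auto simp: lr_zero)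
  then show ?thesis by (simp add: kcoeff_def multi_deriv_0)
qed

text \<open>In each product of the quadratic term one factor has weight below n and
  vanishes.\<close>

lemma kcoeff_low:
  assumes n: "n \<ge> 1" and low: "AE \<omega> in N. \<forall>\<beta>. wt R n \<beta> < n \<longrightarrow> fcoeff \<beta> \<omega> = 0"
    and \<alpha>: "wt R n \<alpha> < 2 * n"
  shows "kcoeff \<alpha> = 0"
proof (cases "\<alpha> = (\<lambda>_. 0)")
  case False
  have "AE \<omega> in N. 2 * (pcoeff \<alpha> \<omega> + fcoeff \<alpha> \<omega>) = 0"
    using AE_pcoeff[OF n low] low
  proof eventually_elim
    case (elim \<omega>)
    have "fcoeff \<beta> \<omega> * fcoeff (\<lambda>i. \<alpha> i - \<beta> i) \<omega> = 0" if "\<forall>i. \<beta> i \<le> \<alpha> i" for \<beta>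
    proof -
      have "\<alpha> = (\<lambda>i. \<beta> i + (\<alpha> i - \<beta> i))" using that by auto
      then have "wt R n \<alpha> = wt R n \<beta> + wt R n (\<lambda>i. \<alpha> i - \<beta> i)" using wt_add by metis
      then have "wt R n \<beta> < n \<or> wt R n (\<lambda>i. \<alpha> i - \<beta> i) < n" using \<alpha> by linarith
      then show ?thesis using elim(2) by auto
    qed
    then have "(\<Sum>\<beta> | \<forall>i. \<beta> i \<le> \<alpha> i. fcoeff \<beta> \<omega> * fcoeff (\<lambda>i. \<alpha> i - \<beta> i) \<omega>) = 0" by (intro sum.neutral) auto
    then show ?case using elim(1) False \<alpha> by simp
  qed
  then have "expectation (\<lambda>\<omega>. 2 * (pcoeff \<alpha> \<omega> + fcoeff \<alpha> \<omega>)) = 0" by (rule integral_eq_zero_AE)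
  then show ?thesis using kcoeff_eq[OF False] by simp
qed (simp add: kcoeff_zero)

text \<open>Twice the lead form is the expectation of the square of the weight-n part of f. A
  nonnegative variable of expectation zero vanishes almost surely.\<close>

lemma lead_form_zero:
  assumes n: "n \<ge> 1" and low: "AE \<omega> in N. \<forall>\<beta>. wt R n \<beta> < n \<longrightarrow> fcoeff \<beta> \<omega> = 0"
    and z: "lead_form R kcoeff n \<theta> = 0"
  shows "AE \<omega> in N. (\<Sum>k\<in>R. \<theta> $ k * partial_deriv k (lr \<omega>) 0) + taylor_form (lr \<omega>) n (- R) \<theta> = 0"
proof -
  let ?A = "{\<alpha> :: 'd \<Rightarrow> nat. wt R n \<alpha> = 2 * n}"
  let ?Q = "\<lambda>\<omega>. \<Sum>\<alpha>\<in>?A. 2 * (pcoeff \<alpha> \<omega> + fcoeff \<alpha> \<omega>) * mpow \<theta> \<alpha>"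
  have fin: "finite ?A" using n by (rule finite_wt_eq)
  have nz: "\<alpha> \<noteq> (\<lambda>_. 0)" if "\<alpha> \<in> ?A" for \<alpha> using that n by (auto simp: wt_def)
  have int: "integrable N ?Q"
    by (intro Bochner_Integration.integrable_sum integrable_mult_left kcoeff_eq(2) nz)
  have "expectation ?Q = (\<Sum>\<alpha>\<in>?A. expectation (\<lambda>\<omega>. 2 * (pcoeff \<alpha> \<omega> + fcoeff \<alpha> \<omega>) * mpow \<theta> \<alpha>))"
    by (intro Bochner_Integration.integral_sum integrable_mult_left kcoeff_eq(2) nz)
  also have "\<dots> = (\<Sum>\<alpha>\<in>?A. 2 * (kcoeff \<alpha> * mpow \<theta> \<alpha>))"
  proof (rule sum.cong[OF refl])
    fix \<alpha> assume "\<alpha> \<in> ?A"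
    from nz[OF this] show "expectation (\<lambda>\<omega>. 2 * (pcoeff \<alpha> \<omega> + fcoeff \<alpha> \<omega>) * mpow \<theta> \<alpha>) = 2 * (kcoeff \<alpha> * mpow \<theta> \<alpha>)"
      using kcoeff_eq(1)[of \<alpha>] by (subst integral_mult_left_zero) simp
  qed
  also have "\<dots> = 2 * lead_form R kcoeff n \<theta>" by (simp add: lead_form_def sum_distrib_left)
  finally have EQ: "expectation ?Q = 0" using z by simp
  have sq: "AE \<omega> in N. ?Q \<omega> = (\<Sum>\<beta> | wt R n \<beta> = n. fcoeff \<beta> \<omega> * mpow \<theta> \<beta>)^2"
    using AE_pcoeff[OF n low] low
  proof eventually_elim
    case (elim \<omega>)
    have "?Q \<omega> = (\<Sum>\<alpha>\<in>?A. (\<Sum>\<beta> | \<forall>i. \<beta> i \<le> \<alpha> i. fcoeff \<beta> \<omega> * fcoeff (\<lambda>i. \<alpha> i - \<beta> i) \<omega>) * mpow \<theta> \<alpha>)"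
      by (intro sum.cong refl) (use elim(1) nz in auto)
    also have "\<dots> = (\<Sum>\<beta> | wt R n \<beta> = n. fcoeff \<beta> \<omega> * mpow \<theta> \<beta>)^2"
      using n by (rule sum_wt_square) (use elim(2) in auto)
    finally show ?case .
  qed
  then have "AE \<omega> in N. ?Q \<omega> \<ge> 0" by eventually_elim simp
  then have "AE \<omega> in N. ?Q \<omega> = 0" using integral_nonneg_eq_0_iff_AE[OF int] EQ by simp
  with sq AE_pseries_lr show ?thesis
  proof eventually_elim
    case (elim \<omega>)
    obtain e where e: "e > 0" "pseries (\<lambda>\<alpha>. fcoeff \<alpha> \<omega>) (\<lambda>_. e) (lr \<omega>)" using elim by blast
    have "(\<Sum>\<beta> | wt R n \<beta> = n. fcoeff \<beta> \<omega> * mpow \<theta> \<beta>) = 0" using elim(1,3) by simp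
    then show ?case using sum_wt_eq_taylor_form[OF n e(2) e(1), where R = R and \<theta> = \<theta>] by simp
  qed
qed

text \<open>Weight below n excludes the coordinates in \<open>R\<close> and leaves degree below n <=
  m. The constant coefficient vanishes because f is 0 at the true parameter, the others by (A2),
  which has to be passed from forms to coefficients outside a single null set.\<close>

lemma AE_fcoeff_low:
  assumes A2: "condition_A2 N X p R m" and n: "1 \<le> n" "n \<le> m"
  shows "AE \<omega> in N. \<forall>\<beta>. wt R n \<beta> < n \<longrightarrow> fcoeff \<beta> \<omega> = 0"
proof -
  have 0: "AE \<omega> in N. fcoeff (\<lambda>_. 0) \<omega> = 0"
    using AE_space by eventually_elim (simp add: fcoeff_def multi_deriv_0 lr_zero)
  have s: "AE \<omega> in N. \<forall>\<beta>\<in>{\<beta> :: 'd \<Rightarrow> nat. (\<forall>i. i \<notin> - R \<longrightarrow> \<beta> i = 0) \<and> (\<Sum>i\<in>-R. \<beta> i) = s}. fcoeff \<beta> \<omega> = 0"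
    (is "AE \<omega> in N. \<forall>\<beta>\<in>?T. _") if s: "1 \<le> s" "s < m" for s
  proof -
    have fin: "finite ?T"
    proof (rule finite_subset[OF _ finite_idx_le[of "\<lambda>_. s"]], safe)
      fix \<beta> :: "'d \<Rightarrow> nat" and i assume b: "\<forall>i. i \<notin> - R \<longrightarrow> \<beta> i = 0"
      show "\<beta> i \<le> (\<Sum>i\<in>-R. \<beta> i)"
        using b by (cases "i \<in> R") (auto intro: member_le_sum)
    qed
    have "R \<noteq> UNIV" using A2 s by (auto simp: condition_A2_def)
    then have "AE \<omega> in N. taylor_form (lr \<omega>) s (- R) \<theta> = 0" for \<theta>
      using A2 s by (auto simp: condition_A2_def vanishing_below_def)
    moreover have "taylor_form (lr \<omega>) s (- R) \<theta> = (\<Sum>\<beta>\<in>?T. fcoeff \<beta> \<omega> * mpow \<theta> \<beta>)" for \<omega> \<theta>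
      unfolding taylor_form_def
    proof (rule sum.cong[OF refl])
      fix \<beta> assume "\<beta> \<in> ?T"
      then have z: "\<And>i. i \<in> R \<Longrightarrow> \<beta> i = 0" by simp
      have "mfact \<beta> = (\<Prod>i\<in>-R. fact (\<beta> i))" unfolding mfact_def by (intro prod.mono_neutral_right) (auto simp: z)
      moreover have "mpow \<theta> \<beta> = (\<Prod>i\<in>-R. \<theta> $ i ^ \<beta> i)" unfolding mpow_def by (intro prod.mono_neutral_right) (auto simp: z)
      ultimately show "1 / (\<Prod>i\<in>-R. fact (\<beta> i)) * multi_deriv \<beta> (lr \<omega>) 0 * (\<Prod>i\<in>-R. \<theta> $ i ^ \<beta> i) = fcoeff \<beta> \<omega> * mpow \<theta> \<beta>"
        by (simp add: fcoeff_def)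
    qed
    ultimately have "AE \<omega> in N. (\<Sum>\<beta>\<in>?T. fcoeff \<beta> \<omega> * mpow \<theta> \<beta>) = 0" for \<theta> by simp
    then show ?thesis by (rule AE_polynomial_coeffs_zero[OF fin])
  qed
  have "AE \<omega> in N. \<forall>s\<in>{1..<m}. \<forall>\<beta>\<in>{\<beta> :: 'd \<Rightarrow> nat. (\<forall>i. i \<notin> - R \<longrightarrow> \<beta> i = 0) \<and> (\<Sum>i\<in>-R. \<beta> i) = s}. fcoeff \<beta> \<omega> = 0"
    by (rule AE_finite_allI) (simp, rule s, simp_all)
  with 0 show ?thesis
  proof eventually_elim
    case (elim \<omega>)
    show ?case
    proof safe
      fix \<beta> :: "'d \<Rightarrow> nat" assume w: "wt R n \<beta> < n"
      then have w': "n * (\<Sum>k\<in>R. \<beta> k) + (\<Sum>k\<in>-R. \<beta> k) < n" by (simp only: wt_alt)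
      then have S: "(\<Sum>k\<in>-R. \<beta> k) < n" by linarith
      have R0: "(\<Sum>k\<in>R. \<beta> k) = 0"
      proof (rule ccontr)
        assume "(\<Sum>k\<in>R. \<beta> k) \<noteq> 0"
        then have "1 \<le> (\<Sum>k\<in>R. \<beta> k)" by linarith
        then have "n * 1 \<le> n * (\<Sum>k\<in>R. \<beta> k)" by (rule mult_le_mono2)
        then show False using w' by linarith
      qed
      then have z: "\<And>i. i \<in> R \<Longrightarrow> \<beta> i = 0" by simp
      show "fcoeff \<beta> \<omega> = 0"
      proof (cases "(\<Sum>k\<in>-R. \<beta> k) = 0")
        case True
        then have "\<beta> = (\<lambda>_. 0)" using z by (auto simp: fun_eq_iff)
        then show ?thesis using elim by simp
      next
        case False
        then have "(\<Sum>k\<in>-R. \<beta> k) \<in> {1..<m}" using S n(2) unfolding atLeastLessThan_iff by linarith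
        with elim(2) show ?thesis using z by blast
      qed
    qed
  qed
qed

lemma taylor_form_zero_coords:
  assumes "n \<ge> 1" "\<And>i. i \<notin> R \<Longrightarrow> \<theta> $ i = 0"
  shows "taylor_form f n (- R) \<theta> = 0"
  unfolding taylor_form_def
proof (rule sum.neutral, safe)
  fix \<alpha> :: "'a \<Rightarrow> nat" assume "n = (\<Sum>i\<in>-R. \<alpha> i)"
  then obtain i where "i \<in> - R" "\<alpha> i \<noteq> 0" using assms(1) by (metis not_one_le_zero sum.neutral)
  then have "(\<Prod>i\<in>-R. \<theta> $ i ^ \<alpha> i) = 0" using assms(2) by (intro prod_zero) (auto intro!: bexI[of _ i])
  then show "1 / (\<Prod>i\<in>-R. fact (\<alpha> i)) * multi_deriv \<alpha> f 0 * (\<Prod>i\<in>-R. \<theta> $ i ^ \<alpha> i) = 0" by simp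
qed

text \<open>The form of degree n vanishes almost surely: by (A2) for n < m, and for n = m by (A3),
  or trivially if all coordinates outside \<open>R\<close> are 0. What is left of the weight-n part
  is a relation between the variables of (A1).\<close>

lemma lead_form_nonzero:
  assumes A: "condition_A1 N X p R" "condition_A2 N X p R m" "condition_A3 N X p R m"
    and n: "1 \<le> n" "n \<le> m" and z: "lead_form R kcoeff n \<theta> = 0"
  shows "k \<in> R \<Longrightarrow> \<theta> $ k = 0"
    and "n = m \<Longrightarrow> AE \<omega> in N. taylor_form (lr \<omega>) m (- R) \<theta> = 0"
proof -
  note L = lead_form_zero[OF n(1) AE_fcoeff_low[OF A(2) n] z]
  have tz: "AE \<omega> in N. taylor_form (lr \<omega>) n (- R) \<theta> = 0"
  proof (cases "n < m")
    case True
    then have "R \<noteq> UNIV" using A(2) n by (auto simp: condition_A2_def)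
    then show ?thesis using A(2) True n by (auto simp: condition_A2_def vanishing_below_def)
  next
    case False
    then have nm: "n = m" using n by simp
    show ?thesis
    proof (cases "\<exists>i. i \<notin> R \<and> \<theta> $ i \<noteq> 0")
      case True
      with A(3) consider "AE \<omega> in N. taylor_form (lr \<omega>) m (- R) \<theta> = 0" | "form_independent N X p R m \<theta>"
        unfolding condition_A3_def by blast
      then show ?thesis
      proof cases
        case 2
        \<comment> \<open>The vanishing weight-m part is a linear relation in which the form has
          coefficient 1, which alternative (ii) forbids.\<close>
        define c where "c k = (case k of None \<Rightarrow> 1 | Some i \<Rightarrow> \<theta> $ i)" for k :: "'d option"
        let ?Y = "\<lambda>k \<omega>. case k of None \<Rightarrow> taylor_form (lr \<omega>) m (- R) \<theta> | Some i \<Rightarrow> partial_deriv i (lr \<omega>) 0"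
        have "(\<Sum>k\<in>insert None (Some ` R). c k * ?Y k \<omega>) =
            taylor_form (lr \<omega>) m (- R) \<theta> + (\<Sum>k\<in>R. \<theta> $ k * partial_deriv k (lr \<omega>) 0)" for \<omega>
          by (subst sum.insert) (auto simp: sum.reindex c_def)
        then have "AE \<omega> in N. (\<Sum>k\<in>insert None (Some ` R). c k * ?Y k \<omega>) = 0"
          using L nm by (simp add: add.commute)
        then have "c None = 0" using 2 unfolding form_independent_def lin_indep_rvs_def by blast
        then show ?thesis by (simp add: c_def)
      qed (use nm in simp)
    next
      case False
      then have "taylor_form f n (- R) \<theta> = 0" for f by (intro taylor_form_zero_coords[OF n(1)]) auto
      then show ?thesis by simp
    qed
  qed
  then show "n = m \<Longrightarrow> AE \<omega> in N. taylor_form (lr \<omega>) m (- R) \<theta> = 0" by simp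
  from L tz have "AE \<omega> in N. (\<Sum>k\<in>R. \<theta> $ k * partial_deriv k (lr \<omega>) 0) = 0"
    by eventually_elim simp
  then show "k \<in> R \<Longrightarrow> \<theta> $ k = 0"
    using A(1) unfolding condition_A1_def lin_indep_rvs_def by blast
qed

end

section \<open>Normal crossings in the charts\<close>

lemma real_analytic_at_translate:
  "real_analytic_at f (x + y) \<Longrightarrow> real_analytic_at (\<lambda>u. f (x + u)) y"
  unfolding real_analytic_at_iff_pseries by (simp add: add.assoc)

lemma analytic_diffeo_translation:
  fixes v0 :: "real^'d::finite"
  assumes U: "open U"
  shows "analytic_diffeo_on (\<lambda>u. v0 + u) ((\<lambda>v. v - v0) ` U)"
proof -
  let ?V = "(\<lambda>v. v - v0) ` U"
  have im: "(\<lambda>u. v0 + u) ` ?V = U" by (auto simp: image_image)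
  have oV: "open ?V" using open_translation_subtract[OF U, of v0] by simp
  have inv: "inv_into ?V (\<lambda>u. v0 + u) v = - v0 + v" if "v \<in> U" for v
    by (rule inv_into_f_eq) (use that in \<open>auto simp: inj_on_def\<close>)
  have an: "real_analytic_at (\<lambda>u. (c + u) $ i) x" for c x :: "real^'d" and i
    by (simp add: real_analytic_at_add real_analytic_at_const real_analytic_at_coord)
  have "real_analytic_at (\<lambda>x. inv_into ?V (\<lambda>u. v0 + u) x $ i) v" if "v \<in> U" for v i
  proof (rule real_analytic_at_cong[OF an[of "- v0"]])
    show "\<forall>\<^sub>F y in nhds v. (- v0 + y) $ i = inv_into ?V (\<lambda>u. v0 + u) y $ i"
      using eventually_nhds_in_open[OF U that] by eventually_elim (simp add: inv)
  qed
  then show ?thesis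
    unfolding analytic_diffeo_on_def im analytic_map_on_def real_analytic_on_def
    using oV U an by (auto simp: inj_on_def)
qed

lemma mono_map_eq_0_imp:
  assumes "mono_map R E N v = 0" "E \<noteq> {}"
  shows "\<exists>e\<in>E. v $ e = 0"
proof -
  obtain k where "k \<in> E" using assms(2) by blast
  then have "(\<Prod>e\<in>E. v $ e ^ Wt R (N e) k) = 0"
    using arg_cong[OF assms(1), of "\<lambda>w. w $ k"] by (simp add: mono_map_def)
  then show ?thesis by (auto simp: prod_zero_iff)
qed

locale semiregular = realizable_model N M X p q \<Theta>
  for N :: "'w measure" and M :: "'x measure" and X :: "'w \<Rightarrow> 'x"
    and p :: "'x \<Rightarrow> real^'d::finite \<Rightarrow> real" and q :: "'x \<Rightarrow> real" and \<Theta> :: "(real^'d) set" +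
  fixes R :: "'d set" and m :: nat
  assumes A1: "condition_A1 N X p R" and A2: "condition_A2 N X p R m" and A3: "condition_A3 N X p R m"
    and R: "R \<noteq> {}"
begin

abbreviation "K \<equiv> kl_div N X p"

lemma m1: "m \<ge> 1" using A2 by (simp add: condition_A2_def)

lemma m_eq_1_iff: "m = 1 \<longleftrightarrow> R = UNIV" using A2 by (simp add: condition_A2_def)

definition lam :: ereal where
  "lam = ereal ((real CARD('d) - real (card R) + real (card R) * real m) / (2 * real m))"

text \<open>Formulated for chart coordinates rather than for points, so that it serves both the
  blow-up atlas and the atlas of the resolution.\<close>

definition regular_point :: "'d list \<Rightarrow> real^'d \<Rightarrow> bool" where
  "regular_point c v \<longleftrightarrow> chart_map R c v = 0 \<and>
     \<not> (\<exists>i. i \<notin> R \<and> c = replicate m i \<and> (\<forall>k\<in>R. v $ k = 0) \<and> v $ i = 0 \<and>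
        (AE \<omega> in N. taylor_form (lr \<omega>) m (- R) (\<chi> k. if k = i then 1 else v $ k) = 0))"

lemma kcoeff_low': "1 \<le> n \<Longrightarrow> n \<le> m \<Longrightarrow> wt R n \<alpha> < 2 * n \<Longrightarrow> kcoeff \<alpha> = 0"
  using kcoeff_low AE_fcoeff_low[OF A2] by blast

lemma chart_data_bounds:
  assumes "chart_data R m c E N'" "e \<in> E"
  shows "1 \<le> N' e" "N' e \<le> m"
  using assms m1 by (auto elim!: chart_dataE split: if_splits)

lemma chart_data_nonempty: "chart_data R m c E N' \<Longrightarrow> E \<noteq> {}"
  by (auto elim!: chart_dataE split: if_splits)

text \<open>The leading coefficient is the value of a lead form at the chart image with the
  vanishing exceptional coordinates set to 1. In a chart ending in a direction j of \<open>R\<close>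
  this image has a nonzero j-th coordinate; in a top chart a zero value would make v0
  degenerate.\<close>

lemma leading_coefficient_nonzero:
  assumes cd: "chart_data R m c E N'" and reg: "regular_point c v0"
    and Z: "Z = {e \<in> E. v0 $ e = 0}" "Z \<noteq> {}"
  shows "(\<Sum>\<alpha> | \<forall>e\<in>Z. wt R (N' e) \<alpha> = 2 * N' e.
      kcoeff \<alpha> * mpow (mono_map R E N' (\<chi> l. if l \<in> Z then 1 else v0 $ l)) \<alpha>) \<noteq> 0"
proof -
  let ?G = "mono_map R E N' (\<chi> l. if l \<in> Z then 1 else v0 $ l)"
  from cd show ?thesis
  proof (cases rule: chart_dataE)
    case (1 i)
    then have Zi: "Z = {i}" using Z by auto
    have G: "?G = (\<chi> k. if k = i then 1 else v0 $ k)"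
      using 1 Zi by (auto simp: mono_map_def vec_eq_iff)
    show ?thesis
    proof
      assume "(\<Sum>\<alpha> | \<forall>e\<in>Z. wt R (N' e) \<alpha> = 2 * N' e. kcoeff \<alpha> * mpow ?G \<alpha>) = 0"
      then have lz: "lead_form R kcoeff m ?G = 0" using 1 unfolding Zi by (simp add: lead_form_def)
      have "\<forall>k\<in>R. v0 $ k = 0"
        using lead_form_nonzero(1)[OF A1 A2 A3 m1 order_refl lz] 1(1) by (fastforce simp: G split: if_splits)
      moreover have "AE \<omega> in N. taylor_form (lr \<omega>) m (- R) ?G = 0"
        using lead_form_nonzero(2)[OF A1 A2 A3 m1 order_refl lz] by simp
      moreover have "v0 $ i = 0" using Z Zi by auto
      ultimately show False using reg 1(1,2) unfolding regular_point_def G by blast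
    qed
  next
    case (2 i j n)
    have jE: "j \<in> E" using 2 by (auto split: if_splits)
    \<comment> \<open>The exceptional coordinates outside \<open>Z\<close> are nonzero at v0 and
      those in \<open>Z\<close> have become 1.\<close>
    have "(\<Prod>e\<in>E. (\<chi> l. if l \<in> Z then 1 else v0 $ l) $ e ^ Wt R (N' e) j) \<noteq> 0"
      using Z by auto
    then have Gj: "?G $ j \<noteq> 0" using jE by (simp add: mono_map_def)
    have nz: "lead_form R kcoeff n' \<theta> \<noteq> 0" if "1 \<le> n'" "n' \<le> m" "\<theta> $ j \<noteq> 0" for n' \<theta>
      using lead_form_nonzero(1)[OF A1 A2 A3 that(1,2)] 2(1) that(3) by blast
    show ?thesis
    proof (cases "\<exists>e. Z = {e}")
      case True
      then obtain e where e: "Z = {e}" by blast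
      then have "e \<in> E" using Z by auto
      from chart_data_bounds[OF cd this] have "lead_form R kcoeff (N' e) ?G \<noteq> 0" using Gj by (intro nz)
      moreover have S: "{\<alpha>. \<forall>e\<in>Z. wt R (N' e) \<alpha> = 2 * N' e} = {\<alpha>. wt R (N' e) \<alpha> = 2 * N' e}"
        using e by auto
      ultimately show ?thesis unfolding S lead_form_def by fast
    next
      case False
      have "E = {j} \<or> E = {i, j}" using 2 by (auto split: if_splits)
      then have Zij: "Z = {i, j}" "i \<noteq> j" using False Z by auto
      then have "E \<noteq> {j}" using Z by auto
      then have n: "n \<ge> 1" "i \<notin> R" using 2 by (auto split: if_splits)
      have Nij: "N' i = n" "N' j = n + 1" using n 2 by auto
      \<comment> \<open>Indices of minimal weight for both n and n + 1 are those quadratic in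
        \<open>R\<close> and free of other coordinates. Setting the coordinates outside
        \<open>R\<close> to 0 selects exactly these from the lead form of weight n.\<close>
      define \<theta> :: "real^'d" where "\<theta> = (\<chi> k. if k \<in> R then ?G $ k else 0)"
      have "lead_form R kcoeff n \<theta> = (\<Sum>\<alpha> | \<forall>e\<in>Z. wt R (N' e) \<alpha> = 2 * N' e. kcoeff \<alpha> * mpow ?G \<alpha>)"
        unfolding lead_form_def
      proof (rule sum.mono_neutral_cong_right)
        show "finite {\<alpha> :: 'd \<Rightarrow> nat. wt R n \<alpha> = 2 * n}" using n by (intro finite_wt_eq)
        show "{\<alpha>. \<forall>e\<in>Z. wt R (N' e) \<alpha> = 2 * N' e} \<subseteq> {\<alpha>. wt R n \<alpha> = 2 * n}"
          using Zij Nij by auto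
        show "\<forall>\<alpha>\<in>{\<alpha>. wt R n \<alpha> = 2 * n} - {\<alpha>. \<forall>e\<in>Z. wt R (N' e) \<alpha> = 2 * N' e}. kcoeff \<alpha> * mpow \<theta> \<alpha> = 0"
        proof
          fix \<alpha> assume \<alpha>: "\<alpha> \<in> {\<alpha>. wt R n \<alpha> = 2 * n} - {\<alpha>. \<forall>e\<in>Z. wt R (N' e) \<alpha> = 2 * N' e}"
          then have w: "n * (\<Sum>k\<in>R. \<alpha> k) + (\<Sum>k\<in>-R. \<alpha> k) = 2 * n"
            and w': "(n + 1) * (\<Sum>k\<in>R. \<alpha> k) + (\<Sum>k\<in>-R. \<alpha> k) \<noteq> 2 * (n + 1)"
            using Zij Nij by (auto simp: wt_alt)
          have "(\<Sum>k\<in>-R. \<alpha> k) \<noteq> 0"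
          proof
            assume "(\<Sum>k\<in>-R. \<alpha> k) = 0"
            then have "(\<Sum>k\<in>R. \<alpha> k) = 2" using w n by simp
            then show False using w' \<open>(\<Sum>k\<in>-R. \<alpha> k) = 0\<close> by simp
          qed
          then obtain l where "l \<in> - R" "\<alpha> l \<noteq> 0" by (meson sum.neutral)
          then have "mpow \<theta> \<alpha> = 0" unfolding mpow_def \<theta>_def by (intro prod_zero) (auto intro!: bexI[of _ l])
          then show "kcoeff \<alpha> * mpow \<theta> \<alpha> = 0" by simp
        qed
        fix \<alpha> assume "\<alpha> \<in> {\<alpha>. \<forall>e\<in>Z. wt R (N' e) \<alpha> = 2 * N' e}"
        then have w: "n * (\<Sum>k\<in>R. \<alpha> k) + (\<Sum>k\<in>-R. \<alpha> k) = 2 * n"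
            "(n + 1) * (\<Sum>k\<in>R. \<alpha> k) + (\<Sum>k\<in>-R. \<alpha> k) = 2 * (n + 1)"
          using Zij Nij by (auto simp: wt_alt)
        then have "(\<Sum>k\<in>R. \<alpha> k) = 2" by simp
        then have "(\<Sum>k\<in>-R. \<alpha> k) = 0" using w(1) by simp
        then have "\<alpha> l = 0" if "l \<notin> R" for l using that by simp
        then have "mpow \<theta> \<alpha> = mpow ?G \<alpha>"
          unfolding mpow_def by (intro prod.cong) (auto simp: \<theta>_def)
        then show "kcoeff \<alpha> * mpow \<theta> \<alpha> = kcoeff \<alpha> * mpow ?G \<alpha>" by simp
      qed
      moreover have "lead_form R kcoeff n \<theta> \<noteq> 0"
        by (rule nz) (use n 2 Gj in \<open>auto simp: \<theta>_def\<close>)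
      ultimately show ?thesis by simp
    qed
  qed
qed

text \<open>Everything about a chart that the exponents depend on. At most two coordinates i, j
  occur, as \<open>nc_exponents_compare\<close> requires; the bound 4m on the total exponent later
  excludes two coordinates of exponent 2m, which yields multiplicity 1.\<close>

lemma chart_local_form:
  assumes c: "c \<in> blowup_charts R m" and reg: "regular_point c v0"
  obtains A B k h i j where "real_analytic_at A v0" "A v0 \<noteq> 0" "real_analytic_at B v0" "B v0 \<noteq> 0"
    and "\<forall>\<^sub>F v in nhds v0. K (chart_map R c v) = A v * (\<Prod>l\<in>UNIV. v $ l ^ k l)"
    and "\<And>v. \<exists>D. (chart_map R c has_derivative (\<lambda>w. D *v w)) (at v) \<and> \<bar>det D\<bar> = \<bar>B v * (\<Prod>l\<in>UNIV. v $ l ^ h l)\<bar>"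
    and "\<And>e. k e > 0 \<Longrightarrow> (e = i \<or> e = j) \<and> v0 $ e = 0" and "\<And>e. h e > 0 \<Longrightarrow> k e > 0"
    and "\<And>e. k e > 0 \<Longrightarrow> \<exists>n. 1 \<le> n \<and> n \<le> m \<and> k e = 2 * n \<and> h e = hexp R n"
    and "(\<Sum>e\<in>UNIV. k e) < 4 * m"
    and "(\<exists>i. i \<notin> R \<and> c = replicate m i) \<or> R = UNIV \<Longrightarrow> \<exists>e. k e = 2 * m \<and> h e = hexp R m"
    and "\<And>e v. k e > 0 \<Longrightarrow> v $ e = 0 \<Longrightarrow> chart_map R c v = 0"
proof -
  obtain E N' where cd: "chart_data R m c E N'" using c blowup_charts_iff[OF m1] by blast
  note bd = chart_data_bounds[OF cd]
  have G: "chart_map R c = mono_map R E N'" using chart_map_eq_mono_map[OF cd m1] by (rule ext)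
  define Z where "Z = {e \<in> E. v0 $ e = 0}"
  have "mono_map R E N' v0 = 0" using reg unfolding regular_point_def G by blast
  then have Z0: "Z \<noteq> {}" using mono_map_eq_0_imp chart_data_nonempty[OF cd] unfolding Z_def by blast
  obtain \<epsilon> where \<epsilon>: "\<epsilon> > 0" "pseries kcoeff (\<lambda>_. \<epsilon>) K" using pseries_kl by blast
  obtain A where A: "real_analytic_at A v0"
    "\<forall>\<^sub>F v in nhds v0. K (mono_map R E N' v) = A v * (\<Prod>l\<in>UNIV. v $ l ^ (if l \<in> Z then 2 * N' l else 0))"
    "A v0 = (\<Sum>\<alpha> | \<forall>e\<in>Z. wt R (N' e) \<alpha> = 2 * N' e.
           kcoeff \<alpha> * mpow (mono_map R E N' (\<chi> l. if l \<in> Z then 1 else v0 $ l)) \<alpha>)"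
    by (rule mono_map_local_form[OF \<epsilon>(2,1) bd(1) _ Z_def Z0]) (use kcoeff_low' bd in blast)+
  define k where "k l = (if l \<in> Z then 2 * N' l else 0)" for l
  define h where "h l = (if l \<in> Z then hexp R (N' l) else 0)" for l
  \<comment> \<open>Exceptional coordinates that do not vanish at v0 form the unit of the
    Jacobian.\<close>
  define B where "B v = (\<Prod>e\<in>E - Z. v $ e ^ hexp R (N' e))" for v :: "real^'d"
  from cd have "\<exists>i j. E \<subseteq> {i, j}"
  proof (cases rule: chart_dataE)
    case (1 i) then show ?thesis by (intro exI[of _ i]) auto
  next
    case (2 i j n) then show ?thesis by (intro exI[of _ i] exI[of _ j]) (auto split: if_splits)
  qed
  then obtain i j where ij: "E \<subseteq> {i, j}" by blast
  show thesis
  proof (rule that[of A B k h i j])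
    show "A v0 \<noteq> 0" unfolding A(3) by (rule leading_coefficient_nonzero[OF cd reg Z_def Z0])
    show "real_analytic_at A v0" by (rule A(1))
    show "real_analytic_at B v0" unfolding B_def
      by (intro real_analytic_at_prod real_analytic_at_power real_analytic_at_coord)
    show "B v0 \<noteq> 0" by (auto simp: B_def Z_def)
    show "\<forall>\<^sub>F v in nhds v0. K (chart_map R c v) = A v * (\<Prod>l\<in>UNIV. v $ l ^ k l)"
      using A(2) unfolding G k_def .
    show "(e = i \<or> e = j) \<and> v0 $ e = 0" if "k e > 0" for e
      using that ij by (auto simp: k_def Z_def split: if_splits)
    show "k e > 0" if "h e > 0" for e
      using that bd(1)[of e] by (auto simp: k_def h_def Z_def split: if_splits)
    show "\<exists>n. 1 \<le> n \<and> n \<le> m \<and> k e = 2 * n \<and> h e = hexp R n" if "k e > 0" for e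
      using that bd[of e] by (intro exI[of _ "N' e"]) (auto simp: k_def h_def Z_def split: if_splits)
    fix v
    obtain D where D: "(chart_map R c has_derivative (\<lambda>w. D *v w)) (at v)" "det D = (\<Prod>e\<in>E. v $ e ^ hexp R (N' e))"
      using chart_map_has_derivative[OF cd m1] by blast
    have "(\<Prod>e\<in>E. v $ e ^ hexp R (N' e)) = B v * (\<Prod>e\<in>Z. v $ e ^ hexp R (N' e))"
      unfolding B_def by (rule prod.subset_diff) (auto simp: Z_def)
    also have "(\<Prod>e\<in>Z. v $ e ^ hexp R (N' e)) = (\<Prod>l\<in>UNIV. v $ l ^ h l)"
      by (intro prod.mono_neutral_cong_left) (auto simp: h_def)
    finally show "\<exists>D. (chart_map R c has_derivative (\<lambda>w. D *v w)) (at v) \<and> \<bar>det D\<bar> = \<bar>B v * (\<Prod>l\<in>UNIV. v $ l ^ h l)\<bar>"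
      using D by metis
  next
    have "(\<Sum>e\<in>UNIV. k e) = (\<Sum>e\<in>Z. 2 * N' e)"
      by (intro sum.mono_neutral_cong_right) (auto simp: k_def)
    also have "\<dots> \<le> (\<Sum>e\<in>E. 2 * N' e)" by (intro sum_mono2) (auto simp: Z_def)
    \<comment> \<open>With two exceptional coordinates the sum is 2n + 2(n + 1), where n <
      m.\<close>
    also from cd have "(\<Sum>e\<in>E. 2 * N' e) < 4 * m"
    proof (cases rule: chart_dataE)
      case (2 i j n)
      show ?thesis
      proof (cases "n = 0")
        case False
        then have "i \<noteq> j" "i \<notin> R" "E = {i, j}" using 2 by auto
        then show ?thesis using 2 by simp
      qed (use 2 in simp)
    qed (use m1 in simp)
    finally show "(\<Sum>e\<in>UNIV. k e) < 4 * m" .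
  next
    assume "(\<exists>i. i \<notin> R \<and> c = replicate m i) \<or> R = UNIV"
    then have "\<exists>e. E = {e} \<and> N' e = m"
    proof
      assume "\<exists>i. i \<notin> R \<and> c = replicate m i"
      then obtain i' where i': "i' \<notin> R" "c = replicate m i'" by blast
      from cd show ?thesis
      proof (cases rule: chart_dataE)
        case (2 i j n)
        have "hd c = j" using 2 by simp
        moreover have "hd c = i'" using i' m1 by (cases m) auto
        ultimately have "j = i'" by simp
        then show ?thesis using 2 i' by simp
      qed auto
    next
      assume "R = UNIV"
      then show ?thesis using cd m_eq_1_iff by (auto elim!: chart_dataE split: if_splits)
    qed
    then obtain e where "E = {e}" "N' e = m" by blast
    then have "e \<in> Z" using Z0 by (auto simp: Z_def)
    then show "\<exists>e. k e = 2 * m \<and> h e = hexp R m" using \<open>N' e = m\<close> by (auto simp: k_def h_def)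
  next
    show "chart_map R c v = 0" if "k e > 0" "v $ e = 0" for e v
      unfolding G by (rule mono_map_zero[of e]) (use that bd(1)[of e] in \<open>auto simp: k_def Z_def split: if_splits\<close>)
  qed
qed

text \<open>The ratio is r / 2 + (d - r) / (2n), which decreases in n.\<close>

lemma hexp_ratio:
  assumes "1 \<le> n" "n \<le> m"
  shows "ereal (real (hexp R n + 1) / real (2 * n)) \<ge> lam"
    and "ereal (real (hexp R n + 1) / real (2 * n)) = lam \<longleftrightarrow> n = m"
proof -
  let ?r = "real (card R)" and ?s = "real (card (- R))"
  have un: "card (R \<union> - R) = card R + card (- R)" by (rule card_Un_disjoint) auto
  then have d: "real CARD('d) = ?r + ?s" by simp
  have "card R \<ge> 1" using R by (simp add: Suc_le_eq card_gt_0_iff)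
  then have "n * card R \<ge> 1" using assms(1) by (metis mult_le_mono nat_mult_1)
  then have "hexp R n + 1 = n * card R + card (- R)" unfolding hexp_alt by linarith
  then have q: "real (hexp R n + 1) / real (2 * n) = ?r / 2 + ?s / (2 * real n)"
    using assms(1) by (simp add: field_simps)
  have l: "lam = ereal (?r / 2 + ?s / (2 * real m))"
    using m1 unfolding lam_def d by (simp add: field_simps)
  have "?s / (2 * real m) \<le> ?s / (2 * real n)"
    using assms by (intro divide_left_mono) auto
  then show "ereal (real (hexp R n + 1) / real (2 * n)) \<ge> lam" unfolding q l by simp
  show "ereal (real (hexp R n + 1) / real (2 * n)) = lam \<longleftrightarrow> n = m"
  proof
    assume eq: "ereal (real (hexp R n + 1) / real (2 * n)) = lam"
    show "n = m"
    proof (rule ccontr)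
      assume "n \<noteq> m"
      \<comment> \<open>For \<open>R = UNIV\<close> the ratio would not depend on n, but then m = 1
        leaves no n other than m.\<close>
      then have "R \<noteq> UNIV" using assms m_eq_1_iff by auto
      then have "- R \<noteq> {}" by auto
      then have "?s > 0" by (simp add: card_gt_0_iff)
      then have "?s / (2 * real m) < ?s / (2 * real n)"
        using assms \<open>n \<noteq> m\<close> by (intro divide_strict_left_mono) auto
      moreover have "?s / (2 * real n) = ?s / (2 * real m)"
        using eq unfolding q l by (simp only: ereal.inject add_left_cancel)
      ultimately show False by linarith
    qed
  next
    assume "n = m"
    then show "ereal (real (hexp R n + 1) / real (2 * n)) = lam" unfolding q l by simp
  qed
qed

section \<open>Threshold and multiplicity for any gluing of these charts\<close>

context
  fixes D :: "'d list \<Rightarrow> (real^'d) set" and \<phi> :: "'d list \<Rightarrow> real^'d \<Rightarrow> 'q"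
    and g :: "'q \<Rightarrow> real^'d" and T :: "'q set"
  assumes openD: "\<And>c. c \<in> blowup_charts R m \<Longrightarrow> open (D c)"
    and g: "\<And>c v. c \<in> blowup_charts R m \<Longrightarrow> v \<in> D c \<Longrightarrow> g (\<phi> c v) = chart_map R c v"
    and T: "T \<subseteq> (\<Union>c\<in>blowup_charts R m. \<phi> c ` D c)"
    and reg: "\<And>c v. c \<in> blowup_charts R m \<Longrightarrow> v \<in> D c \<Longrightarrow> \<phi> c v \<in> T \<Longrightarrow> regular_point c v"
begin

abbreviation "AT \<equiv> (\<lambda>c. (D c, \<phi> c)) ` blowup_charts R m"

lemma normal_crossing_exists:
  assumes c: "c \<in> blowup_charts R m" and v0: "v0 \<in> D c" and Q: "\<phi> c v0 \<in> T"
  shows "\<exists>k h. normal_crossing AT g K (\<phi> c v0) k h \<and>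
    ((\<exists>i. i \<notin> R \<and> c = replicate m i) \<or> R = UNIV \<longrightarrow> (\<exists>e. k e = 2 * m \<and> h e = hexp R m))"
proof -
  obtain A B k h i j where AB: "real_analytic_at A v0" "A v0 \<noteq> 0" "real_analytic_at B v0" "B v0 \<noteq> 0"
    and KA: "\<forall>\<^sub>F v in nhds v0. K (chart_map R c v) = A v * (\<Prod>l\<in>UNIV. v $ l ^ k l)"
    and J: "\<And>v. \<exists>D. (chart_map R c has_derivative (\<lambda>w. D *v w)) (at v) \<and> \<bar>det D\<bar> = \<bar>B v * (\<Prod>l\<in>UNIV. v $ l ^ h l)\<bar>"
    and k: "\<And>e. k e > 0 \<Longrightarrow> (e = i \<or> e = j) \<and> v0 $ e = 0" and h: "\<And>e. h e > 0 \<Longrightarrow> k e > 0"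
    and top: "(\<exists>i. i \<notin> R \<and> c = replicate m i) \<or> R = UNIV \<Longrightarrow> \<exists>e. k e = 2 * m \<and> h e = hexp R m"
    by (rule chart_local_form[OF c reg[OF c v0 Q]]) blast
  have "\<forall>\<^sub>F v in nhds v0. K (chart_map R c v) = A v * (\<Prod>l\<in>UNIV. v $ l ^ k l) \<and>
      real_analytic_at A v \<and> real_analytic_at B v \<and> v \<in> D c"
    using KA eventually_real_analytic_at[OF AB(1)] eventually_real_analytic_at[OF AB(3)]
      eventually_nhds_in_open[OF openD[OF c] v0] by eventually_elim simp
  then obtain U where U: "open U" "v0 \<in> U" and
    UA: "\<And>v. v \<in> U \<Longrightarrow> K (chart_map R c v) = A v * (\<Prod>l\<in>UNIV. v $ l ^ k l) \<and>
      real_analytic_at A v \<and> real_analytic_at B v \<and> v \<in> D c"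
    unfolding eventually_nhds by blast
  let ?V = "(\<lambda>v. v - v0) ` U" and ?\<psi> = "\<lambda>u. v0 + u"
  have VU: "u \<in> ?V \<longleftrightarrow> v0 + u \<in> U" for u by force
  \<comment> \<open>The exponents are supported on coordinates that vanish at v0, so centering the
    chart does not change the monomials.\<close>
  have prod_eq: "(\<Prod>l\<in>UNIV. (v0 + u) $ l ^ e l) = (\<Prod>l\<in>UNIV. u $ l ^ e l)"
    if "\<And>l. e l > 0 \<Longrightarrow> v0 $ l = 0" for e and u :: "real^'d"
    using that by (intro prod.cong refl) (metis add_0 neq0_conv power_0 vector_add_component)
  have oV: "open ?V" using analytic_diffeo_translation[OF U(1), of v0] by (simp add: analytic_diffeo_on_def)
  have "normal_crossing AT g K (\<phi> c v0) k h"
    unfolding normal_crossing_def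
  proof (rule bexI[of _ "(D c, \<phi> c)"], clarify, intro exI conjI ballI)
    show "analytic_diffeo_on ?\<psi> ?V" using U(1) by (rule analytic_diffeo_translation)
    show "?\<psi> ` ?V \<subseteq> D c" using UA by auto
    show "0 \<in> ?V" using U(2) by (simp add: VU)
    show "\<phi> c (?\<psi> 0) = \<phi> c v0" by simp
    show "real_analytic_on (\<lambda>u. A (v0 + u)) ?V" "real_analytic_on (\<lambda>u. B (v0 + u)) ?V"
      unfolding real_analytic_on_def using UA VU by (auto intro!: real_analytic_at_translate)
    show "A (v0 + 0) \<noteq> 0" "B (v0 + 0) \<noteq> 0" using AB by simp_all
    fix u assume u: "u \<in> ?V"
    then have uU: "v0 + u \<in> U" by (simp add: VU)
    show "K (g (\<phi> c (?\<psi> u))) = A (v0 + u) * (\<Prod>i\<in>UNIV. u $ i ^ k i)"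
      using UA[OF uU] g[OF c] prod_eq[of k u] k by simp
    obtain D' where D': "(chart_map R c has_derivative (\<lambda>w. D' *v w)) (at (v0 + u))"
      "\<bar>det D'\<bar> = \<bar>B (v0 + u) * (\<Prod>l\<in>UNIV. (v0 + u) $ l ^ h l)\<bar>" using J by blast
    have "((\<lambda>u. v0 + u) has_derivative (\<lambda>w. w)) (at u)" by (auto intro!: derivative_eq_intros)
    from has_derivative_compose[OF this D'(1)]
    have "((\<lambda>u. chart_map R c (v0 + u)) has_derivative (\<lambda>w. D' *v w)) (at u)" .
    then have "((g \<circ> \<phi> c \<circ> ?\<psi>) has_derivative (\<lambda>w. D' *v w)) (at u)"
      by (rule has_derivative_transform_within_open[OF _ oV u]) (use UA VU g[OF c] in auto)
    then have "jacobian (g \<circ> \<phi> c \<circ> ?\<psi>) (at u) = D'" by (rule jacobian_eq)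
    then show "\<bar>det (jacobian (g \<circ> \<phi> c \<circ> ?\<psi>) (at u))\<bar> = \<bar>B (v0 + u) * (\<Prod>i\<in>UNIV. u $ i ^ h i)\<bar>"
      using D'(2) prod_eq[of h u] h k by auto
  qed (use c in auto)
  then show ?thesis using top by blast
qed

text \<open>Exponents in arbitrary coordinates are among those of the chart, whose ratios are known.
  A ratio equal to \<open>lam\<close> means exponent 2m, and two of these would exceed the bound on
  the total exponent.\<close>

lemma normal_crossing_ratio:
  assumes nc: "normal_crossing AT g K Q k' h'" and Q: "Q \<in> T"
  shows "nc_ratio k' h' l \<ge> lam" and "card {l. nc_ratio k' h' l = lam} \<le> 1"
proof -
  obtain c V \<psi> a b where c: "c \<in> blowup_charts R m"
    and \<psi>: "analytic_diffeo_on \<psi> V" "\<psi> ` V \<subseteq> D c" "0 \<in> V" "\<phi> c (\<psi> 0) = Q"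
    and ab: "real_analytic_on a V" "real_analytic_on b V" "a 0 \<noteq> 0" "b 0 \<noteq> 0"
    and KJ: "\<And>u. u \<in> V \<Longrightarrow> K (g (\<phi> c (\<psi> u))) = a u * (\<Prod>i\<in>UNIV. u $ i ^ k' i)"
      "\<And>u. u \<in> V \<Longrightarrow> \<bar>det (jacobian (g \<circ> \<phi> c \<circ> \<psi>) (at u))\<bar> = \<bar>b u * (\<Prod>i\<in>UNIV. u $ i ^ h' i)\<bar>"
    using nc unfolding normal_crossing_def by auto
  have D0: "\<psi> 0 \<in> D c" using \<psi> by auto
  then have rp: "regular_point c (\<psi> 0)" using reg[OF c] \<psi>(4) Q by simp
  obtain A B k h i j where AB: "real_analytic_at A (\<psi> 0)" "A (\<psi> 0) \<noteq> 0" "real_analytic_at B (\<psi> 0)" "B (\<psi> 0) \<noteq> 0"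
    and KA: "\<forall>\<^sub>F v in nhds (\<psi> 0). K (chart_map R c v) = A v * (\<Prod>l\<in>UNIV. v $ l ^ k l)"
    and J: "\<And>v. \<exists>D. (chart_map R c has_derivative (\<lambda>w. D *v w)) (at v) \<and> \<bar>det D\<bar> = \<bar>B v * (\<Prod>l\<in>UNIV. v $ l ^ h l)\<bar>"
    and k: "\<And>e. k e > 0 \<Longrightarrow> (e = i \<or> e = j) \<and> \<psi> 0 $ e = 0" and h: "\<And>e. h e > 0 \<Longrightarrow> k e > 0"
    and kn: "\<And>e. k e > 0 \<Longrightarrow> \<exists>n. 1 \<le> n \<and> n \<le> m \<and> k e = 2 * n \<and> h e = hexp R n"
    and km: "(\<Sum>e\<in>UNIV. k e) < 4 * m"
    by (rule chart_local_form[OF c rp]) blast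
  have unit: "\<forall>\<^sub>F v in nhds (\<psi> 0). isCont f v \<and> f v \<noteq> 0" if f: "real_analytic_at f (\<psi> 0)" "f (\<psi> 0) \<noteq> 0" for f
  proof -
    have "\<forall>\<^sub>F u in nhds (\<psi> 0). isCont f u"
      using eventually_real_analytic_at[OF f(1)] by eventually_elim (rule real_analytic_at_isCont)
    moreover have "\<forall>\<^sub>F u in nhds (\<psi> 0). f u \<noteq> 0"
      using continuous_at_avoid[OF real_analytic_at_isCont[OF f(1)] f(2)] by (auto simp: eventually_nhds_metric dist_commute)
    ultimately show ?thesis by eventually_elim simp
  qed
  let ?J = "\<lambda>v. det (jacobian (chart_map R c) (at v))"
  have jac: "(chart_map R c has_derivative (\<lambda>w. jacobian (chart_map R c) (at v) *v w)) (at v)"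
    and detJ: "\<bar>?J v\<bar> = \<bar>B v * (\<Prod>l\<in>UNIV. v $ l ^ h l)\<bar>" for v
    using J[of v] jacobian_eq by auto
  have JJ: "?J (\<psi> u) * det (Dmat \<psi> u) = det (jacobian (g \<circ> \<phi> c \<circ> \<psi>) (at u))" if u: "u \<in> V" for u
  proof -
    have "(\<psi> has_derivative (\<lambda>w. Dmat \<psi> u *v w)) (at u)"
      by (rule analytic_has_derivative) (rule analytic_diffeoD(4)[OF \<psi>(1) u])
    from has_derivative_compose[OF this jac]
    have "((\<lambda>u. chart_map R c (\<psi> u)) has_derivative (\<lambda>w. (jacobian (chart_map R c) (at (\<psi> u)) ** Dmat \<psi> u) *v w)) (at u)"
      by (simp add: matrix_vector_mul_assoc)
    then have "((g \<circ> \<phi> c \<circ> \<psi>) has_derivative (\<lambda>w. (jacobian (chart_map R c) (at (\<psi> u)) ** Dmat \<psi> u) *v w)) (at u)"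
      by (rule has_derivative_transform_within_open[OF _ analytic_diffeoD(1)[OF \<psi>(1)] u]) (use \<psi>(2) g[OF c] in auto)
    from jacobian_eq[OF this] show ?thesis by (simp add: det_mul)
  qed
  have evJ: "\<forall>\<^sub>F v in nhds (\<psi> 0). \<bar>?J v\<bar> = \<bar>B v * (\<Prod>l\<in>UNIV. v $ l ^ h l)\<bar>"
    using detJ by (intro always_eventually allI)
  have KH: "K (chart_map R c (\<psi> u)) = a u * (\<Prod>l\<in>UNIV. u $ l ^ k' l)" if "u \<in> V" for u
  proof -
    have "\<psi> u \<in> D c" using \<psi>(2) that by auto
    then show ?thesis using KJ(1)[OF that] g[OF c] by simp
  qed
  have JH: "\<bar>?J (\<psi> u) * det (Dmat \<psi> u)\<bar> = \<bar>b u * (\<Prod>l\<in>UNIV. u $ l ^ h' l)\<bar>" if "u \<in> V" for u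
    unfolding JJ[OF that] by (rule KJ(2)[OF that])
  have ab0: "real_analytic_at a 0" "real_analytic_at b 0" using ab(1,2) \<psi>(3) unfolding real_analytic_on_def by auto
  note cmp = nc_exponents_compare[OF \<psi>(1,3) KA unit[OF AB(1,2)] evJ unit[OF AB(3,4)] KH JH ab0 ab(3,4) k h]
  have main: "nc_ratio k' h' l \<ge> lam \<and> (nc_ratio k' h' l = lam \<longrightarrow> k' l = 2 * m)" for l
  proof (cases "k' l = 0")
    case True
    then show ?thesis by (simp add: nc_ratio_def lam_def)
  next
    case False
    then obtain e where e: "k e > 0" "k' l = k e" "h' l = h e" using cmp(2) by auto
    obtain n where n: "1 \<le> n" "n \<le> m" "k e = 2 * n" "h e = hexp R n" using kn[OF e(1)] by blast
    have "nc_ratio k' h' l = ereal (real (hexp R n + 1) / real (2 * n))"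
      using False e n by (simp add: nc_ratio_def)
    then show ?thesis using hexp_ratio[OF n(1,2)] e n by simp
  qed
  then show "nc_ratio k' h' l \<ge> lam" by blast
  show "card {l. nc_ratio k' h' l = lam} \<le> 1"
  proof (rule ccontr)
    assume "\<not> card {l. nc_ratio k' h' l = lam} \<le> 1"
    then have "card {l. nc_ratio k' h' l = lam} \<ge> 2" by simp
    then have "2 * (2 * m) \<le> card {l. nc_ratio k' h' l = lam} * (2 * m)" by (rule mult_le_mono1)
    also have "\<dots> = (\<Sum>l\<in>{l. nc_ratio k' h' l = lam}. k' l)" using main by simp
    also have "\<dots> \<le> (\<Sum>l\<in>UNIV. k' l)" by (intro sum_mono2) auto
    finally show False using cmp(1) km by simp
  qed
qed

text \<open>The lower bound holds at every point; it is attained at a point of a chart whose only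
  exceptional weight is m. For \<open>R = UNIV\<close> every chart is of this kind, because m =
  1.\<close>

lemma nc_threshold_multiplicity:
  assumes Q: "Q \<in> T" "c \<in> blowup_charts R m" "v \<in> D c" "Q = \<phi> c v"
    and c: "(\<exists>i. i \<notin> R \<and> c = replicate m i) \<or> R = UNIV"
  shows "nc_threshold AT g K T = lam" "nc_multiplicity AT g K T = 1"
proof -
  obtain k h e where kh: "normal_crossing AT g K Q k h" "k e = 2 * m" "h e = hexp R m"
    using normal_crossing_exists[OF Q(2,3)] Q(1,4) c by blast
  have ke: "nc_ratio k h e = lam"
    using kh m1 hexp_ratio(2)[OF m1 order_refl] by (simp add: nc_ratio_def)
  have mem: "(k, h) \<in> nc_exponents AT g K T" using kh(1) Q(1) unfolding nc_exponents_def by blast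
  have low: "Min (range (nc_ratio k' h')) \<ge> lam" "card {l. nc_ratio k' h' l = lam} \<le> 1"
    if "(k', h') \<in> nc_exponents AT g K T" for k' h'
    using that normal_crossing_ratio unfolding nc_exponents_def by auto
  have "Min (range (nc_ratio k h)) \<le> nc_ratio k h e" by simp
  then have "Min (range (nc_ratio k h)) = lam" using low(1)[OF mem] ke by (simp add: antisym)
  then have "nc_threshold AT g K T \<le> lam"
    unfolding nc_threshold_def by (intro INF_lower2[OF mem]) simp
  moreover have "nc_threshold AT g K T \<ge> lam"
    unfolding nc_threshold_def by (intro INF_greatest) (use low(1) in auto)
  ultimately show th: "nc_threshold AT g K T = lam" by (rule antisym)
  let ?C = "(\<lambda>(k, h). card {i. nc_ratio k h i = lam}) ` nc_exponents AT g K T"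
  \<comment> \<open>The set of exponents may be infinite; the cardinalities form a finite set
    because they are at most 1, so that \<open>Max\<close> is meaningful.\<close>
  have sub: "?C \<subseteq> {0, 1}" using low(2) by fastforce
  have "e \<in> {l. nc_ratio k h l = lam}" using ke by simp
  then have "card {l. nc_ratio k h l = lam} \<noteq> 0" by (metis card_eq_0_iff empty_iff finite)
  then have "card {l. nc_ratio k h l = lam} = 1" using low(2)[OF mem] by linarith
  then have "1 \<in> ?C" using mem by (metis (mono_tags, lifting) case_prod_conv image_iff)
  moreover have "finite ?C" using sub by (rule finite_subset) simp
  ultimately have "Max ?C = 1" using sub by (intro Max_eqI) auto
  then show "nc_multiplicity AT g K T = 1" unfolding nc_multiplicity_def th .
qed

end

end

section \<open>The glued charts\<close>

context semiregular
begin

lemma isCont_chart_map: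
  assumes "c \<in> blowup_charts R m"
  shows "isCont (chart_map R c) v"
proof -
  obtain E N' where "chart_data R m c E N'" using assms blowup_charts_iff[OF m1] by blast
  then obtain D where "(chart_map R c has_derivative (\<lambda>w. D *v w)) (at v)"
    using chart_map_has_derivative[OF _ m1] by blast
  then show ?thesis by (rule has_derivative_continuous)
qed

lemma continuous_on_chart_map [continuous_intros]:
  assumes "c \<in> blowup_charts R m" "continuous_on S f"
  shows "continuous_on S (\<lambda>x. chart_map R c (f x))"
proof -
  have "continuous_on UNIV (chart_map R c)"
    using isCont_chart_map[OF assms(1)] by (intro continuous_at_imp_continuous_on) auto
  then show ?thesis using assms(2) by (rule continuous_on_compose2) auto
qed

text \<open>A small positive multiple of the all-ones vector makes every coordinate nonzero. Thus
  each chart point is a limit of points not lying over the origin, and closed statements proved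
  there extend to it.\<close>

lemma eventually_chart_map_nonzero:
  assumes "c \<in> blowup_charts R m"
  shows "\<forall>\<^sub>F t in at_right 0. chart_map R c (v + t *\<^sub>R 1) \<noteq> 0"
proof -
  obtain E N' where cd: "chart_data R m c E N'" using assms blowup_charts_iff[OF m1] by blast
  have "\<forall>\<^sub>F t :: real in at_right 0. v $ l + t \<noteq> 0" for l
  proof (cases "v $ l = 0")
    case True
    have "\<forall>\<^sub>F t :: real in at_right 0. t > 0" by (simp add: eventually_at_right_less)
    then show ?thesis by eventually_elim (use True in simp)
  next
    case False
    have "((\<lambda>t. v $ l + t) \<longlongrightarrow> v $ l) (at_right 0)" by (auto intro!: tendsto_eq_intros)
    then show ?thesis using False by (rule tendsto_imp_eventually_ne)
  qed
  then have "\<forall>\<^sub>F t :: real in at_right 0. \<forall>l. v $ l + t \<noteq> 0" by (rule eventually_all_finite)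
  then show ?thesis
  proof eventually_elim
    case (elim t)
    show ?case
    proof
      assume "chart_map R c (v + t *\<^sub>R 1) = 0"
      then obtain l where "(v + t *\<^sub>R 1) $ l = 0"
        using mono_map_eq_0_imp[of R E N'] chart_data_nonempty[OF cd] chart_map_eq_mono_map[OF cd m1] by metis
      then show False using elim by simp
    qed
  qed
qed

lemma tendsto_diagonal: "((\<lambda>t :: real. v + t *\<^sub>R 1) \<longlongrightarrow> (v :: real^'d)) (at_right 0)"
  by (auto intro!: tendsto_eq_intros)

text \<open>The way to use gluing: a closed relation only has to be checked for chart points with
  the same image off the origin.\<close>

lemma glued_closed:
  assumes "glued R (c, u) (c', u')" "closed S"
    and "\<And>v v'. chart_map R c v = chart_map R c' v' \<Longrightarrow> chart_map R c v \<noteq> 0 \<Longrightarrow> (v, v') \<in> S"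
  shows "(u, u') \<in> S"
proof -
  have "closure {(v, v'). chart_map R c v = chart_map R c' v' \<and> chart_map R c v \<noteq> 0} \<subseteq> S"
    using assms(2,3) by (intro closure_minimal) auto
  then show ?thesis using assms(1) unfolding glued_def by auto
qed

lemma glued_refl:
  assumes c: "c \<in> blowup_charts R m"
  shows "glued R (c, u) (c, u)"
proof -
  let ?S = "{(v, v'). chart_map R c v = chart_map R c v' \<and> chart_map R c v \<noteq> 0}"
  have "\<forall>\<^sub>F t in at_right 0. (u + t *\<^sub>R 1, u + t *\<^sub>R 1) \<in> closure ?S"
    using eventually_chart_map_nonzero[OF c, of u]
    by eventually_elim (intro subsetD[OF closure_subset], simp)
  moreover have "((\<lambda>t :: real. (u + t *\<^sub>R 1, u + t *\<^sub>R 1)) \<longlongrightarrow> (u, u)) (at_right 0)"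
    by (intro tendsto_Pair tendsto_diagonal)
  ultimately have "(u, u) \<in> closure ?S"
    by (rule Lim_in_closed_set[OF closed_closure _ trivial_limit_at_right_real])
  then show ?thesis unfolding glued_def by simp
qed

lemma glued_chart_map_eq:
  assumes "c \<in> blowup_charts R m" "c' \<in> blowup_charts R m" "glued R (c, u) (c', u')"
  shows "chart_map R c u = chart_map R c' u'"
proof -
  have "closed {x. chart_map R c (fst x) = chart_map R c' (snd x)}"
    using assms(1,2) by (intro closed_Collect_eq continuous_intros)
  from glued_closed[OF assms(3) this] show ?thesis by simp
qed

text \<open>All representatives of a point have the same image, so the description by
  \<open>THE\<close> is meaningful.\<close>

lemma blowup_map_point:
  assumes c: "c \<in> blowup_charts R m"
  shows "blowup_map R (blowup_point R m c v) = chart_map R c v"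
  unfolding blowup_map_def
proof (rule the_equality)
  show "\<exists>(c', u)\<in>blowup_point R m c v. chart_map R c v = chart_map R c' u"
    using c glued_refl[OF c] unfolding blowup_point_def by (auto intro!: bexI[of _ "(c, v)"])
  fix \<theta> assume "\<exists>(c', u)\<in>blowup_point R m c v. \<theta> = chart_map R c' u"
  then show "\<theta> = chart_map R c v" using glued_chart_map_eq[OF c] unfolding blowup_point_def by auto
qed

section \<open>The fibre over the origin outside the degenerate points\<close>

abbreviation "TU \<equiv> fiber_over_origin R m - degenerate_points N X p R m"

lemma TU_subset: "TU \<subseteq> (\<Union>c\<in>blowup_charts R m. blowup_point R m c ` UNIV)"
  unfolding fiber_over_origin_def atlas_points_def blowup_atlas_def by auto

lemma TU_regular:
  assumes c: "c \<in> blowup_charts R m" and Q: "blowup_point R m c v \<in> TU"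
  shows "regular_point c v"
proof -
  have "chart_map R c v = 0"
    using Q blowup_map_point[OF c] unfolding fiber_over_origin_def by simp
  moreover have "blowup_point R m c v \<in> degenerate_points N X p R m"
    if "i \<notin> R" "c = replicate m i" "\<forall>k\<in>R. v $ k = 0" "v $ i = 0"
      "AE \<omega> in N. taylor_form (lr \<omega>) m (- R) (\<chi> k. if k = i then 1 else v $ k) = 0" for i
    using that unfolding degenerate_points_def by blast
  ultimately show ?thesis using Q unfolding regular_point_def by blast
qed

lemma in_TU:
  assumes "c \<in> blowup_charts R m" "chart_map R c v = 0" "blowup_point R m c v \<notin> degenerate_points N X p R m"
  shows "blowup_point R m c v \<in> TU"
  using assms blowup_map_point[OF assms(1), of v]
  unfolding fiber_over_origin_def atlas_points_def blowup_atlas_def by auto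

text \<open>The infimum has to be attained outside the degenerate points. On the exceptional
  hypersurface of a top chart, the point with a coordinate j of \<open>R\<close> equal to 1 is
  suitable, since degenerate points have zero coordinates in \<open>R\<close>; it must also be shown
  not to be glued to one in another chart.\<close>

lemma TU_top:
  obtains c v where "c \<in> blowup_charts R m" "blowup_point R m c v \<in> TU"
    and "(\<exists>i. i \<notin> R \<and> c = replicate m i) \<or> R = UNIV"
proof (cases "R = UNIV")
  case True
  then have "m = 1" using m_eq_1_iff by simp
  obtain j where "j \<in> R" using R by blast
  then have "chart_data R m [j] {j} (\<lambda>e. if e \<in> R then 0 + 1 else 0)"
    unfolding chart_data_def using m1 by (intro disjI2 exI[of _ j] exI[of _ 0]) auto
  then have c: "[j] \<in> blowup_charts R m" using blowup_charts_iff[OF m1] by blast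
  have "chart_map R [j] 0 = 0" by (simp add: blowup_chart_def vec_eq_iff)
  moreover have "degenerate_points N X p R m = {}" using True by (simp add: degenerate_points_def)
  ultimately have "blowup_point R m [j] 0 \<in> TU" using in_TU[OF c] by blast
  then show thesis using that c True by blast
next
  case False
  then obtain i where i: "i \<notin> R" by blast
  obtain j where j: "j \<in> R" using R by blast
  let ?c = "replicate m i" and ?v = "axis j 1 :: real^'d"
  have c: "?c \<in> blowup_charts R m" using i by (rule replicate_in_blowup_charts)
  have ij: "i \<noteq> j" using i j by blast
  have cm: "chart_map R (replicate m i) u = (\<chi> k. if k = i then u $ i else if k \<in> R then u $ i ^ m * u $ k else u $ i * u $ k)"
    if "i \<notin> R" for i u using chart_map_replicate[OF that m1] .
  have "chart_map R ?c ?v = 0" using ij m1 by (auto simp: cm[OF i] vec_eq_iff axis_def)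
  moreover have "blowup_point R m ?c ?v \<notin> degenerate_points N X p R m"
  proof
    assume "blowup_point R m ?c ?v \<in> degenerate_points N X p R m"
    then obtain i' u' where i': "i' \<notin> R" "\<forall>k\<in>R. u' $ k = 0" "u' $ i' = 0"
      "blowup_point R m ?c ?v = blowup_point R m (replicate m i') u'"
      unfolding degenerate_points_def by blast
    have c': "replicate m i' \<in> blowup_charts R m" using i'(1) by (rule replicate_in_blowup_charts)
    have "(replicate m i', u') \<in> blowup_point R m (replicate m i') u'"
      using c' glued_refl[OF c'] unfolding blowup_point_def by blast
    then have gl: "glued R (?c, ?v) (replicate m i', u')"
      unfolding i'(4)[symmetric] by (auto simp: blowup_point_def)
    show False
    proof (cases "i' = i")
      case True
      \<comment> \<open>In the same chart the j-th coordinate is preserved by gluing; it is 1 on one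
        side and 0 on the other.\<close>
      have "closed {x :: (real^'d) \<times> (real^'d). fst x $ j = snd x $ j}"
        by (intro closed_Collect_eq continuous_intros)
      then have "(?v, u') \<in> {x :: (real^'d) \<times> (real^'d). fst x $ j = snd x $ j}"
      proof (rule glued_closed[OF gl])
        fix v v' :: "real^'d" assume eq: "chart_map R (replicate m i) v = chart_map R (replicate m i') v'"
          and nz: "chart_map R (replicate m i) v \<noteq> 0"
        have "v $ i = v' $ i" "v $ i ^ m * v $ j = v' $ i ^ m * v' $ j"
          using arg_cong[OF eq, of "\<lambda>w. w $ i"] arg_cong[OF eq, of "\<lambda>w. w $ j"] i j ij
          by (simp_all add: True cm)
        moreover have "v $ i \<noteq> 0" using nz m1 by (auto simp: cm[OF i] vec_eq_iff power_0_left split: if_splits)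
        ultimately show "(v, v') \<in> {x. fst x $ j = snd x $ j}" by simp
      qed
      then show False using i'(2) j by (simp add: axis_def)
    next
      case False
      \<comment> \<open>Between the top charts of i and i' gluing preserves v_i' v'_i = 1, but v_i'
        is 0 at the chosen point.\<close>
      have "closed {x :: (real^'d) \<times> (real^'d). fst x $ i' * snd x $ i = 1}"
        by (intro closed_Collect_eq continuous_intros)
      then have "(?v, u') \<in> {x :: (real^'d) \<times> (real^'d). fst x $ i' * snd x $ i = 1}"
      proof (rule glued_closed[OF gl])
        fix v v' :: "real^'d" assume eq: "chart_map R (replicate m i) v = chart_map R (replicate m i') v'"
          and nz: "chart_map R (replicate m i) v \<noteq> 0"
        have "v $ i = v' $ i' * v' $ i" "v $ i * v $ i' = v' $ i'"
          using arg_cong[OF eq, of "\<lambda>w. w $ i"] arg_cong[OF eq, of "\<lambda>w. w $ i'"] i i' False by (simp_all add: cm)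
        moreover have "v $ i \<noteq> 0" using nz m1 by (auto simp: cm[OF i] vec_eq_iff power_0_left split: if_splits)
        ultimately have "v' $ i' \<noteq> 0" "v' $ i' * (v $ i' * v' $ i) = v' $ i'" by (auto simp: mult_ac)
        then show "(v, v') \<in> {x. fst x $ i' * snd x $ i = 1}" by simp
      qed
      then show False using i'(1) j by (auto simp: axis_def split: if_splits)
    qed
  qed
  ultimately show thesis using that in_TU[OF c] c i by blast
qed

lemma blowup_atlas_eq: "blowup_atlas R m = (\<lambda>c. (UNIV, blowup_point R m c)) ` blowup_charts R m"
  by (simp add: blowup_atlas_def)

lemma blowup_normal_crossings:
  shows "\<forall>Q\<in>TU. \<exists>k h. normal_crossing (blowup_atlas R m) (blowup_map R) K Q k h"
    and "nc_threshold (blowup_atlas R m) (blowup_map R) K TU = lam"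
    and "nc_multiplicity (blowup_atlas R m) (blowup_map R) K TU = 1"
proof -
  note args = open_UNIV blowup_map_point TU_subset TU_regular
  show "\<forall>Q\<in>TU. \<exists>k h. normal_crossing (blowup_atlas R m) (blowup_map R) K Q k h"
  proof
    fix Q assume Q: "Q \<in> TU"
    then obtain c v where c: "c \<in> blowup_charts R m" "Q = blowup_point R m c v" using TU_subset by blast
    then show "\<exists>k h. normal_crossing (blowup_atlas R m) (blowup_map R) K Q k h"
      using normal_crossing_exists[OF args c(1), of v] Q unfolding blowup_atlas_eq by auto
  qed
  obtain c v where cv: "c \<in> blowup_charts R m" "blowup_point R m c v \<in> TU"
    and top: "(\<exists>i. i \<notin> R \<and> c = replicate m i) \<or> R = UNIV" by (rule TU_top)
  show "nc_threshold (blowup_atlas R m) (blowup_map R) K TU = lam"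
    "nc_multiplicity (blowup_atlas R m) (blowup_map R) K TU = 1"
    using nc_threshold_multiplicity[OF args cv(2,1) UNIV_I refl top] unfolding blowup_atlas_eq by auto
qed

end

section \<open>Zeros near the origin\<close>

text \<open>The zero vector is included: division by zero yields 0, and the chart map sends 0 to
  0.\<close>

lemma mono_map_inverse_1:
  fixes \<theta> :: "real^'d::finite"
  assumes "i \<notin> R" "\<theta> $ i = 0 \<Longrightarrow> \<theta> = 0" "m \<ge> 1"
  shows "mono_map R {i} (\<lambda>_. m) (\<chi> k. if k = i then \<theta> $ i else if k \<in> R then \<theta> $ k / \<theta> $ i ^ m else \<theta> $ k / \<theta> $ i) = \<theta>"
proof (cases "\<theta> $ i = 0")
  case True
  then show ?thesis using assms by (auto simp: mono_map_def vec_eq_iff Wt_def)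
next
  case False
  then show ?thesis using assms by (auto simp: mono_map_def vec_eq_iff Wt_def)
qed

lemma mono_map_inverse_2:
  fixes \<theta> :: "real^'d::finite"
  assumes "j \<in> R" "\<theta> $ j \<noteq> 0"
  shows "mono_map R {j} (\<lambda>e. if e \<in> R then 1 else 0) (\<chi> k. if k = j then \<theta> $ j else \<theta> $ k / \<theta> $ j) = \<theta>"
  using assms by (auto simp: mono_map_def vec_eq_iff Wt_def)

text \<open>The exceptional coordinates a, b solve a b = \<theta>_i and a^n b^(n + 1) =
  \<theta>_j.\<close>

lemma mono_map_inverse_3:
  fixes \<theta> :: "real^'d::finite"
  assumes "j \<in> R" "i \<notin> R" "\<theta> $ j \<noteq> 0" "\<theta> $ i \<noteq> 0"
  shows "mono_map R {i, j} (\<lambda>e. if e \<in> R then n + 1 else n)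
    (\<chi> k. if k = i then \<theta> $ i ^ (n + 1) / \<theta> $ j else if k = j then \<theta> $ j / \<theta> $ i ^ n
          else if k \<in> R then \<theta> $ k / \<theta> $ j else \<theta> $ k / \<theta> $ i) = \<theta>"
proof -
  have ij: "i \<noteq> j" using assms by blast
  define a b where "a = \<theta> $ i ^ (n + 1) / \<theta> $ j" and "b = \<theta> $ j / \<theta> $ i ^ n"
  have 1: "a * b = \<theta> $ i" using assms by (simp add: a_def b_def)
  have "a ^ n * b ^ (n + 1) = (a * b) ^ n * b" by (simp add: power_mult_distrib mult_ac)
  also have "\<dots> = \<theta> $ j" unfolding 1 using assms by (simp add: b_def)
  finally have 2: "a ^ n * b ^ (n + 1) = \<theta> $ j" .
  let ?v = "\<chi> k. if k = i then a else if k = j then b else if k \<in> R then \<theta> $ k / \<theta> $ j else \<theta> $ k / \<theta> $ i"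
  have "mono_map R {i, j} (\<lambda>e. if e \<in> R then n + 1 else n) ?v $ k = \<theta> $ k" for k
  proof -
    have "(\<Prod>e\<in>{i, j}. ?v $ e ^ Wt R (if e \<in> R then n + 1 else n) k) = (if k \<in> R then \<theta> $ j else \<theta> $ i)"
      using ij assms(1,2) 1 2 by (simp add: Wt_def)
    then show ?thesis using assms ij by (auto simp: mono_map_def)
  qed
  then show ?thesis unfolding a_def b_def vec_eq_iff by blast
qed

context semiregular
begin

text \<open>Compare the largest modulus |\<theta>_j| in \<open>R\<close> with the powers of the
  largest modulus s outside \<open>R\<close>. The position of |\<theta>_j| among 1, s, ..., s^m
  selects the chart, and these inequalities say precisely that its coordinates are at most 1 in
  modulus.\<close>

lemma chart_cube_cover:
  assumes \<theta>: "\<And>k. \<bar>\<theta> $ k\<bar> \<le> 1"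
  shows "\<exists>c\<in>blowup_charts R m. \<exists>v. (\<forall>l. \<bar>v $ l\<bar> \<le> 1) \<and> chart_map R c v = \<theta>"
proof -
  have argmax: "\<exists>i\<in>A. \<forall>k\<in>A. \<bar>\<theta> $ k\<bar> \<le> \<bar>\<theta> $ i\<bar>" if "A \<noteq> {}" for A
  proof -
    have "Max ((\<lambda>k. \<bar>\<theta> $ k\<bar>) ` A) \<in> (\<lambda>k. \<bar>\<theta> $ k\<bar>) ` A" using that by (intro Max_in) auto
    then obtain i where i: "i \<in> A" "Max ((\<lambda>k. \<bar>\<theta> $ k\<bar>) ` A) = \<bar>\<theta> $ i\<bar>" by auto
    have "\<bar>\<theta> $ k\<bar> \<le> Max ((\<lambda>k. \<bar>\<theta> $ k\<bar>) ` A)" if "k \<in> A" for k using that by (intro Max_ge) auto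
    then show ?thesis using i by auto
  qed
  obtain j where j: "j \<in> R" "\<And>k. k \<in> R \<Longrightarrow> \<bar>\<theta> $ k\<bar> \<le> \<bar>\<theta> $ j\<bar>" using argmax[OF R] by blast
  define s where "s = (if R = UNIV then 0 else Max ((\<lambda>k. \<bar>\<theta> $ k\<bar>) ` (- R)))"
  have s_ge: "\<bar>\<theta> $ k\<bar> \<le> s" if "k \<notin> R" for k using that by (auto simp: s_def)
  have s0: "s \<ge> 0"
  proof (cases "R = UNIV")
    case False
    then obtain k where "k \<notin> R" by blast
    then show ?thesis using s_ge[of k] by linarith
  qed (simp add: s_def)
  have s_at: "\<exists>i. i \<notin> R \<and> \<bar>\<theta> $ i\<bar> = s" if "R \<noteq> UNIV"
  proof -
    have "Max ((\<lambda>k. \<bar>\<theta> $ k\<bar>) ` (- R)) \<in> (\<lambda>k. \<bar>\<theta> $ k\<bar>) ` (- R)" using that by (intro Max_in) auto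
    then show ?thesis using that by (auto simp: s_def)
  qed
  have fin: ?thesis if "chart_data R m c E N'" "\<And>l. \<bar>v $ l\<bar> \<le> 1" "mono_map R E N' v = \<theta>" for c E N' v
    using that blowup_charts_iff[OF m1] chart_map_eq_mono_map[OF _ m1] by metis
  have div_le: "\<bar>a\<bar> / \<bar>b\<bar> \<le> 1" if "\<bar>a\<bar> \<le> \<bar>b\<bar>" for a b :: real
    using that by (cases "b = 0") (auto simp: abs_divide)
  \<comment> \<open>In order: a top chart, the chart of j alone, a chart with two exceptional
    coordinates, and the zero vector when nothing lies outside \<open>R\<close>.\<close>
  consider "R \<noteq> UNIV" "\<bar>\<theta> $ j\<bar> \<le> s ^ m" | "\<theta> $ j \<noteq> 0" "s < \<bar>\<theta> $ j\<bar>" | n where "1 \<le> n" "n < m" "s ^ (n + 1) < \<bar>\<theta> $ j\<bar>" "\<bar>\<theta> $ j\<bar> \<le> s ^ n"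
    | "R = UNIV" "\<theta> $ j = 0"
  proof (cases "\<bar>\<theta> $ j\<bar> \<le> s ^ m")
    case True
    show thesis
    proof (cases "R = UNIV")
      case True
      then have "s = 0" by (simp add: s_def)
      then have "s ^ m = 0" using m1 by (cases m) auto
      then have "\<theta> $ j = 0" using \<open>\<bar>\<theta> $ j\<bar> \<le> s ^ m\<close> by linarith
      then show thesis using that(4) True by blast
    qed (use that(1) True in blast)
  next
    case False
    \<comment> \<open>The least exponent is positive because s^0 = 1 bounds |\<theta>_j|; its
      predecessor n satisfies s^(n + 1) < |\<theta>_j| <= s^n.\<close>
    define n' where "n' = (LEAST n. s ^ n < \<bar>\<theta> $ j\<bar>)"
    have ex: "s ^ m < \<bar>\<theta> $ j\<bar>" using False by simp
    have lt: "s ^ n' < \<bar>\<theta> $ j\<bar>" unfolding n'_def by (rule LeastI[of _ m]) (rule ex)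
    have le: "n' \<le> m" unfolding n'_def by (rule Least_le) (rule ex)
    have "n' \<noteq> 0" using lt \<theta>[of j] by (cases n') auto
    then obtain n where n: "n' = Suc n" by (cases n') auto
    have "\<not> s ^ n < \<bar>\<theta> $ j\<bar>" using not_less_Least[of n "\<lambda>n. s ^ n < \<bar>\<theta> $ j\<bar>"] n unfolding n'_def[symmetric] by simp
    then have ge: "\<bar>\<theta> $ j\<bar> \<le> s ^ n" by simp
    show thesis
    proof (cases "n = 0")
      case True
      then have "s < \<bar>\<theta> $ j\<bar>" using lt n by simp
      then show thesis using that(2) s0 by force
    next
      case False
      then show thesis using that(3)[of n] lt le ge n by simp
    qed
  qed
  then show ?thesis
  proof cases
    case 1
    obtain i where i: "i \<notin> R" "\<bar>\<theta> $ i\<bar> = s" using s_at[OF 1(1)] by blast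
    let ?v = "\<chi> k. if k = i then \<theta> $ i else if k \<in> R then \<theta> $ k / \<theta> $ i ^ m else \<theta> $ k / \<theta> $ i"
    have cd: "chart_data R m (replicate m i) {i} (\<lambda>_. m)" unfolding chart_data_def using i by blast
    have le: "\<bar>?v $ l\<bar> \<le> 1" for l
    proof -
      have "\<bar>\<theta> $ l\<bar> \<le> \<bar>\<theta> $ i ^ m\<bar>" if "l \<in> R" using j(2)[OF that] 1 i by (simp add: power_abs)
      moreover have "\<bar>\<theta> $ l\<bar> \<le> \<bar>\<theta> $ i\<bar>" if "l \<notin> R" using s_ge[OF that] i by simp
      ultimately show ?thesis using \<theta> by (auto simp: abs_divide intro: div_le)
    qed
    have "\<theta> = 0" if "\<theta> $ i = 0"
    proof -
      have "s = 0" using that i by simp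
      then have "\<bar>\<theta> $ k\<bar> \<le> 0" for k
        using s_ge[of k] j(2)[of k] 1(2) m1 by (cases "k \<in> R") (auto simp: power_0_left)
      then show ?thesis by (simp add: vec_eq_iff)
    qed
    then have "mono_map R {i} (\<lambda>_. m) ?v = \<theta>" using i m1 by (intro mono_map_inverse_1) auto
    then show ?thesis using fin[OF cd le] by blast
  next
    case 2
    let ?v = "\<chi> k. if k = j then \<theta> $ j else \<theta> $ k / \<theta> $ j"
    have cd: "chart_data R m (j # replicate 0 j) {j} (\<lambda>e. if e \<in> R then 1 else 0)"
      unfolding chart_data_def using j m1 by (intro disjI2 exI[of _ j] exI[of _ 0]) auto
    have "\<bar>?v $ l\<bar> \<le> 1" for l
      using \<theta> j(2)[of l] s_ge[of l] 2 by (cases "l \<in> R") (auto simp: abs_divide intro!: div_le)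
    then show ?thesis using fin[OF cd] mono_map_inverse_2[OF j(1) 2(1)] by blast
  next
    case (3 n)
    have "s \<noteq> 0"
    proof
      assume "s = 0"
      then show False using 3 by (simp add: power_0_left)
    qed
    then have "R \<noteq> UNIV" by (auto simp: s_def)
    then obtain i where i: "i \<notin> R" "\<bar>\<theta> $ i\<bar> = s" using s_at by blast
    have "\<bar>\<theta> $ j\<bar> > 0" using 3(3) zero_le_power[OF s0, of "n + 1"] by linarith
    then have nz: "\<theta> $ i \<noteq> 0" "\<theta> $ j \<noteq> 0" using i \<open>s \<noteq> 0\<close> by auto
    let ?v = "\<chi> k. if k = i then \<theta> $ i ^ (n + 1) / \<theta> $ j else if k = j then \<theta> $ j / \<theta> $ i ^ n
          else if k \<in> R then \<theta> $ k / \<theta> $ j else \<theta> $ k / \<theta> $ i"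
    have cd: "chart_data R m (j # replicate n i) {i, j} (\<lambda>e. if e \<in> R then n + 1 else n)"
      unfolding chart_data_def using j i 3 by (intro disjI2 exI[of _ i] exI[of _ j] exI[of _ n]) auto
    have "\<bar>\<theta> $ i ^ (n + 1)\<bar> \<le> \<bar>\<theta> $ j\<bar>" "\<bar>\<theta> $ j\<bar> \<le> \<bar>\<theta> $ i ^ n\<bar>" using 3(3,4) i(2) by (simp_all only: power_abs less_imp_le)
    moreover have "\<bar>\<theta> $ l\<bar> \<le> \<bar>\<theta> $ i\<bar>" if "l \<notin> R" for l using s_ge[OF that] i by simp
    ultimately have "\<bar>?v $ l\<bar> \<le> 1" for l
      using j(2) by (simp add: abs_divide div_le)
    then show ?thesis using fin[OF cd] mono_map_inverse_3[OF j(1) i(1) nz(2,1)] by blast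
  next
    case 4
    have cd: "chart_data R m (j # replicate 0 j) {j} (\<lambda>e. if e \<in> R then 1 else 0)"
      unfolding chart_data_def using j m1 by (intro disjI2 exI[of _ j] exI[of _ 0]) auto
    have "\<theta> $ k = 0" for k using j(2)[of k] 4 by simp
    then have "mono_map R {j} (\<lambda>e. if e \<in> R then 1 else 0) 0 = \<theta>"
      using 4 by (simp add: mono_map_def vec_eq_iff Wt_def)
    then show ?thesis using fin[OF cd, of 0] by simp
  qed
qed

section \<open>The origin as an isolated zero of the divergence\<close>

lemma K_zero: "K 0 = 0"
  using kcoeff_zero by (simp add: kcoeff_def multi_deriv_0 mfact_pos[THEN less_imp_neq, symmetric])

lemma finite_blowup_charts: "finite (blowup_charts R m)"
proof -
  have "finite (blowup_charts R n)" for n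
  proof (induction n)
    case (Suc n)
    have "finite (if center_coords R c = {} then {c} else {j # c | j. j \<in> center_coords R c})" for c
      by simp
    then show ?case using Suc by simp
  qed simp
  then show ?thesis .
qed

context
  assumes ii: "\<forall>\<theta>. (\<exists>i. i \<notin> R \<and> \<theta> $ i \<noteq> 0) \<longrightarrow> form_independent N X p R m \<theta>"
begin

lemma all_points_regular:
  assumes "chart_map R c v = 0"
  shows "regular_point c v"
proof -
  have "\<not> (AE \<omega> in N. taylor_form (lr \<omega>) m (- R) \<theta> = 0)" if "i \<notin> R" "\<theta> $ i \<noteq> 0" for i \<theta>
  proof
    assume ae: "AE \<omega> in N. taylor_form (lr \<omega>) m (- R) \<theta> = 0"
    \<comment> \<open>An almost surely vanishing form would be a linear relation with coefficient 1,
      against independence.\<close>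
    define c where "c k = (case k of None \<Rightarrow> 1 | Some i \<Rightarrow> (0 :: real))" for k :: "'d option"
    let ?Y = "\<lambda>k \<omega>. case k of None \<Rightarrow> taylor_form (lr \<omega>) m (- R) \<theta> | Some i \<Rightarrow> partial_deriv i (lr \<omega>) 0"
    have "(\<Sum>k\<in>insert None (Some ` R). c k * ?Y k \<omega>) = taylor_form (lr \<omega>) m (- R) \<theta>" for \<omega>
      by (subst sum.insert) (auto simp: sum.reindex c_def)
    then have "AE \<omega> in N. (\<Sum>k\<in>insert None (Some ` R). c k * ?Y k \<omega>) = 0" using ae by simp
    then have "c None = 0" using ii that unfolding form_independent_def lin_indep_rvs_def by blast
    then show False by (simp add: c_def)
  qed
  then have "\<not> (AE \<omega> in N. taylor_form (lr \<omega>) m (- R) (\<chi> k. if k = i then 1 else v $ k) = 0)" if "i \<notin> R" for i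
    using that by simp
  then show ?thesis using assms unfolding regular_point_def by blast
qed

text \<open>K is a unit times a monomial in exceptional coordinates, and each of these vanishes only
  over the origin.\<close>

lemma zeros_in_chart:
  assumes c: "c \<in> blowup_charts R m" and "chart_map R c v0 = 0"
  shows "\<forall>\<^sub>F v in nhds v0. K (chart_map R c v) = 0 \<longrightarrow> chart_map R c v = 0"
proof -
  obtain A k where A: "real_analytic_at A v0" "A v0 \<noteq> 0"
    and KA: "\<forall>\<^sub>F v in nhds v0. K (chart_map R c v) = A v * (\<Prod>l\<in>UNIV. v $ l ^ k l)"
    and z: "\<And>e v. k e > 0 \<Longrightarrow> v $ e = 0 \<Longrightarrow> chart_map R c v = 0"
    by (rule chart_local_form[OF c all_points_regular[OF assms(2)]]) blast
  have "\<forall>\<^sub>F v in nhds v0. A v \<noteq> 0"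
    using continuous_at_avoid[OF real_analytic_at_isCont[OF A(1)] A(2)] by (auto simp: eventually_nhds_metric dist_commute)
  with KA show ?thesis
  proof eventually_elim
    case (elim v)
    show ?case
    proof
      assume "K (chart_map R c v) = 0"
      then have "(\<Prod>l\<in>UNIV. v $ l ^ k l) = 0" using elim by simp
      then obtain l where "v $ l = 0" "k l > 0" by (auto simp: prod_zero_iff)
      then show "chart_map R c v = 0" using z by blast
    qed
  qed
qed

text \<open>In the compact cube of a chart, the zeros of K not over the origin cannot accumulate at
  a point over it. Hence their images keep a positive distance from the origin. The finitely many
  cubes cover the unit cube below, so a smaller cube contains no further zero.\<close>

lemma K_zero_iff:
  "\<exists>\<epsilon>>0. \<epsilon> \<le> 1 \<and> (\<forall>\<theta>. (\<forall>k. \<bar>\<theta> $ k\<bar> < \<epsilon>) \<longrightarrow> (\<theta> \<in> W0 \<and> (K \<theta> = 0 \<longleftrightarrow> \<theta> = 0)))"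
proof -
  let ?C = "cbox (- 1) (1 :: real^'d)"
  have C: "v \<in> ?C \<longleftrightarrow> (\<forall>l. \<bar>v $ l\<bar> \<le> 1)" for v by (auto simp: mem_box_cart abs_le_iff minus_le_iff)
  define B where "B c = {v \<in> ?C. K (chart_map R c v) = 0 \<and> chart_map R c v \<noteq> 0}" for c
  have pos: "\<exists>\<delta>>0. \<forall>v\<in>B c. \<exists>k. \<bar>chart_map R c v $ k\<bar> \<ge> \<delta>" if c: "c \<in> blowup_charts R m" for c
  proof -
    have comp: "compact (closure (B c))"
      by (rule compact_closure[THEN iffD2], rule bounded_subset[of ?C]) (auto simp: B_def bounded_cbox)
    have nz: "chart_map R c v \<noteq> 0" if v: "v \<in> closure (B c)" for v
    proof
      assume "chart_map R c v = 0"
      then have "\<forall>\<^sub>F w in nhds v. K (chart_map R c w) = 0 \<longrightarrow> chart_map R c w = 0" by (rule zeros_in_chart[OF c])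
      then obtain U where U: "open U" "v \<in> U" "\<And>w. w \<in> U \<Longrightarrow> K (chart_map R c w) = 0 \<Longrightarrow> chart_map R c w = 0"
        unfolding eventually_nhds by blast
      then have "U \<inter> B c = {}" unfolding B_def by blast
      then show False using U v by (metis disjoint_iff open_Int_closure_eq_empty)
    qed
    have cont: "continuous_on (closure (B c)) (\<lambda>v. norm (chart_map R c v))"
      using c by (intro continuous_intros)
    show ?thesis
    proof (cases "closure (B c) = {}")
      case True
      then have "B c = {}" by simp
      then show ?thesis by (intro exI[of _ 1]) auto
    next
      case False
      then obtain v0 where v0: "v0 \<in> closure (B c)" "\<And>v. v \<in> closure (B c) \<Longrightarrow> norm (chart_map R c v0) \<le> norm (chart_map R c v)"
        using continuous_attains_inf[OF comp _ cont] by blast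
      \<comment> \<open>The norm is at most the sum of the absolute coordinates, so some coordinate
        is at least the minimal norm divided by d.\<close>
      define \<delta> where "\<delta> = norm (chart_map R c v0) / real CARD('d)"
      have "\<exists>k. \<bar>chart_map R c v $ k\<bar> \<ge> \<delta>" if "v \<in> B c" for v
      proof (rule ccontr)
        assume "\<nexists>k. \<delta> \<le> \<bar>chart_map R c v $ k\<bar>"
        then have "(\<Sum>k\<in>UNIV. \<bar>chart_map R c v $ k\<bar>) < (\<Sum>k\<in>(UNIV :: 'd set). \<delta>)"
          by (intro sum_strict_mono) (auto simp: not_le)
        moreover have "norm (chart_map R c v0) \<le> norm (chart_map R c v)"
          using that closure_subset by (intro v0(2)) blast
        moreover have "norm (chart_map R c v) \<le> (\<Sum>k\<in>UNIV. \<bar>chart_map R c v $ k\<bar>)" by (rule norm_le_l1_cart)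
        ultimately show False by (simp add: \<delta>_def)
      qed
      then show ?thesis using nz[OF v0(1)] by (intro exI[of _ \<delta>]) (auto simp: \<delta>_def)
    qed
  qed
  then obtain \<delta> where \<delta>: "\<And>c. c \<in> blowup_charts R m \<Longrightarrow> \<delta> c > 0"
    "\<And>c v. c \<in> blowup_charts R m \<Longrightarrow> v \<in> B c \<Longrightarrow> \<exists>k. \<bar>chart_map R c v $ k\<bar> \<ge> \<delta> c" by metis
  obtain e where e: "e > 0" "\<And>w. (\<And>i. \<bar>w $ i\<bar> < e) \<Longrightarrow> w \<in> W0" by (rule W0_box) blast
  define \<epsilon> where "\<epsilon> = Min (insert e (insert 1 (\<delta> ` blowup_charts R m)))"
  have \<epsilon>: "\<epsilon> > 0" "\<epsilon> \<le> 1" "\<epsilon> \<le> e" "\<And>c. c \<in> blowup_charts R m \<Longrightarrow> \<epsilon> \<le> \<delta> c"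
  proof -
    let ?M = "insert e (insert 1 (\<delta> ` blowup_charts R m))"
    have fin: "finite ?M" using finite_blowup_charts by simp
    show "\<epsilon> > 0" unfolding \<epsilon>_def using fin e(1) \<delta>(1) by (subst Min_gr_iff) auto
    show "\<epsilon> \<le> 1" "\<epsilon> \<le> e" unfolding \<epsilon>_def by (rule Min_le[OF fin], simp)+
    show "\<epsilon> \<le> \<delta> c" if "c \<in> blowup_charts R m" for c
      unfolding \<epsilon>_def by (rule Min_le[OF fin]) (use that in simp)
  qed
  have "\<theta> \<in> W0 \<and> (K \<theta> = 0 \<longleftrightarrow> \<theta> = 0)" if \<theta>: "\<forall>k. \<bar>\<theta> $ k\<bar> < \<epsilon>" for \<theta>
  proof -
    have "\<theta> \<in> W0" using \<theta> \<epsilon>(3) by (intro e(2)) (meson order_less_le_trans)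
    moreover have "\<theta> = 0" if "K \<theta> = 0"
    proof (rule ccontr)
      assume "\<theta> \<noteq> 0"
      have "\<And>k. \<bar>\<theta> $ k\<bar> \<le> 1" using \<theta> \<epsilon>(2) by (meson less_imp_le order_less_le_trans)
      then obtain c v where cv: "c \<in> blowup_charts R m" "\<forall>l. \<bar>v $ l\<bar> \<le> 1" "chart_map R c v = \<theta>"
        using chart_cube_cover by blast
      then have "v \<in> B c" using that \<open>\<theta> \<noteq> 0\<close> C unfolding B_def by auto
      then obtain k where "\<bar>\<theta> $ k\<bar> \<ge> \<delta> c" using \<delta>(2)[OF cv(1)] cv(3) by blast
      then show False using \<theta>[rule_format, of k] \<epsilon>(4)[OF cv(1)] by linarith
    qed
    ultimately show ?thesis using K_zero by blast
  qed
  then show ?thesis using \<epsilon> by blast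
qed

end

end

section \<open>The topology of an atlas\<close>

context
  fixes \<A> :: "('d::finite, 'p) atlas"
  assumes chart: "\<And>V \<phi>. (V, \<phi>) \<in> \<A> \<Longrightarrow> open V" "\<And>V \<phi>. (V, \<phi>) \<in> \<A> \<Longrightarrow> inj_on \<phi> V"
    and overlap: "\<And>V \<phi> V' \<phi>'. (V, \<phi>) \<in> \<A> \<Longrightarrow> (V', \<phi>') \<in> \<A> \<Longrightarrow> open {u \<in> V. \<phi> u \<in> \<phi>' ` V'}"
      "\<And>V \<phi> V' \<phi>'. (V, \<phi>) \<in> \<A> \<Longrightarrow> (V', \<phi>') \<in> \<A> \<Longrightarrow>
         continuous_on {u \<in> V. \<phi> u \<in> \<phi>' ` V'} (\<lambda>u. inv_into V' \<phi>' (\<phi> u))"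
begin

lemma openin_atlas:
  "openin (atlas_topology \<A>) S \<longleftrightarrow> S \<subseteq> atlas_points \<A> \<and> (\<forall>(V, \<phi>)\<in>\<A>. open {u \<in> V. \<phi> u \<in> S})"
  unfolding atlas_topology_def using istopology_atlas[of \<A>] chart(1) by (subst topology_inverse') auto

lemma topspace_atlas: "topspace (atlas_topology \<A>) = atlas_points \<A>"
proof (rule antisym)
  show "topspace (atlas_topology \<A>) \<subseteq> atlas_points \<A>"
    using openin_topspace[of "atlas_topology \<A>"] openin_atlas by blast
  have "open {u \<in> V. \<phi> u \<in> atlas_points \<A>}" if "(V, \<phi>) \<in> \<A>" for V \<phi>
  proof -
    have "{u \<in> V. \<phi> u \<in> atlas_points \<A>} = V" using that unfolding atlas_points_def by blast
    then show ?thesis using chart(1)[OF that] by simp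
  qed
  then have "openin (atlas_topology \<A>) (atlas_points \<A>)" unfolding openin_atlas by blast
  then show "atlas_points \<A> \<subseteq> topspace (atlas_topology \<A>)" by (rule openin_subset)
qed

text \<open>Seen from another chart, the image of an open set is its preimage under the continuous
  transition map.\<close>

lemma chart_open_map:
  assumes c: "(V, \<phi>) \<in> \<A>" and U: "open U" "U \<subseteq> V"
  shows "openin (atlas_topology \<A>) (\<phi> ` U)"
  unfolding openin_atlas
proof (intro conjI ballI, goal_cases)
  case 1
  show ?case using c U(2) unfolding atlas_points_def by blast
next
  case (2 x)
  obtain V' \<phi>' where x: "x = (V', \<phi>')" by (cases x)
  have c': "(V', \<phi>') \<in> \<A>" using 2 x by simp
  let ?O = "{u \<in> V'. \<phi>' u \<in> \<phi> ` V}"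
  have "{u \<in> V'. \<phi>' u \<in> \<phi> ` U} = {u \<in> ?O. inv_into V \<phi> (\<phi>' u) \<in> U}"
  proof (intro set_eqI iffI)
    fix u assume "u \<in> {u \<in> V'. \<phi>' u \<in> \<phi> ` U}"
    then obtain w where "u \<in> V'" "w \<in> U" "\<phi>' u = \<phi> w" by blast
    then show "u \<in> {u \<in> ?O. inv_into V \<phi> (\<phi>' u) \<in> U}"
      using U(2) inv_into_f_f[OF chart(2)[OF c], of w] by auto
  next
    fix u assume "u \<in> {u \<in> ?O. inv_into V \<phi> (\<phi>' u) \<in> U}"
    then have "u \<in> V'" "inv_into V \<phi> (\<phi>' u) \<in> U" "\<phi> (inv_into V \<phi> (\<phi>' u)) = \<phi>' u"
      by (auto simp: f_inv_into_f)
    then show "u \<in> {u \<in> V'. \<phi>' u \<in> \<phi> ` U}" by (metis (mono_tags, lifting) imageI mem_Collect_eq)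
  qed
  also have "\<dots> = ?O \<inter> (\<lambda>u. inv_into V \<phi> (\<phi>' u)) -` U" by auto
  finally show ?case
    unfolding x using continuous_open_preimage[OF overlap(2)[OF c' c] overlap(1)[OF c' c] U(1)] by simp
qed

lemma chart_continuous_map:
  assumes c: "(V, \<phi>) \<in> \<A>"
  shows "continuous_map (top_of_set V) (atlas_topology \<A>) \<phi>"
  unfolding continuous_map_def topspace_atlas
proof (intro conjI allI impI)
  show "\<phi> \<in> topspace (top_of_set V) \<rightarrow> atlas_points \<A>" using c unfolding atlas_points_def by auto
  fix S assume "openin (atlas_topology \<A>) S"
  then have "open {u \<in> V. \<phi> u \<in> S}" using c unfolding openin_atlas by blast
  then show "openin (top_of_set V) {u \<in> topspace (top_of_set V). \<phi> u \<in> S}"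
    by (simp add: openin_open_eq chart(1)[OF c])
qed

lemma Hausdorff_atlas:
  assumes sep: "\<And>V \<phi> u V' \<phi>' u'. (V, \<phi>) \<in> \<A> \<Longrightarrow> (V', \<phi>') \<in> \<A> \<Longrightarrow> u \<in> V \<Longrightarrow> u' \<in> V' \<Longrightarrow> \<phi> u \<noteq> \<phi>' u' \<Longrightarrow>
     \<exists>U U'. open U \<and> open U' \<and> u \<in> U \<and> u' \<in> U' \<and> (\<forall>w\<in>U \<inter> V. \<forall>w'\<in>U' \<inter> V'. \<phi> w \<noteq> \<phi>' w')"
  shows "Hausdorff_space (atlas_topology \<A>)"
  unfolding Hausdorff_space_def topspace_atlas
proof (intro allI impI)
  fix x y assume xy: "x \<in> atlas_points \<A> \<and> y \<in> atlas_points \<A> \<and> x \<noteq> y"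
  obtain V \<phi> u where c: "(V, \<phi>) \<in> \<A>" "u \<in> V" "x = \<phi> u" using xy unfolding atlas_points_def by auto
  obtain V' \<phi>' u' where c': "(V', \<phi>') \<in> \<A>" "u' \<in> V'" "y = \<phi>' u'" using xy unfolding atlas_points_def by auto
  obtain U U' where U: "open U" "open U'" "u \<in> U" "u' \<in> U'" "\<forall>w\<in>U \<inter> V. \<forall>w'\<in>U' \<inter> V'. \<phi> w \<noteq> \<phi>' w'"
    using sep[OF c(1) c'(1) c(2) c'(2)] xy c(3) c'(3) by blast
  have "openin (atlas_topology \<A>) (\<phi> ` (U \<inter> V))" "openin (atlas_topology \<A>) (\<phi>' ` (U' \<inter> V'))"
    using U chart(1) c c' by (auto intro!: chart_open_map)
  moreover have "x \<in> \<phi> ` (U \<inter> V)" "y \<in> \<phi>' ` (U' \<inter> V')" using U c c' by auto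
  moreover have "disjnt (\<phi> ` (U \<inter> V)) (\<phi>' ` (U' \<inter> V'))" using U(5) unfolding disjnt_def by blast
  ultimately show "\<exists>U V. openin (atlas_topology \<A>) U \<and> openin (atlas_topology \<A>) V \<and> x \<in> U \<and> y \<in> V \<and> disjnt U V"
    by blast
qed

lemma second_countable_atlas:
  assumes fin: "finite \<A>"
  shows "second_countable (atlas_topology \<A>)"
proof -
  obtain \<B> :: "(real^'d) set set" where B: "countable \<B>" "\<And>C. C \<in> \<B> \<Longrightarrow> open C" "\<And>S. open S \<Longrightarrow> \<exists>U. U \<subseteq> \<B> \<and> S = \<Union>U"
    using univ_second_countable by blast
  let ?\<C> = "\<Union>(V, \<phi>)\<in>\<A>. (\<lambda>b. \<phi> ` (b \<inter> V)) ` \<B>"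
  have 1: "countable ?\<C>" using B(1) fin by (intro countable_UN) (auto simp: countable_finite)
  have 2: "openin (atlas_topology \<A>) C" if "C \<in> ?\<C>" for C
    using that B(2) chart(1) by (auto intro!: chart_open_map)
  have 3: "\<exists>C\<in>?\<C>. x \<in> C \<and> C \<subseteq> U" if U: "openin (atlas_topology \<A>) U" and x: "x \<in> U" for U x
  proof -
    have "x \<in> atlas_points \<A>" using U x unfolding openin_atlas by blast
    then obtain V \<phi> u where c: "(V, \<phi>) \<in> \<A>" "u \<in> V" "x = \<phi> u" unfolding atlas_points_def by auto
    have op: "open {u \<in> V. \<phi> u \<in> U}" using U c(1) unfolding openin_atlas by blast
    obtain UU where UU: "UU \<subseteq> \<B>" "{u \<in> V. \<phi> u \<in> U} = \<Union>UU" using B(3)[OF op] by metis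
    have "u \<in> \<Union>UU" unfolding UU(2)[symmetric] using c x by simp
    then obtain b where b: "b \<in> UU" "u \<in> b" by (rule UnionE)
    then have b': "b \<in> \<B>" "b \<subseteq> {u \<in> V. \<phi> u \<in> U}" using UU by auto
    have "\<phi> ` (b \<inter> V) \<in> ?\<C>" using b' c by (intro UN_I[of "(V, \<phi>)"]) auto
    moreover have "x \<in> \<phi> ` (b \<inter> V)" "\<phi> ` (b \<inter> V) \<subseteq> U" using b b' c by auto
    ultimately show ?thesis by blast
  qed
  show ?thesis
    unfolding second_countable_def
  proof (intro exI[of _ ?\<C>] conjI ballI allI impI)
    show "openin (atlas_topology \<A>) C" if "C \<in> ?\<C>" for C using that by (rule 2)
    show "\<exists>C\<in>?\<C>. x \<in> C \<and> C \<subseteq> U" if "openin (atlas_topology \<A>) U \<and> x \<in> U" for U x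
      using that by (intro 3) auto
  qed (rule 1)
qed

end

section \<open>Homogeneous coordinates\<close>

text \<open>The blow-up is described by its map to a product of projective spaces: for each
  \<open>n \<in> {1..m}\<close>, the point with homogeneous coordinates \<open>hom_coord R n \<theta>\<close>. In a chart, they are
  divided by the coordinate \<open>piv n\<close> of largest modulus, which gives \<open>chart_coord\<close>.\<close>

definition hom_coord :: "'d set \<Rightarrow> nat \<Rightarrow> real^'d::finite \<Rightarrow> 'd \<Rightarrow> real" where
  "hom_coord R n \<theta> a = (if a \<in> R then \<theta> $ a else \<theta> $ a ^ n)"

definition chart_coord ::
  "'d set \<Rightarrow> 'd set \<Rightarrow> ('d \<Rightarrow> nat) \<Rightarrow> (nat \<Rightarrow> 'd) \<Rightarrow> nat \<Rightarrow> real^'d::finite \<Rightarrow> 'd \<Rightarrow> real" where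
  "chart_coord R E N piv n v a =
     (if piv n \<in> R then (if a \<in> R then 1 else \<Prod>e\<in>E. v $ e ^ (n - N e))
      else (if a \<in> R then \<Prod>e\<in>E. v $ e ^ (N e - n) else 1)) *
     (if a \<in> E then 1 else if a \<in> R then v $ a else v $ a ^ n)"

lemma real_analytic_at_chart_coord: "real_analytic_at (\<lambda>v. chart_coord R E N piv n v a) v0"
proof -
  have "real_analytic_at (\<lambda>v. (if P then if Q then 1 else f v else if Q then g v else 1) *
      (if S then 1 else if Q then h v else k v)) v0"
    if "real_analytic_at f v0" "real_analytic_at g v0" "real_analytic_at h v0" "real_analytic_at k v0"
    for P Q S and f g h k :: "real^'a \<Rightarrow> real"
    using that by (cases P; cases Q; cases S) (auto intro: real_analytic_at_mult real_analytic_at_const)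
  then show ?thesis unfolding chart_coord_def
    by (simp add: real_analytic_at_prod real_analytic_at_power real_analytic_at_coord)
qed

lemma isCont_chart_coord: "isCont (\<lambda>v. chart_coord R E N piv n v a) v0"
  using real_analytic_at_chart_coord by (rule real_analytic_at_isCont)

lemma real_analytic_at_mono_map: "real_analytic_at (\<lambda>v. mono_map R E N v $ k) v0"
  unfolding mono_map_def vec_lambda_beta
  by (cases "k \<in> E") (auto intro!: real_analytic_at_mult real_analytic_at_prod real_analytic_at_power
      real_analytic_at_coord real_analytic_at_const)

text \<open>The pivot carries the smallest exponent of each exceptional coordinate: n outside
  \<open>R\<close>, \<open>N e\<close> inside. The two hypotheses say which of these is smaller, so
  the truncated differences in \<open>chart_coord\<close> are exact.\<close>

lemma hom_coord_mono_map:
  assumes p: "piv n \<in> E" "piv n \<notin> R \<Longrightarrow> \<forall>e\<in>E. n \<le> N e" "piv n \<in> R \<Longrightarrow> \<forall>e\<in>E. N e \<le> n"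
  shows "hom_coord R n (mono_map R E N v) a =
    hom_coord R n (mono_map R E N v) (piv n) * chart_coord R E N piv n v a"
proof -
  have pw: "(\<Prod>e\<in>E. v $ e) ^ n = (\<Prod>e\<in>E. v $ e ^ n)" by (rule prod_power_distrib)
  show ?thesis
  proof (cases "piv n \<in> R")
    case True
    have "(\<Prod>e\<in>E. v $ e ^ n) = (\<Prod>e\<in>E. v $ e ^ N e * v $ e ^ (n - N e))"
      using p(3)[OF True] by (intro prod.cong) (auto simp: power_add[symmetric])
    then show ?thesis using True p(1)
      by (simp add: hom_coord_def mono_map_def chart_coord_def Wt_def power_mult_distrib pw prod.distrib)
  next
    case False
    have "(\<Prod>e\<in>E. v $ e ^ N e) = (\<Prod>e\<in>E. v $ e ^ n * v $ e ^ (N e - n))"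
      using p(2)[OF False] by (intro prod.cong) (auto simp: power_add[symmetric])
    then show ?thesis using False p(1)
      by (simp add: hom_coord_def mono_map_def chart_coord_def Wt_def power_mult_distrib pw prod.distrib)
  qed
qed

lemma chart_coord_pivot: "piv n \<in> E \<Longrightarrow> chart_coord R E N piv n v (piv n) = 1"
  by (simp add: chart_coord_def)

context semiregular
begin

text \<open>\<open>src k\<close> records where the k-th chart coordinate can be read off: from the
  image itself if it is 0, otherwise from the normalized homogeneous coordinates of that index.
  Hence a point determines its chart coordinates. The last clause describes enough of the image for
  the chart to reach every overlap.\<close>

definition chart_pivots :: "'d list \<Rightarrow> 'd set \<Rightarrow> ('d \<Rightarrow> nat) \<Rightarrow> (nat \<Rightarrow> 'd) \<Rightarrow> ('d \<Rightarrow> nat) \<Rightarrow> bool" where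
  "chart_pivots c E N' piv src \<longleftrightarrow> chart_data R m c E N' \<and>
     (\<forall>n. 1 \<le> n \<and> n \<le> m \<longrightarrow> piv n \<in> E \<and> (piv n \<notin> R \<longrightarrow> (\<forall>e\<in>E. n \<le> N' e)) \<and> (piv n \<in> R \<longrightarrow> (\<forall>e\<in>E. N' e \<le> n))) \<and>
     (\<forall>k. src k \<le> m \<and> (src k = 0 \<longrightarrow> (\<forall>v. mono_map R E N' v $ k = v $ k)) \<and>
        (src k \<ge> 1 \<longrightarrow> (\<forall>v. chart_coord R E N' piv (src k) v k = v $ k))) \<and>
     (\<forall>\<theta>. (\<forall>n. 1 \<le> n \<and> n \<le> m \<longrightarrow> \<theta> $ piv n \<noteq> 0) \<longrightarrow> (\<exists>v. mono_map R E N' v = \<theta>))"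

lemma chart_pivots_exist:
  assumes "c \<in> blowup_charts R m"
  shows "\<exists>E N' piv src. chart_pivots c E N' piv src"
proof -
  obtain E N' where cd: "chart_data R m c E N'" using assms blowup_charts_iff[OF m1] by blast
  from cd show ?thesis
  proof (cases rule: chart_dataE)
    case (1 i)
    have "\<exists>v. mono_map R E N' v = \<theta>" if "\<theta> $ i \<noteq> 0" for \<theta>
      using mono_map_inverse_1[OF 1(1) _ m1, of \<theta>] that 1 by blast
    then have "chart_pivots c E N' (\<lambda>_. i) (\<lambda>k. if k = i then 0 else if k \<in> R then m else 1)"
      using cd 1 m1 unfolding chart_pivots_def
      by (auto simp: mono_map_def chart_coord_def Wt_def)
    then show ?thesis by blast
  next
    case (2 i j n)
    show ?thesis
    proof (cases "n = 0")
      case True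
      have N0: "N' = (\<lambda>e. if e \<in> R then 1 else 0)" "E = {j}" using True 2 by auto
      have "\<exists>v. mono_map R E N' v = \<theta>" if "\<theta> $ j \<noteq> 0" for \<theta>
        unfolding N0 using mono_map_inverse_2[OF 2(1) that] by (rule exI)
      then have "chart_pivots c E N' (\<lambda>_. j) (\<lambda>k. if k = j then 0 else 1)"
        using cd 2 m1 True unfolding chart_pivots_def
        by (auto simp: mono_map_def chart_coord_def Wt_def)
      then show ?thesis by blast
    next
      case False
      then have ij: "i \<notin> R" "E = {i, j}" "i \<noteq> j" using 2 by auto
      \<comment> \<open>The pivot switches from i to j at the weight n of i. Around the switch the
        quotients are exactly the exceptional coordinates: v_j appears at index n and v_i at index n
        + 1.\<close>
      let ?piv = "\<lambda>n'. if n' \<le> n then i else j"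
      let ?src = "\<lambda>k. if k = j then n else if k \<in> R \<or> k = i then n + 1 else 1"
      have inv: "\<exists>v. mono_map R E N' v = \<theta>" if "\<forall>n. 1 \<le> n \<and> n \<le> m \<longrightarrow> \<theta> $ ?piv n \<noteq> 0" for \<theta>
      proof -
        have "\<theta> $ i \<noteq> 0" using that[rule_format, of 1] m1 False by (simp split: if_splits)
        moreover have "\<theta> $ j \<noteq> 0" using that[rule_format, of m] m1 2(2) by (simp split: if_splits)
        ultimately show ?thesis using mono_map_inverse_3[OF 2(1) ij(1)] 2(4) ij(2) by blast
      qed
      have src: "?src k \<le> m \<and> (?src k = 0 \<longrightarrow> (\<forall>v. mono_map R E N' v $ k = v $ k)) \<and>
        (?src k \<ge> 1 \<longrightarrow> (\<forall>v. chart_coord R E N' ?piv (?src k) v k = v $ k))" for k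
        using False 2(1,2,4) ij m1 by (auto simp: chart_coord_def)
      have piv: "?piv n' \<in> E \<and> (?piv n' \<notin> R \<longrightarrow> (\<forall>e\<in>E. n' \<le> N' e)) \<and> (?piv n' \<in> R \<longrightarrow> (\<forall>e\<in>E. N' e \<le> n'))" for n'
        using 2(1,4) ij by auto
      have "chart_pivots c E N' ?piv ?src"
        unfolding chart_pivots_def using cd inv src piv by blast
      then show ?thesis by blast
    qed
  qed
qed

end

lemma tendsto_unique_eventually:
  fixes f g :: "'a \<Rightarrow> 'b::t2_space"
  assumes "F \<noteq> bot" "(f \<longlongrightarrow> a) F" "(g \<longlongrightarrow> b) F" "\<forall>\<^sub>F x in F. f x = g x"
  shows "a = b"
proof -
  have "(g \<longlongrightarrow> a) F" using assms(2,4) by (rule Lim_transform_eventually)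
  then show ?thesis using assms(1,3) tendsto_unique by blast
qed

section \<open>A resolution with the threshold\<close>

context semiregular
begin

context
  fixes E :: "'d list \<Rightarrow> 'd set" and EN :: "'d list \<Rightarrow> 'd \<Rightarrow> nat" and piv :: "'d list \<Rightarrow> nat \<Rightarrow> 'd"
    and src :: "'d list \<Rightarrow> 'd \<Rightarrow> nat" and \<epsilon> :: real
  assumes CP: "\<And>c. c \<in> blowup_charts R m \<Longrightarrow> chart_pivots c (E c) (EN c) (piv c) (src c)"
    and \<epsilon>: "\<epsilon> > 0" "\<epsilon> \<le> 1"
    and box: "\<And>\<theta>. (\<forall>k. \<bar>\<theta> $ k\<bar> < \<epsilon>) \<Longrightarrow> \<theta> \<in> W0" "\<And>\<theta>. (\<forall>k. \<bar>\<theta> $ k\<bar> < \<epsilon>) \<Longrightarrow> K \<theta> = 0 \<longleftrightarrow> \<theta> = 0"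
    and ii: "\<forall>\<theta>. (\<exists>i. i \<notin> R \<and> \<theta> $ i \<noteq> 0) \<longrightarrow> form_independent N X p R m \<theta>"
begin

abbreviation "CH \<equiv> blowup_charts R m"
abbreviation "G \<equiv> chart_map R"
abbreviation "xc c \<equiv> chart_coord R (E c) (EN c) (piv c)"

lemma G_eq: "c \<in> CH \<Longrightarrow> G c v = mono_map R (E c) (EN c) v"
  using CP m1 chart_map_eq_mono_map unfolding chart_pivots_def by blast

lemma piv_in: "c \<in> CH \<Longrightarrow> 1 \<le> n \<Longrightarrow> n \<le> m \<Longrightarrow> piv c n \<in> E c"
  using CP unfolding chart_pivots_def by blast

lemma xc_pivot: "c \<in> CH \<Longrightarrow> 1 \<le> n \<Longrightarrow> n \<le> m \<Longrightarrow> xc c n v (piv c n) = 1"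
  using piv_in by (rule chart_coord_pivot)

lemma hom_G:
  "c \<in> CH \<Longrightarrow> 1 \<le> n \<Longrightarrow> n \<le> m \<Longrightarrow> hom_coord R n (G c v) a = hom_coord R n (G c v) (piv c n) * xc c n v a"
  unfolding G_eq using CP[of c] unfolding chart_pivots_def by (intro hom_coord_mono_map) blast+

lemma src_le: "c \<in> CH \<Longrightarrow> src c k \<le> m"
  using CP unfolding chart_pivots_def by blast

lemma src_zero: "c \<in> CH \<Longrightarrow> src c k = 0 \<Longrightarrow> G c v $ k = v $ k"
  unfolding G_eq using CP unfolding chart_pivots_def by blast

lemma src_pos: "c \<in> CH \<Longrightarrow> 1 \<le> src c k \<Longrightarrow> xc c (src c k) v k = v $ k"
  using CP unfolding chart_pivots_def by blast

lemma G_surj: "c \<in> CH \<Longrightarrow> (\<And>n. 1 \<le> n \<Longrightarrow> n \<le> m \<Longrightarrow> \<theta> $ piv c n \<noteq> 0) \<Longrightarrow> \<exists>v. G c v = \<theta>"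
  unfolding G_eq using CP unfolding chart_pivots_def by blast

lemma G_pivot_nonzero:
  assumes c: "c \<in> CH" and n: "1 \<le> n" "n \<le> m" and nz: "G c v \<noteq> 0"
  shows "G c v $ piv c n \<noteq> 0" "hom_coord R n (G c v) (piv c n) \<noteq> 0"
proof -
  have cd: "chart_data R m c (E c) (EN c)" using CP[OF c] unfolding chart_pivots_def by blast
  have "v $ e \<noteq> 0" if "e \<in> E c" for e
    using mono_map_zero[where N = "EN c", OF that chart_data_bounds(1)[OF cd that]] nz G_eq[OF c] by auto
  then have "(\<Prod>e\<in>E c. v $ e ^ Wt R (EN c e) (piv c n)) \<noteq> 0" by (simp add: prod_zero_iff)
  then show "G c v $ piv c n \<noteq> 0" using piv_in[OF c n] by (simp add: G_eq[OF c] mono_map_def)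
  then show "hom_coord R n (G c v) (piv c n) \<noteq> 0" by (simp add: hom_coord_def)
qed

section \<open>Points of the graph closure and transition maps\<close>

definition line :: "'d list \<Rightarrow> nat \<Rightarrow> real^'d \<Rightarrow> ('d \<Rightarrow> real) set" where
  "line c n v = range (\<lambda>t a. t * xc c n v a)"

text \<open>A point of the product of the parameter space with m projective spaces, each projective
  point being a line through 0. Outside 1..m a fixed value is used, so that equality of functions
  means equality of the m lines.\<close>

definition pt :: "'d list \<Rightarrow> real^'d \<Rightarrow> (real^'d) \<times> (nat \<Rightarrow> ('d \<Rightarrow> real) set)" where
  "pt c v = (G c v, \<lambda>n. if 1 \<le> n \<and> n \<le> m then line c n v else {})"

lemma pt_eqD:
  assumes c: "c \<in> CH" "c' \<in> CH" and pt: "pt c u = pt c' u'" and n: "1 \<le> n" "n \<le> m"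
  shows "xc c n u (piv c' n) \<noteq> 0" "xc c n u a = xc c n u (piv c' n) * xc c' n u' a"
proof -
  have "line c n u = line c' n u'"
    using fun_cong[OF arg_cong[OF pt, of snd], of n] n by (simp add: pt_def)
  moreover have "(\<lambda>a. 1 * xc c n u a) \<in> line c n u" unfolding line_def by (rule rangeI)
  ultimately obtain t where t: "(\<lambda>a. 1 * xc c n u a) = (\<lambda>a. t * xc c' n u' a)" unfolding line_def by auto
  have t': "xc c n u a = t * xc c' n u' a" for a using fun_cong[OF t, of a] by simp
  have "t = xc c n u (piv c' n)" using t'[of "piv c' n"] xc_pivot[OF c(2) n] by simp
  moreover have "t \<noteq> 0" using t'[of "piv c n"] xc_pivot[OF c(1) n] by auto
  ultimately show "xc c n u (piv c' n) \<noteq> 0" "xc c n u a = xc c n u (piv c' n) * xc c' n u' a"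
    using t' by auto
qed

lemma pt_eqI:
  assumes "G c u = G c' u'"
    and "\<And>n. 1 \<le> n \<Longrightarrow> n \<le> m \<Longrightarrow> \<exists>t. t \<noteq> 0 \<and> (\<forall>a. xc c n u a = t * xc c' n u' a)"
  shows "pt c u = pt c' u'"
proof -
  have "line c n u = line c' n u'" if n: "1 \<le> n" "n \<le> m" for n
  proof -
    obtain t where t: "t \<noteq> 0" "\<And>a. xc c n u a = t * xc c' n u' a" using assms(2)[OF n] by blast
    show ?thesis
    proof (intro set_eqI iffI)
      fix x assume "x \<in> line c n u"
      then obtain s where "x = (\<lambda>a. s * xc c n u a)" unfolding line_def by blast
      then have "x = (\<lambda>a. (s * t) * xc c' n u' a)" by (simp add: t(2) mult.assoc)
      then show "x \<in> line c' n u'" unfolding line_def by blast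
    next
      fix x assume "x \<in> line c' n u'"
      then obtain s where "x = (\<lambda>a. s * xc c' n u' a)" unfolding line_def by blast
      then have "x = (\<lambda>a. (s / t) * xc c n u a)" by (simp add: t)
      then show "x \<in> line c n u" unfolding line_def by blast
    qed
  qed
  then show ?thesis unfolding pt_def using assms(1) by (auto simp: fun_eq_iff)
qed

text \<open>Proportionality is expressed by cross products, without the scalar: a closed condition
  that passes to limits. Conversely the pivot coordinates, equal to 1, supply the nonzero
  scalar.\<close>

lemma pt_eq_iff_cross:
  assumes c: "c \<in> CH" "c' \<in> CH"
  shows "pt c u = pt c' u' \<longleftrightarrow> G c u = G c' u' \<and>
    (\<forall>n\<in>{1..m}. \<forall>a b. xc c n u a * xc c' n u' b = xc c n u b * xc c' n u' a)"
proof
  assume pt: "pt c u = pt c' u'"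
  have "xc c n u a * xc c' n u' b = xc c n u b * xc c' n u' a" if "n \<in> {1..m}" for n a b
    using pt_eqD(2)[OF c pt, of n a] pt_eqD(2)[OF c pt, of n b] that by simp
  moreover have "G c u = G c' u'" using arg_cong[OF pt, of fst] by (simp add: pt_def)
  ultimately show "G c u = G c' u' \<and> (\<forall>n\<in>{1..m}. \<forall>a b. xc c n u a * xc c' n u' b = xc c n u b * xc c' n u' a)"
    by blast
next
  assume cr: "G c u = G c' u' \<and> (\<forall>n\<in>{1..m}. \<forall>a b. xc c n u a * xc c' n u' b = xc c n u b * xc c' n u' a)"
  show "pt c u = pt c' u'"
  proof (rule pt_eqI)
    fix n assume n: "1 \<le> n" "n \<le> m"
    have *: "xc c n u a = xc c n u (piv c' n) * xc c' n u' a" for a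
    proof -
      have "xc c n u a * xc c' n u' (piv c' n) = xc c n u (piv c' n) * xc c' n u' a" using cr n by simp
      then show ?thesis using xc_pivot[OF c(2) n] by simp
    qed
    have "xc c n u (piv c' n) \<noteq> 0" using *[of "piv c n"] xc_pivot[OF c(1) n, of u] by auto
    then show "\<exists>t. t \<noteq> 0 \<and> (\<forall>a. xc c n u a = t * xc c' n u' a)" using * by blast
  qed (use cr in blast)
qed

text \<open>Off the origin all pivots are nonzero, so the lines are spanned by the homogeneous
  coordinates of the image.\<close>

lemma pt_eq_of_G_eq:
  assumes c: "c \<in> CH" "c' \<in> CH" and G: "G c u = G c' u'" "G c u \<noteq> 0"
  shows "pt c u = pt c' u'"
proof (rule pt_eqI[OF G(1)])
  fix n assume n: "1 \<le> n" "n \<le> m"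
  define a a' where "a = hom_coord R n (G c u) (piv c n)" and "a' = hom_coord R n (G c' u') (piv c' n)"
  have "a \<noteq> 0" unfolding a_def by (rule G_pivot_nonzero(2)[OF c(1) n G(2)])
  moreover have "a' \<noteq> 0" unfolding a'_def by (rule G_pivot_nonzero(2)[OF c(2) n]) (use G in simp)
  ultimately have nz: "a \<noteq> 0" "a' \<noteq> 0" by simp_all
  have "a * xc c n u b = a' * xc c' n u' b" for b
    using hom_G[OF c(1) n, of u b] hom_G[OF c(2) n, of u' b] G(1) unfolding a_def a'_def by simp
  then have "xc c n u b = (a' / a) * xc c' n u' b" for b using nz by (simp add: field_simps)
  then show "\<exists>t. t \<noteq> 0 \<and> (\<forall>b. xc c n u b = t * xc c' n u' b)" using nz by (intro exI[of _ "a' / a"]) auto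
qed

text \<open>The points of chart c that also lie in chart c': there the homogeneous coordinates can
  be renormalized to the pivots of c'.\<close>

definition overlap :: "'d list \<Rightarrow> 'd list \<Rightarrow> (real^'d) set" where
  "overlap c c' = {u. \<forall>n\<in>{1..m}. xc c n u (piv c' n) \<noteq> 0}"

text \<open>Each coordinate of c' is read from the source given by \<open>src\<close>, after
  renormalizing the coordinates of c to the pivot of c'. As a quotient with nonzero denominator it
  is analytic.\<close>

definition transition :: "'d list \<Rightarrow> 'd list \<Rightarrow> real^'d \<Rightarrow> real^'d" where
  "transition c c' u = (\<chi> k. if src c' k = 0 then G c u $ k else xc c (src c' k) u k * inverse (xc c (src c' k) u (piv c' (src c' k))))"

lemma open_overlap: "open (overlap c c')"
proof -
  have "overlap c c' = (\<Inter>n\<in>{1..m}. {u. xc c n u (piv c' n) \<noteq> 0})" unfolding overlap_def by auto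
  moreover have "open {u. xc c n u (piv c' n) \<noteq> 0}" for n
    by (intro open_Collect_neq continuous_at_imp_continuous_on ballI isCont_chart_coord continuous_on_const)
  ultimately show ?thesis by (simp add: open_INT)
qed

lemma pt_eq_trans:
  assumes c: "c \<in> CH" "c' \<in> CH" and pt: "pt c u = pt c' u'"
  shows "u \<in> overlap c c'" "u' = transition c c' u"
proof -
  show "u \<in> overlap c c'" unfolding overlap_def using pt_eqD(1)[OF c pt] by simp
  have "u' $ k = transition c c' u $ k" for k
  proof (cases "src c' k = 0")
    case True
    have "G c u = G c' u'" using arg_cong[OF pt, of fst] by (simp add: pt_def)
    then show ?thesis using src_zero[OF c(2) True, of u'] True by (simp add: transition_def)
  next
    case False
    then have n: "1 \<le> src c' k" "src c' k \<le> m" using src_le[OF c(2)] by auto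
    have "xc c (src c' k) u k = xc c (src c' k) u (piv c' (src c' k)) * u' $ k"
      using pt_eqD(2)[OF c pt n, of k] src_pos[OF c(2) n(1)] by simp
    then show ?thesis using pt_eqD(1)[OF c pt n] False by (simp add: transition_def)
  qed
  then show "u' = transition c c' u" by (simp add: vec_eq_iff)
qed

lemma real_analytic_at_G: "c \<in> CH \<Longrightarrow> real_analytic_at (\<lambda>v. G c v $ k) v0"
  unfolding G_eq by (rule real_analytic_at_mono_map)

lemma trans_analytic:
  assumes c: "c \<in> CH" "c' \<in> CH" and u: "u \<in> overlap c c'"
  shows "real_analytic_at (\<lambda>v. transition c c' v $ k) u"
proof (cases "src c' k = 0")
  case True
  then show ?thesis using real_analytic_at_G[OF c(1)] by (simp add: transition_def)
next
  case False
  then have "xc c (src c' k) u (piv c' (src c' k)) \<noteq> 0"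
    using u src_le[OF c(2), of k] unfolding overlap_def by auto
  then have "real_analytic_at (\<lambda>u. xc c (src c' k) u k * inverse (xc c (src c' k) u (piv c' (src c' k)))) u"
    by (intro real_analytic_at_mult real_analytic_at_inverse real_analytic_at_chart_coord)
  then show ?thesis using False by (simp add: transition_def)
qed

lemma isCont_trans:
  assumes "c \<in> CH" "c' \<in> CH" "u \<in> overlap c c'"
  shows "isCont (transition c c') u"
  using analytic_has_derivative[OF trans_analytic[OF assms]] has_derivative_continuous by blast

text \<open>Off the origin, nonvanishing pivots make the image a value of the other chart map, and
  the coordinates found there must be those of \<open>transition\<close>. The remaining points are
  limits along the diagonal, where the cross-product equations persist.\<close>

lemma pt_trans:
  assumes c: "c \<in> CH" "c' \<in> CH" and u: "u \<in> overlap c c'"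
  shows "pt c u = pt c' (transition c c' u)"
proof -
  have nz: "pt c w = pt c' (transition c c' w)" if w: "w \<in> overlap c c'" "G c w \<noteq> 0" for w
  proof -
    have "G c w $ piv c' n \<noteq> 0" if n: "1 \<le> n" "n \<le> m" for n
    proof -
      have "hom_coord R n (G c w) (piv c' n) \<noteq> 0"
        using hom_G[OF c(1) n, of w "piv c' n"] G_pivot_nonzero(2)[OF c(1) n w(2)] w(1) n
        unfolding overlap_def by auto
      then show ?thesis using n by (auto simp: hom_coord_def power_0_left split: if_splits)
    qed
    then obtain v where v: "G c' v = G c w" using G_surj[OF c(2)] by blast
    have "pt c w = pt c' v" using c v w(2) by (intro pt_eq_of_G_eq) auto
    then show ?thesis using pt_eq_trans(2)[OF c] by metis
  qed
  let ?\<gamma> = "\<lambda>t :: real. u + t *\<^sub>R 1"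
  have lim: "(?\<gamma> \<longlongrightarrow> u) (at_right 0)" by (rule tendsto_diagonal)
  have "\<forall>\<^sub>F t in at_right 0. ?\<gamma> t \<in> overlap c c'"
    using topological_tendstoD[OF lim open_overlap u] .
  then have ev: "\<forall>\<^sub>F t in at_right 0. pt c (?\<gamma> t) = pt c' (transition c c' (?\<gamma> t))"
    using eventually_chart_map_nonzero[OF c(1), of u] by eventually_elim (rule nz)
  have limT: "((\<lambda>t. transition c c' (?\<gamma> t)) \<longlongrightarrow> transition c c' u) (at_right 0)"
    using isCont_trans[OF c u] lim by (rule isCont_tendsto_compose)
  show ?thesis
    unfolding pt_eq_iff_cross[OF c]
  proof (intro conjI ballI allI)
    have "((\<lambda>t. G c (?\<gamma> t)) \<longlongrightarrow> G c u) (at_right 0)"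
      using isCont_chart_map[OF c(1)] lim by (rule isCont_tendsto_compose)
    moreover have "((\<lambda>t. G c' (transition c c' (?\<gamma> t))) \<longlongrightarrow> G c' (transition c c' u)) (at_right 0)"
      using isCont_chart_map[OF c(2)] limT by (rule isCont_tendsto_compose)
    moreover have "\<forall>\<^sub>F t in at_right 0. G c (?\<gamma> t) = G c' (transition c c' (?\<gamma> t))"
      using ev by eventually_elim (simp add: pt_def)
    ultimately show "G c u = G c' (transition c c' u)"
      by (rule tendsto_unique_eventually[OF trivial_limit_at_right_real])
    fix n a b assume n: "n \<in> {1..m}"
    have l1: "((\<lambda>t. xc c n (?\<gamma> t) a) \<longlongrightarrow> xc c n u a) (at_right 0)" for a
      using isCont_chart_coord lim by (rule isCont_tendsto_compose)
    have l2: "((\<lambda>t. xc c' n (transition c c' (?\<gamma> t)) a) \<longlongrightarrow> xc c' n (transition c c' u) a) (at_right 0)" for a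
      using isCont_chart_coord limT by (rule isCont_tendsto_compose)
    have "\<forall>\<^sub>F t in at_right 0. xc c n (?\<gamma> t) a * xc c' n (transition c c' (?\<gamma> t)) b =
        xc c n (?\<gamma> t) b * xc c' n (transition c c' (?\<gamma> t)) a"
      using ev by eventually_elim (use pt_eq_iff_cross[OF c] n in blast)
    then show "xc c n u a * xc c' n (transition c c' u) b = xc c n u b * xc c' n (transition c c' u) a"
      by (rule tendsto_unique_eventually[OF trivial_limit_at_right_real tendsto_mult[OF l1[of a] l2[of b]]
            tendsto_mult[OF l1[of b] l2[of a]]])
  qed
qed

text \<open>Both arguments are recovered from the point by \<open>transition c c\<close>.\<close>

lemma pt_inj:
  assumes c: "c \<in> CH" and pt: "pt c u = pt c u'"
  shows "u = u'"
  using pt_eq_trans(2)[OF c c pt] pt_eq_trans(2)[OF c c refl[of "pt c u"]] by simp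

section \<open>The manifold over a small cube\<close>

definition W :: "(real^'d) set" where "W = {\<theta>. \<forall>k. \<bar>\<theta> $ k\<bar> < \<epsilon>}"

definition D :: "'d list \<Rightarrow> (real^'d) set" where "D c = {v. G c v \<in> W}"

text \<open>The class of all chart points naming the same point of the graph closure; this gives
  points of the type demanded by \<open>has_rlct\<close>.\<close>

definition \<phi> :: "'d list \<Rightarrow> real^'d \<Rightarrow> ('d list \<times> (real^'d)) set" where
  "\<phi> c v = {(c', v'). c' \<in> CH \<and> pt c' v' = pt c v}"

abbreviation "\<A> \<equiv> (\<lambda>c. (D c, \<phi> c)) ` CH"
abbreviation "g \<equiv> blowup_map R :: ('d list \<times> (real^'d)) set \<Rightarrow> real^'d"

lemma \<phi>_eq_iff: "c \<in> CH \<Longrightarrow> \<phi> c v = \<phi> c' v' \<longleftrightarrow> pt c v = pt c' v'"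
proof
  assume c: "c \<in> CH" and eq: "\<phi> c v = \<phi> c' v'"
  have "(c, v) \<in> \<phi> c v" using c unfolding \<phi>_def by blast
  then show "pt c v = pt c' v'" unfolding eq by (simp add: \<phi>_def)
qed (simp add: \<phi>_def)

lemma g_\<phi>: "c \<in> CH \<Longrightarrow> g (\<phi> c v) = G c v"
  unfolding blowup_map_def
proof (rule the_equality)
  show "c \<in> CH \<Longrightarrow> \<exists>(c', u)\<in>\<phi> c v. G c v = G c' u" by (auto simp: \<phi>_def intro!: bexI[of _ "(c, v)"])
  show "\<theta> = G c v" if "\<exists>(c', u)\<in>\<phi> c v. \<theta> = G c' u" for \<theta> using that by (auto simp: \<phi>_def pt_def)
qed

lemma open_W: "open W"
proof -
  have "W = (\<Inter>k\<in>UNIV. {\<theta>. \<bar>\<theta> $ k\<bar> < \<epsilon>})" by (auto simp: W_def)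
  moreover have "open {\<theta> :: real^'d. \<bar>\<theta> $ k\<bar> < \<epsilon>}" for k by (intro open_Collect_less continuous_intros)
  ultimately show ?thesis by (simp add: open_INT)
qed

lemma open_D: "c \<in> CH \<Longrightarrow> open (D c)"
proof -
  assume c: "c \<in> CH"
  have "continuous_on UNIV (G c)" using isCont_chart_map[OF c] by (intro continuous_at_imp_continuous_on) auto
  then have "open (G c -` W)" using open_W by (intro open_vimage)
  moreover have "G c -` W = D c" by (auto simp: D_def)
  ultimately show ?thesis by simp
qed

lemma inj_\<phi>: "c \<in> CH \<Longrightarrow> inj_on (\<phi> c) S"
  using \<phi>_eq_iff pt_inj unfolding inj_on_def by blast

lemma \<phi>_overlap:
  assumes c: "c \<in> CH" "c' \<in> CH"
  shows "{u \<in> D c. \<phi> c u \<in> \<phi> c' ` D c'} = D c \<inter> overlap c c'"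
    and "u \<in> D c \<inter> overlap c c' \<Longrightarrow> inv_into (D c') (\<phi> c') (\<phi> c u) = transition c c' u"
proof -
  have tr: "transition c c' u \<in> D c' \<and> \<phi> c u = \<phi> c' (transition c c' u)" if "u \<in> D c \<inter> overlap c c'" for u
  proof -
    have pt: "pt c u = pt c' (transition c c' u)" using pt_trans[OF c] that by blast
    then have "G c u = G c' (transition c c' u)" using arg_cong[OF pt, of fst] by (simp add: pt_def)
    then show ?thesis using that pt \<phi>_eq_iff[OF c(1)] unfolding D_def by auto
  qed
  then show "{u \<in> D c. \<phi> c u \<in> \<phi> c' ` D c'} = D c \<inter> overlap c c'"
    using \<phi>_eq_iff[OF c(1)] pt_eq_trans(1)[OF c] by fastforce
  show "inv_into (D c') (\<phi> c') (\<phi> c u) = transition c c' u" if "u \<in> D c \<inter> overlap c c'"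
    using tr[OF that] inj_\<phi>[OF c(2)] by (metis inv_into_f_f)
qed

lemma atlas_conditions:
  shows "(V, \<psi>) \<in> \<A> \<Longrightarrow> open V" "(V, \<psi>) \<in> \<A> \<Longrightarrow> inj_on \<psi> V"
    and "(V, \<psi>) \<in> \<A> \<Longrightarrow> (V', \<psi>') \<in> \<A> \<Longrightarrow> open {u \<in> V. \<psi> u \<in> \<psi>' ` V'}"
    and "(V, \<psi>) \<in> \<A> \<Longrightarrow> (V', \<psi>') \<in> \<A> \<Longrightarrow> analytic_map_on (inv_into V' \<psi>' \<circ> \<psi>) {u \<in> V. \<psi> u \<in> \<psi>' ` V'}"
    and "(V, \<psi>) \<in> \<A> \<Longrightarrow> (V', \<psi>') \<in> \<A> \<Longrightarrow> continuous_on {u \<in> V. \<psi> u \<in> \<psi>' ` V'} (\<lambda>u. inv_into V' \<psi>' (\<psi> u))"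
proof -
  show "open V" "inj_on \<psi> V" if "(V, \<psi>) \<in> \<A>" using that open_D inj_\<phi> by auto
  assume "(V, \<psi>) \<in> \<A>" "(V', \<psi>') \<in> \<A>"
  then obtain c c' where c: "c \<in> CH" "c' \<in> CH" and eq: "V = D c" "\<psi> = \<phi> c" "V' = D c'" "\<psi>' = \<phi> c'" by auto
  have op: "open (D c \<inter> overlap c c')" using open_D[OF c(1)] open_overlap by auto
  then show "open {u \<in> V. \<psi> u \<in> \<psi>' ` V'}" unfolding eq \<phi>_overlap(1)[OF c] .
  show "analytic_map_on (inv_into V' \<psi>' \<circ> \<psi>) {u \<in> V. \<psi> u \<in> \<psi>' ` V'}"
    unfolding eq \<phi>_overlap(1)[OF c] analytic_map_on_def real_analytic_on_def
  proof (intro allI ballI)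
    fix i u assume u: "u \<in> D c \<inter> overlap c c'"
    show "real_analytic_at (\<lambda>x. (inv_into (D c') (\<phi> c') \<circ> \<phi> c) x $ i) u"
    proof (rule real_analytic_at_cong)
      show "real_analytic_at (\<lambda>w. transition c c' w $ i) u" using trans_analytic[OF c] u by blast
      show "\<forall>\<^sub>F w in nhds u. transition c c' w $ i = (inv_into (D c') (\<phi> c') \<circ> \<phi> c) w $ i"
        using eventually_nhds_in_open[OF op u] by eventually_elim (simp add: \<phi>_overlap(2)[OF c])
    qed
  qed
  have "continuous_on (D c \<inter> overlap c c') (transition c c')"
    using isCont_trans[OF c] by (intro continuous_at_imp_continuous_on) auto
  then show "continuous_on {u \<in> V. \<psi> u \<in> \<psi>' ` V'} (\<lambda>u. inv_into V' \<psi>' (\<psi> u))"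
    unfolding eq \<phi>_overlap(1)[OF c] by (rule continuous_on_eq) (simp add: \<phi>_overlap(2)[OF c])
qed

lemmas atlas_args = atlas_conditions(1,2,3,5)

lemma topspace_A: "topspace (atlas_topology \<A>) = atlas_points \<A>"
  by (rule topspace_atlas[OF atlas_args])

lemma openin_A:
  "openin (atlas_topology \<A>) S \<longleftrightarrow> S \<subseteq> atlas_points \<A> \<and> (\<forall>(V, \<psi>)\<in>\<A>. open {u \<in> V. \<psi> u \<in> S})"
  by (rule openin_atlas[OF atlas_args])

lemma continuous_map_\<phi>: "c \<in> CH \<Longrightarrow> continuous_map (top_of_set (D c)) (atlas_topology \<A>) (\<phi> c)"
  by (rule chart_continuous_map[OF atlas_args]) auto

text \<open>A closed equality relation gives both the Hausdorff property and the limit argument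
  behind properness.\<close>

lemma closed_pt_eq:
  assumes c: "c \<in> CH" "c' \<in> CH"
  shows "closed {x. pt c (fst x) = pt c' (snd x)}"
proof -
  have cx: "continuous_on UNIV (\<lambda>x :: (real^'d) \<times> (real^'d). xc c n (fst x) a)" for c n a
    by (rule continuous_on_compose2[of UNIV "\<lambda>v. xc c n v a"])
      (auto intro!: continuous_at_imp_continuous_on isCont_chart_coord continuous_intros)
  have cx': "continuous_on UNIV (\<lambda>x :: (real^'d) \<times> (real^'d). xc c n (snd x) a)" for c n a
    by (rule continuous_on_compose2[of UNIV "\<lambda>v. xc c n v a"])
      (auto intro!: continuous_at_imp_continuous_on isCont_chart_coord continuous_intros)
  have "closed {x. G c (fst x) = G c' (snd x)}"
    using c by (intro closed_Collect_eq continuous_intros)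
  moreover have "closed {x. xc c n (fst x) a * xc c' n (snd x) b = xc c n (fst x) b * xc c' n (snd x) a}" for n a b
    by (intro closed_Collect_eq continuous_on_mult cx cx')
  ultimately have "closed ({x. G c (fst x) = G c' (snd x)} \<inter>
      (\<Inter>n\<in>{1..m}. \<Inter>a. \<Inter>b. {x. xc c n (fst x) a * xc c' n (snd x) b = xc c n (fst x) b * xc c' n (snd x) a}))"
    by (intro closed_Int closed_INT ballI) auto
  then show ?thesis unfolding pt_eq_iff_cross[OF c]
    by (rule back_subst[of closed]) auto
qed

lemma manifold: "analytic_manifold \<A>"
  unfolding analytic_manifold_def
proof (intro conjI)
  show "\<forall>(V, \<psi>)\<in>\<A>. open V \<and> inj_on \<psi> V" using atlas_conditions(1,2) by blast
  show "\<forall>(V, \<psi>)\<in>\<A>. \<forall>(V', \<psi>')\<in>\<A>. open {u \<in> V. \<psi> u \<in> \<psi>' ` V'} \<and>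
      analytic_map_on (inv_into V' \<psi>' \<circ> \<psi>) {u \<in> V. \<psi> u \<in> \<psi>' ` V'}"
  proof safe
    fix c c' assume "c \<in> CH" "c' \<in> CH"
    then have "(D c, \<phi> c) \<in> \<A>" "(D c', \<phi> c') \<in> \<A>" by auto
    from atlas_conditions(3,4)[OF this]
    show "open {u \<in> D c. \<phi> c u \<in> \<phi> c' ` D c'}"
      "analytic_map_on (inv_into (D c') (\<phi> c') \<circ> \<phi> c) {u \<in> D c. \<phi> c u \<in> \<phi> c' ` D c'}" .
  qed
  show "second_countable (atlas_topology \<A>)"
    by (rule second_countable_atlas[OF atlas_args]) (use finite_blowup_charts in auto)
  show "Hausdorff_space (atlas_topology \<A>)"
  proof (rule Hausdorff_atlas[OF atlas_args])
    fix V \<psi> u V' \<psi>' u'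
    assume "(V, \<psi>) \<in> \<A>" "(V', \<psi>') \<in> \<A>" and u: "u \<in> V" "u' \<in> V'" and ne: "\<psi> u \<noteq> \<psi>' u'"
    then obtain c c' where c: "c \<in> CH" "c' \<in> CH" and eq: "V = D c" "\<psi> = \<phi> c" "V' = D c'" "\<psi>' = \<phi> c'" by auto
    \<comment> \<open>Distinct points lie in the open complement of the relation, and a product
      neighbourhood inside it separates them.\<close>
    have mem: "(u, u') \<in> - {x. pt c (fst x) = pt c' (snd x)}" using ne \<phi>_eq_iff[OF c(1)] unfolding eq by simp
    have op: "open (- {x. pt c (fst x) = pt c' (snd x)})" using closed_pt_eq[OF c] by auto
    obtain A B where AB: "open A" "open B" "(u, u') \<in> A \<times> B" "A \<times> B \<subseteq> - {x. pt c (fst x) = pt c' (snd x)}"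
      by (rule open_prod_elim[OF op mem])
    then have "\<forall>w\<in>A. \<forall>w'\<in>B. pt c w \<noteq> pt c' w'" by force
    then show "\<exists>U U'. open U \<and> open U' \<and> u \<in> U \<and> u' \<in> U' \<and> (\<forall>w\<in>U \<inter> V. \<forall>w'\<in>U' \<inter> V'. \<psi> w \<noteq> \<psi>' w')"
      using AB \<phi>_eq_iff[OF c(1)] unfolding eq by (intro exI[of _ A] exI[of _ B]) auto
  qed
qed

section \<open>Compactness, properness and the isomorphism off the zeros\<close>

abbreviation "cube \<equiv> {v :: real^'d. \<forall>l. \<bar>v $ l\<bar> \<le> 1}"

lemma compact_cube: "compact cube"
proof -
  have "cube = cbox (- 1) 1" by (auto simp: mem_box_cart abs_le_iff minus_le_iff)
  then show ?thesis by simp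
qed

lemma W_le_1:
  assumes "\<theta> \<in> W"
  shows "\<bar>\<theta> $ k\<bar> \<le> 1"
proof -
  have "\<bar>\<theta> $ k\<bar> < \<epsilon>" using assms by (simp add: W_def)
  then show ?thesis using \<epsilon>(2) by linarith
qed

text \<open>Off the origin this is the covering of the unit cube by the chart cubes. The points with
  a representative in a fixed compact cube form a closed set, and every point is a limit of points
  off the origin.\<close>

lemma atlas_points_cube:
  assumes c: "c \<in> CH" and u: "u \<in> D c"
  shows "\<exists>c'\<in>CH. \<exists>v\<in>cube. \<phi> c u = \<phi> c' v"
proof -
  define P where "P c' = {w. \<exists>v\<in>cube. pt c w = pt c' v}" for c'
  have closedP: "closed (P c')" if c': "c' \<in> CH" for c'
    unfolding closed_sequential_limits
  proof (intro allI impI)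
    fix w l assume wl: "(\<forall>n. w n \<in> P c') \<and> w \<longlonglongrightarrow> l"
    then obtain v where v: "\<And>n. v n \<in> cube" "\<And>n. pt c (w n) = pt c' (v n)" unfolding P_def by (auto) metis
    obtain v0 r where r: "v0 \<in> cube" "strict_mono (r :: nat \<Rightarrow> nat)" "(v \<circ> r) \<longlonglongrightarrow> v0"
      using compact_cube v(1) unfolding compact_def by meson
    have "(\<lambda>n. (w (r n), v (r n))) \<longlonglongrightarrow> (l, v0)"
      using LIMSEQ_subseq_LIMSEQ[OF conjunct2[OF wl] r(2)] r(3) by (intro tendsto_Pair) (simp_all add: o_def)
    then have "(l, v0) \<in> {x. pt c (fst x) = pt c' (snd x)}"
      using closed_pt_eq[OF c c'] v(2) by (elim closed_sequentially[rotated 2]) auto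
    then show "l \<in> P c'" unfolding P_def using r(1) by auto
  qed
  have cl: "closed (\<Union>c'\<in>CH. P c')" using finite_blowup_charts closedP by (intro closed_UN) auto
  let ?\<gamma> = "\<lambda>t :: real. u + t *\<^sub>R 1"
  have lim: "(?\<gamma> \<longlongrightarrow> u) (at_right 0)" by (rule tendsto_diagonal)
  have "\<forall>\<^sub>F t in at_right 0. ?\<gamma> t \<in> D c" using topological_tendstoD[OF lim open_D[OF c] u] .
  then have "\<forall>\<^sub>F t in at_right 0. ?\<gamma> t \<in> (\<Union>c'\<in>CH. P c')"
    using eventually_chart_map_nonzero[OF c, of u]
  proof eventually_elim
    case (elim t)
    have "\<And>k. \<bar>G c (?\<gamma> t) $ k\<bar> \<le> 1" using elim(1) W_le_1 unfolding D_def by blast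
    from chart_cube_cover[OF this] obtain c' v where "c' \<in> CH" "v \<in> cube" "G c' v = G c (?\<gamma> t)" by auto
    then have "c' \<in> CH" "v \<in> cube" "pt c (?\<gamma> t) = pt c' v" using pt_eq_of_G_eq[OF c _ _ elim(2)] by auto
    then show ?case unfolding P_def by blast
  qed
  from Lim_in_closed_set[OF cl this trivial_limit_at_right_real lim]
  show ?thesis unfolding P_def using \<phi>_eq_iff[OF c] by blast
qed

lemma points_eq: "atlas_points \<A> = (\<Union>c\<in>CH. \<phi> c ` D c)"
  unfolding atlas_points_def by auto

lemma g_image: "g ` atlas_points \<A> = W"
proof
  show "g ` atlas_points \<A> \<subseteq> W" unfolding points_eq by (auto simp: g_\<phi> D_def)
  show "W \<subseteq> g ` atlas_points \<A>"
  proof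
    fix \<theta> assume \<theta>: "\<theta> \<in> W"
    obtain c v where cv: "c \<in> CH" "G c v = \<theta>" using chart_cube_cover[OF W_le_1[OF \<theta>]] by blast
    then have "v \<in> D c" using \<theta> by (simp add: D_def)
    then have mem: "\<phi> c v \<in> atlas_points \<A>" unfolding points_eq using cv by blast
    have eq: "\<theta> = g (\<phi> c v)" using g_\<phi>[OF cv(1)] cv(2) by simp
    show "\<theta> \<in> g ` atlas_points \<A>" unfolding eq using mem by (rule imageI)
  qed
qed

text \<open>Over a metrizable base it suffices that preimages of compact sets are compact. Such a
  preimage is a finite union of images of compact parts of the chart cubes.\<close>

lemma g_proper: "proper_map (atlas_topology \<A>) (top_of_set W) g"
proof (rule compact_imp_proper_map)
  show "k_space (top_of_set W)"
    by (intro metrizable_imp_k_space metrizable_space_subtopology metrizable_space_euclidean)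
  show "kc_space (top_of_set W)"
    by (intro kc_space_subtopology kc_space_euclidean)
  show "g \<in> topspace (atlas_topology \<A>) \<rightarrow> topspace (top_of_set W)"
    using g_image unfolding topspace_A by auto
  have "continuous_map (atlas_topology \<A>) (top_of_set W) g"
    unfolding continuous_map_def topspace_A
  proof (intro conjI allI impI)
    show "g \<in> atlas_points \<A> \<rightarrow> topspace (top_of_set W)" using g_image by auto
    fix U assume "openin (top_of_set W) U"
    then have U: "open U" "U \<subseteq> W" using open_W openin_open_eq by blast+
    show "openin (atlas_topology \<A>) {x \<in> atlas_points \<A>. g x \<in> U}"
      unfolding openin_A
    proof (intro conjI ballI, goal_cases)
      case (2 x)
      then obtain c where c: "c \<in> CH" "x = (D c, \<phi> c)" by auto
      have "{u \<in> D c. \<phi> c u \<in> {x \<in> atlas_points \<A>. g x \<in> U}} = G c -` U"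
        unfolding points_eq using c U(2) by (auto simp: g_\<phi> D_def)
      moreover have "continuous_on UNIV (G c)" using isCont_chart_map[OF c(1)] by (intro continuous_at_imp_continuous_on) auto
      ultimately show ?case unfolding c(2) using U(1) by (simp add: open_vimage)
    qed auto
  qed
  then show "continuous_map (atlas_topology \<A>) (top_of_set W) g \<or> kc_space (atlas_topology \<A>)" by blast
  fix C assume C: "compactin (top_of_set W) C"
  then have C': "compact C" "C \<subseteq> W" by (auto simp: compactin_subtopology)
  have "{x \<in> topspace (atlas_topology \<A>). g x \<in> C} = \<Union> ((\<lambda>c. \<phi> c ` {v \<in> cube. G c v \<in> C}) ` CH)"
  proof (intro set_eqI iffI)
    fix x assume "x \<in> {x \<in> topspace (atlas_topology \<A>). g x \<in> C}"
    then obtain c u where cu: "c \<in> CH" "u \<in> D c" "x = \<phi> c u" "g x \<in> C" unfolding topspace_A points_eq by auto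
    obtain c' v where "c' \<in> CH" "v \<in> cube" "x = \<phi> c' v" using atlas_points_cube[OF cu(1,2)] cu(3) by blast
    then show "x \<in> \<Union> ((\<lambda>c. \<phi> c ` {v \<in> cube. G c v \<in> C}) ` CH)" using cu(4) g_\<phi> by auto
  next
    fix x assume "x \<in> \<Union> ((\<lambda>c. \<phi> c ` {v \<in> cube. G c v \<in> C}) ` CH)"
    then obtain c v where cv: "c \<in> CH" "G c v \<in> C" "x = \<phi> c v" by auto
    then have "v \<in> D c" using C'(2) by (auto simp: D_def)
    then show "x \<in> {x \<in> topspace (atlas_topology \<A>). g x \<in> C}" unfolding topspace_A points_eq using cv g_\<phi> by auto
  qed
  moreover have "compactin (atlas_topology \<A>) (\<phi> c ` {v \<in> cube. G c v \<in> C})" if c: "c \<in> CH" for c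
  proof (rule image_compactin)
    show "continuous_map (top_of_set (D c)) (atlas_topology \<A>) (\<phi> c)" using c by (rule continuous_map_\<phi>)
    have "continuous_on UNIV (G c)" using isCont_chart_map[OF c] by (intro continuous_at_imp_continuous_on) auto
    then have "closed (G c -` C)" using C'(1) by (intro closed_vimage compact_imp_closed)
    then have "compact (cube \<inter> G c -` C)" using compact_cube by (intro compact_Int_closed)
    moreover have "cube \<inter> G c -` C = {v \<in> cube. G c v \<in> C}" by auto
    moreover have "{v \<in> cube. G c v \<in> C} \<subseteq> D c" using C'(2) by (auto simp: D_def)
    ultimately show "compactin (top_of_set (D c)) {v \<in> cube. G c v \<in> C}" by (simp add: compactin_subtopology)
  qed
  ultimately show "compactin (atlas_topology \<A>) {x \<in> topspace (atlas_topology \<A>). g x \<in> C}"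
    using finite_blowup_charts by (auto intro!: compactin_Union)
qed

lemma K_zero_on_W: "\<theta> \<in> W \<Longrightarrow> K \<theta> = 0 \<longleftrightarrow> \<theta> = 0"
  unfolding W_def using box(2) by blast

lemma g_bij: "bij_betw g {Q \<in> atlas_points \<A>. K (g Q) \<noteq> 0} {\<theta> \<in> W. K \<theta> \<noteq> 0}"
  unfolding bij_betw_def
proof
  show "inj_on g {Q \<in> atlas_points \<A>. K (g Q) \<noteq> 0}"
  proof (rule inj_onI)
    fix Q Q' assume Q: "Q \<in> {Q \<in> atlas_points \<A>. K (g Q) \<noteq> 0}" "Q' \<in> {Q \<in> atlas_points \<A>. K (g Q) \<noteq> 0}" and eq: "g Q = g Q'"
    obtain c u where c: "c \<in> CH" "u \<in> D c" "Q = \<phi> c u" using Q(1) unfolding points_eq by blast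
    obtain c' u' where c': "c' \<in> CH" "u' \<in> D c'" "Q' = \<phi> c' u'" using Q(2) unfolding points_eq by blast
    have "G c u = G c' u'" "G c u \<noteq> 0" using eq Q(1) c c' K_zero by (auto simp: g_\<phi>)
    then show "Q = Q'" using pt_eq_of_G_eq[OF c(1) c'(1)] \<phi>_eq_iff[OF c(1)] c(3) c'(3) by simp
  qed
  show "g ` {Q \<in> atlas_points \<A>. K (g Q) \<noteq> 0} = {\<theta> \<in> W. K \<theta> \<noteq> 0}" using g_image by auto
qed

lemma g_diffeo:
  assumes c: "c \<in> CH"
  shows "analytic_diffeo_on (g \<circ> \<phi> c) {u \<in> D c. K (g (\<phi> c u)) \<noteq> 0}"
proof -
  let ?V = "{u \<in> D c. K (g (\<phi> c u)) \<noteq> 0}"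
  have V: "?V = G c -` (W - {0})"
    using K_zero_on_W by (auto simp: g_\<phi>[OF c] D_def)
  have gG: "(g \<circ> \<phi> c) = G c" using g_\<phi>[OF c] by auto
  have cont: "continuous_on UNIV (G c)" using isCont_chart_map[OF c] by (intro continuous_at_imp_continuous_on) auto
  have opV: "open ?V" unfolding V using cont open_W by (intro open_vimage) auto
  have inj: "inj_on (G c) ?V"
  proof (rule inj_onI)
    fix u u' assume "u \<in> ?V" "u' \<in> ?V" "G c u = G c u'"
    then have "pt c u = pt c u'" unfolding V by (intro pt_eq_of_G_eq[OF c c]) auto
    then show "u = u'" by (rule pt_inj[OF c])
  qed
  \<comment> \<open>The inverse of the chart map, read off from the homogeneous coordinates of the
    image; analytic as long as the pivots do not vanish.\<close>
  define S where "S \<theta> = (\<chi> k. if src c k = 0 then \<theta> $ k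
      else hom_coord R (src c k) \<theta> k * inverse (hom_coord R (src c k) \<theta> (piv c (src c k))))" for \<theta> :: "real^'d"
  have S: "S (G c u) = u" if "G c u \<noteq> 0" for u
  proof -
    have "S (G c u) $ k = u $ k" for k
    proof (cases "src c k = 0")
      case True
      then show ?thesis using src_zero[OF c True] by (simp add: S_def)
    next
      case False
      then have n: "1 \<le> src c k" "src c k \<le> m" using src_le[OF c] by auto
      have "hom_coord R (src c k) (G c u) k = hom_coord R (src c k) (G c u) (piv c (src c k)) * u $ k"
        using hom_G[OF c n, of u k] src_pos[OF c n(1)] by simp
      then show ?thesis using False G_pivot_nonzero(2)[OF c n that] by (simp add: S_def)
    qed
    then show ?thesis by (simp add: vec_eq_iff)
  qed
  have im: "G c ` ?V = W \<inter> (\<Inter>n\<in>{1..m}. {\<theta>. \<theta> $ piv c n \<noteq> 0})"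
  proof (intro set_eqI iffI)
    fix \<theta> assume "\<theta> \<in> G c ` ?V"
    then show "\<theta> \<in> W \<inter> (\<Inter>n\<in>{1..m}. {\<theta>. \<theta> $ piv c n \<noteq> 0})" unfolding V using G_pivot_nonzero(1)[OF c] by auto
  next
    fix \<theta> assume \<theta>: "\<theta> \<in> W \<inter> (\<Inter>n\<in>{1..m}. {\<theta>. \<theta> $ piv c n \<noteq> 0})"
    then obtain v where v: "G c v = \<theta>" using G_surj[OF c, of \<theta>] by auto
    have "\<theta> $ piv c 1 \<noteq> 0" using \<theta> m1 by auto
    then have "\<theta> \<noteq> 0" by auto
    then show "\<theta> \<in> G c ` ?V" unfolding V using v \<theta> by auto
  qed
  have opim: "open (G c ` ?V)"
    unfolding im by (intro open_Int open_W open_INT ballI open_Collect_neq continuous_intros) auto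
  have an_hom: "real_analytic_at (\<lambda>\<theta>. hom_coord R n \<theta> a) \<theta>" for n a and \<theta> :: "real^'d"
    unfolding hom_coord_def by (cases "a \<in> R") (auto intro: real_analytic_at_power real_analytic_at_coord)
  have an: "real_analytic_at (\<lambda>\<theta>. S \<theta> $ k) \<theta>" if \<theta>: "\<theta> \<in> G c ` ?V" for \<theta> k
  proof (cases "src c k = 0")
    case True
    then show ?thesis by (simp add: S_def real_analytic_at_coord)
  next
    case False
    then have n: "1 \<le> src c k" "src c k \<le> m" using src_le[OF c] by auto
    have "hom_coord R (src c k) \<theta> (piv c (src c k)) \<noteq> 0"
      using \<theta> n unfolding im by (auto simp: hom_coord_def)
    then have "real_analytic_at (\<lambda>\<theta>. hom_coord R (src c k) \<theta> k * inverse (hom_coord R (src c k) \<theta> (piv c (src c k)))) \<theta>"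
      by (intro real_analytic_at_mult real_analytic_at_inverse an_hom)
    then show ?thesis using False by (simp add: S_def)
  qed
  have inv: "inv_into ?V (G c) \<theta> = S \<theta>" if \<theta>: "\<theta> \<in> G c ` ?V" for \<theta>
  proof -
    obtain u where u: "u \<in> ?V" "\<theta> = G c u" using \<theta> by blast
    then have "G c u \<noteq> 0" unfolding V by auto
    then show ?thesis using u inj S by simp
  qed
  have "real_analytic_at (\<lambda>\<theta>. inv_into ?V (G c) \<theta> $ k) \<theta>" if "\<theta> \<in> G c ` ?V" for \<theta> k
  proof (rule real_analytic_at_cong[OF an[OF that, of k]])
    show "\<forall>\<^sub>F y in nhds \<theta>. S y $ k = inv_into ?V (G c) y $ k"
      using eventually_nhds_in_open[OF opim that] by eventually_elim (simp add: inv)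
  qed
  then show ?thesis
    unfolding analytic_diffeo_on_def gG analytic_map_on_def real_analytic_on_def
    using opV opim inj real_analytic_at_G[OF c] by auto
qed

abbreviation "T0 \<equiv> {Q \<in> atlas_points \<A>. g Q = 0}"

lemma T0_args:
  shows "T0 \<subseteq> (\<Union>c\<in>CH. \<phi> c ` D c)"
    and "c \<in> CH \<Longrightarrow> v \<in> D c \<Longrightarrow> \<phi> c v \<in> T0 \<Longrightarrow> regular_point c v"
  using points_eq all_points_regular[OF ii] g_\<phi> by auto

lemma is_resolution: "resolution_of_singularities \<A> g W K"
  unfolding resolution_of_singularities_def
proof (intro conjI)
  show "open W" by (rule open_W)
  show "real_analytic_on K W" using kl_analytic box(1) unfolding real_analytic_on_def W_def by blast
  show "\<forall>(V, \<psi>)\<in>\<A>. analytic_map_on (g \<circ> \<psi>) V"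
  proof safe
    fix c assume c: "c \<in> CH"
    have "g \<circ> \<phi> c = G c" using g_\<phi>[OF c] by auto
    then show "analytic_map_on (g \<circ> \<phi> c) (D c)"
      unfolding analytic_map_on_def real_analytic_on_def using real_analytic_at_G[OF c] by simp
  qed
  show "\<forall>(V, \<psi>)\<in>\<A>. analytic_diffeo_on (g \<circ> \<psi>) {u \<in> V. K (g (\<psi> u)) \<noteq> 0}" using g_diffeo by auto
  show "\<forall>Q\<in>atlas_points \<A>. K (g Q) = 0 \<longrightarrow> (\<exists>k h. normal_crossing \<A> g K Q k h)"
  proof (intro ballI impI)
    fix Q assume Q: "Q \<in> atlas_points \<A>" "K (g Q) = 0"
    then have "g Q = 0" using K_zero_on_W g_image by blast
    obtain c v where c: "c \<in> CH" "v \<in> D c" "Q = \<phi> c v" using Q(1) unfolding points_eq by blast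
    have "\<phi> c v \<in> T0" using Q \<open>g Q = 0\<close> c by simp
    then show "\<exists>k h. normal_crossing \<A> g K Q k h"
      unfolding c(3) using normal_crossing_exists[OF open_D g_\<phi> T0_args c(1,2)] by blast
  qed
qed (use manifold g_image g_proper g_bij in auto)

lemma rlct: "has_rlct K 0 lam 1"
proof -
  \<comment> \<open>Only the chart is needed here: its origin lies over the origin of the parameter
    space, and under (ii) every point of the fibre is regular.\<close>
  obtain c where c: "c \<in> CH" and top: "(\<exists>i. i \<notin> R \<and> c = replicate m i) \<or> R = UNIV" using TU_top by blast
  have 0: "0 \<in> W" using \<epsilon> by (simp add: W_def)
  have cd: "chart_data R m c (E c) (EN c)" using CP[OF c] unfolding chart_pivots_def by blast
  obtain e where "e \<in> E c" using chart_data_nonempty[OF cd] by blast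
  then have "G c 0 = 0" unfolding G_eq[OF c] using chart_data_bounds[OF cd] by (intro mono_map_zero) auto
  then have "0 \<in> D c" "g (\<phi> c 0) = 0" using 0 g_\<phi>[OF c] by (auto simp: D_def)
  then have "\<phi> c 0 \<in> T0" using c points_eq by auto
  note th = nc_threshold_multiplicity[OF open_D g_\<phi> T0_args this c \<open>0 \<in> D c\<close> refl top]
  show ?thesis
    unfolding has_rlct_def
    by (rule exI[of _ \<A>], rule exI[of _ g], rule exI[of _ W]) (use 0 is_resolution th in auto)
qed

end

theorem rlct_of_independent_forms:
  assumes ii: "\<forall>\<theta>. (\<exists>i. i \<notin> R \<and> \<theta> $ i \<noteq> 0) \<longrightarrow> form_independent N X p R m \<theta>"
  shows "has_rlct K 0 lam 1" and "\<exists>W. open W \<and> 0 \<in> W \<and> (\<forall>\<theta>\<in>W \<inter> \<Theta>. K \<theta> = 0 \<longleftrightarrow> \<theta> = 0)"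
proof -
  obtain \<epsilon> where \<epsilon>: "\<epsilon> > 0" "\<epsilon> \<le> 1" "\<And>\<theta>. (\<forall>k. \<bar>\<theta> $ k\<bar> < \<epsilon>) \<Longrightarrow> \<theta> \<in> W0" "\<And>\<theta>. (\<forall>k. \<bar>\<theta> $ k\<bar> < \<epsilon>) \<Longrightarrow> K \<theta> = 0 \<longleftrightarrow> \<theta> = 0"
    using K_zero_iff[OF ii] by blast
  \<comment> \<open>The four data of each chart are packed into one tuple, so that a single choice
    function provides them for all charts.\<close>
  have "\<forall>c\<in>blowup_charts R m. \<exists>x. chart_pivots c (fst x) (fst (snd x)) (fst (snd (snd x))) (snd (snd (snd x)))"
    using chart_pivots_exist by fastforce
  then obtain f where f: "\<And>c. c \<in> blowup_charts R m \<Longrightarrow>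
      chart_pivots c (fst (f c)) (fst (snd (f c))) (fst (snd (snd (f c)))) (snd (snd (snd (f c))))"
    by metis
  show "has_rlct K 0 lam 1" by (rule rlct[OF f \<epsilon> ii])
  have "open {\<theta> :: real^'d. \<forall>k. \<bar>\<theta> $ k\<bar> < \<epsilon>}"
  proof -
    have "{\<theta>. \<forall>k. \<bar>\<theta> $ k\<bar> < \<epsilon>} = (\<Inter>k\<in>UNIV. {\<theta> :: real^'d. \<bar>\<theta> $ k\<bar> < \<epsilon>})" by auto
    moreover have "open {\<theta> :: real^'d. \<bar>\<theta> $ k\<bar> < \<epsilon>}" for k by (intro open_Collect_less continuous_intros)
    ultimately show ?thesis by (simp add: open_INT)
  qed
  then show "\<exists>W. open W \<and> 0 \<in> W \<and> (\<forall>\<theta>\<in>W \<inter> \<Theta>. K \<theta> = 0 \<longleftrightarrow> \<theta> = 0)"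
    using \<epsilon> by (intro exI[of _ "{\<theta>. \<forall>k. \<bar>\<theta> $ k\<bar> < \<epsilon>}"]) auto
qed

end

theorem theorem2:
  fixes N :: "'w measure" and M :: "'x measure" and X :: "'w \<Rightarrow> 'x"
    and p :: "'x \<Rightarrow> real^'d::finite \<Rightarrow> real" and q :: "'x \<Rightarrow> real" and \<Theta> :: "(real^'d) set"
    and R :: "'d set" and r m :: nat
  assumes "realizable_model N M X p q \<Theta>"
    and "rank (fisher_information N X p) = r" and "r > 0" and "card R = r"
    and "condition_A1 N X p R"
    and "condition_A2 N X p R m"
    and "condition_A3 N X p R m"
  shows "(\<forall>Q\<in>fiber_over_origin R m - degenerate_points N X p R m.
            \<exists>k h. normal_crossing (blowup_atlas R m) (blowup_map R) (kl_div N X p) Q k h) \<and>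
         nc_threshold (blowup_atlas R m) (blowup_map R) (kl_div N X p)
             (fiber_over_origin R m - degenerate_points N X p R m) =
           ereal ((real CARD('d) - real r + real r * real m) / (2 * real m)) \<and>
         nc_multiplicity (blowup_atlas R m) (blowup_map R) (kl_div N X p)
             (fiber_over_origin R m - degenerate_points N X p R m) = 1 \<and>
         ((\<forall>\<theta>. (\<exists>i. i \<notin> R \<and> \<theta> $ i \<noteq> 0) \<longrightarrow> form_independent N X p R m \<theta>) \<longrightarrow>
            has_rlct (kl_div N X p) 0
              (ereal ((real CARD('d) - real r + real r * real m) / (2 * real m))) 1 \<and>
            (\<exists>W. open W \<and> 0 \<in> W \<and> (\<forall>\<theta>\<in>W \<inter> \<Theta>. kl_div N X p \<theta> = 0 \<longleftrightarrow> \<theta> = 0)))"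
proof -
  interpret realizable_model N M X p q \<Theta> by fact
  have "R \<noteq> {}" using assms(3,4) by auto
  then interpret semiregular N M X p q \<Theta> R m
    using assms by unfold_locales auto
  have lam: "ereal ((real CARD('d) - real r + real r * real m) / (2 * real m)) = lam"
    by (simp add: lam_def assms(4))
  show ?thesis
    unfolding lam using blowup_normal_crossings rlct_of_independent_forms by blast
qed

end
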